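(* For any $p_o, p_v \in (0,1)$ (and any law $\mathcal{L}\neq\delta_0$ on $\mathbb{R}$), there exists almost surely a self-avoiding path $\hat\eta\in\Gamma_O$ such that the sequence of partial sums $(S_n(\hat\eta):n\in\mathbb{N})$ is bounded and has zero as an accumulation point.
   Context: **Lattice and paths.** The square lattice is the graph $(\mathbb{Z}^2,E_2)$, where $E_2$ is the set of unordered pairs $\{(x_1,y_1),(x_2,y_2)\}$ of points of $\mathbb{Z}^2$ with $|x_1-x_2|+|y_1-y_2|=1$. An edge is horizontal if $|x_1-x_2|=1$ and vertical if $|y_1-y_2|=1$. The origin is $O=(0,0)$. An infinite path from $v_0\in\mathbb{Z}^2$ is an infinite sequence $\gamma=(v_0,e_1,v_1,e_2,v_2,\ldots)$ with $v_k\in\mathbb{Z}^2$ and $e_k=\{v_{k-1},v_k\}\in E_2$ for all $k\ge 1$. It is self-avoiding if all its vertices are different. $\Gamma_O$ is the set of infinite self-avoiding paths starting from $O$. **Random environment.** $\mathbf{X}=(X_e:e\in E_2)$ and $\mathbf{Y}=(Y_e:e\in E_2)$ are two families of independent random variables, $\mathbf{X}$ and $\mathbf{Y}$ being independent of each other. Each $X_e$ is real-valued with common law $\mathcal{L}\neq\delta_0$. Each $Y_e$ takes values in $\{-1,+1\}$, with $\mathbb{P}(Y_e=1)=p_o$ if $e$ is horizontal and $\mathbb{P}(Y_e=1)=p_v$ if $e$ is vertical. **Partial sums.** For a path $\gamma=(v_0,e_1,v_1,\ldots)$ with $v_k=(x_k,y_k)$, set $Z_{(v_{k-1},v_k)}=(x_k-x_{k-1}+y_k-y_{k-1})\,Y_{e_k}$,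 so that $Y_{e_k}$ is multiplied by $+1$ if $e_k$ is crossed rightward or upward and by $-1$ if it is crossed leftward or downward. Set $S_N(\gamma)=\sum_{k=1}^N Z_{(v_{k-1},v_k)}X_{e_k}$. **Convention.** Zero is an accumulation point of a real sequence if every neighborhood of $0$ contains the terms of the sequence for infinitely many indices. *)

theory Defs
  imports "HOL-Probability.Probability"
begin

type_synonym vertex = "int \<times> int"
type_synonym edge = "vertex set"

definition lattice_edges :: "edge set" where
  "lattice_edges =
     {{(x1, y1), (x2, y2)} | x1 y1 x2 y2. \<bar>x1 - x2\<bar> + \<bar>y1 - y2\<bar> = 1}"

definition horizontal_edges :: "edge set" where
  "horizontal_edges =
     {{(x1, y1), (x2, y2)} | x1 y1 x2 y2. \<bar>x1 - x2\<bar> + \<bar>y1 - y2\<bar> = 1 \<and> \<bar>x1 - x2\<bar> = 1}"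

definition vertical_edges :: "edge set" where
  "vertical_edges =
     {{(x1, y1), (x2, y2)} | x1 y1 x2 y2. \<bar>x1 - x2\<bar> + \<bar>y1 - y2\<bar> = 1 \<and> \<bar>y1 - y2\<bar> = 1}"

text \<open>An infinite path is given by its vertices \<open>\<gamma> 0, \<gamma> 1, \<dots>\<close>; its \<open>k\<close>-th edge
  (\<open>k \<ge> 1\<close>) is then determined as \<open>{\<gamma> (k - 1), \<gamma> k}\<close>.\<close>

definition path_edge :: "(nat \<Rightarrow> vertex) \<Rightarrow> nat \<Rightarrow> edge" where
  "path_edge \<gamma> k = {\<gamma> (k - 1), \<gamma> k}"

definition infinite_path_from :: "vertex \<Rightarrow> (nat \<Rightarrow> vertex) \<Rightarrow> bool" where
  "infinite_path_from v \<gamma> \<longleftrightarrow> \<gamma> 0 = v \<and> (\<forall>k\<ge>1. path_edge \<gamma> k \<in> lattice_edges)"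

definition self_avoiding_paths :: "(nat \<Rightarrow> vertex) set" where
  "self_avoiding_paths = {\<gamma>. infinite_path_from (0, 0) \<gamma> \<and> inj \<gamma>}"

text \<open>The sign of a step from \<open>u\<close> to \<open>v\<close> is \<open>1\<close> when the edge is crossed rightward or
  upward, and \<open>-1\<close> when it is crossed leftward or downward. The arguments \<open>X\<close> and \<open>Y\<close>
  are single realizations of the two fields.\<close>

definition step_sign :: "vertex \<Rightarrow> vertex \<Rightarrow> int" where
  "step_sign u v = fst v - fst u + snd v - snd u"

definition partial_sum ::
    "(edge \<Rightarrow> real) \<Rightarrow> (edge \<Rightarrow> real) \<Rightarrow> (nat \<Rightarrow> vertex) \<Rightarrow> nat \<Rightarrow> real" where
  "partial_sum X Y \<gamma> N =
     (\<Sum>k=1..N. of_int (step_sign (\<gamma> (k - 1)) (\<gamma> k)) * Y (path_edge \<gamma> k) * X (path_edge \<gamma> k))"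

text \<open>Infinitely many indices are required, not infinitely many distinct values: a sequence
  taking the value \<open>a\<close> infinitely often accumulates at \<open>a\<close>.\<close>

definition accumulation_point :: "(nat \<Rightarrow> real) \<Rightarrow> real \<Rightarrow> bool" where
  "accumulation_point s a \<longleftrightarrow> (\<forall>U. open U \<and> a \<in> U \<longrightarrow> infinite {n. s n \<in> U})"

end

theory Submission
  imports Defs
begin

text \<open>
Put \<open>w e = Y e * X e\<close>. A walk gains \<open>w e\<close> when it crosses \<open>e\<close> rightward or upward and
loses \<open>w e\<close> otherwise. The variables \<open>w e\<close> are independent, their law depends only on the
orientation of the edge, and since \<open>p_o\<close> and \<open>p_v\<close> lie strictly between 0 and 1, the two laws
have the same null sets, these are stable under negation, and 0 is not almost sure. The
argument works for every field with these properties (locale \<open>edge_field\<close>).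

Boundedness. A cell is a rectangle that a walk crosses along its bottom row, with one detour
over a hump: up a column and down the next one. As a function of the height, the contribution
of the vertical edges of a hump is a symmetric random walk. In a tall cell with many humps
some detour therefore outweighs the whole row, in either direction (\<open>hump_prob\<close>), so that with
high probability the cell can be crossed with a sum of either sign. Moving to the next row of
cells costs the sum of a column, which is much larger than what a hump is able to compensate;
but a column sum can be taken on either side of its median \<open>m\<close>. Hence a good cell can be crossed
with a change of level \<open>d\<close> in \<open>{-1, 0, 1}\<close> and a sum of the form \<open>d * m + r\<close>, where the sign of
\<open>r\<close> is prescribed and its absolute value is at least 1 (\<open>cell_crossing\<close>).

Good cells percolate: by the Lipschitz surface argument of Dirr, Dondl, Grimmett, Holroyd and
Scheutzow, good cells form the graph of a function whose increments are at most one. On a long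
block of cells whose end points are prescribed, the multiples of \<open>m\<close> telescope, while
the terms \<open>r\<close> may be chosen with constant sign and add up. So a block can be crossed with a sum
of either sign (\<open>block_crossing\<close>). Blocks are good with high probability and percolate in
turn. A walk that follows the surface of good blocks, and crosses every block with a sum
whose sign is opposite to the sum collected before, has bounded partial sums.

Accumulation at zero. Each block starts with a gadget, a hump of height one; which
blocks are good is decided without looking at the three edges of this detour. By Fubini's theorem, the walk
meets gadgets of every type of positive probability infinitely often (\<open>AE_rich\<close>), and using a
gadget changes the sum by approximately \<open>x - y\<close>, for any \<open>x\<close> and \<open>y\<close> in the support of the edge
variables. The sums at the entrances of the blocks lie in the group generated by these
differences, because all walks between two entrances have even length. The sums of the steered walk
without further gadgets come close to an element \<open>g\<close> of this group infinitely often. The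
number \<open>- g\<close> is a finite sum of differences; using the corresponding gadgets, in an
order that keeps their partial sums bounded, turns a sum close to \<open>g\<close> into a sum close to 0
(\<open>stage\<close>). Iteration with smaller and smaller errors yields the path.
\<close>

section \<open>Walks and their sums\<close>

text \<open>An edge is addressed by its left or lower end point; the flag tells whether it is
horizontal.\<close>

type_synonym env = "bool \<times> int \<times> int \<Rightarrow> real"

definition crossing :: "env \<Rightarrow> vertex \<Rightarrow> vertex \<Rightarrow> real" where
  "crossing w u v =
     (if snd u = snd v then (if fst u < fst v then w (True, u) else - w (True, v))
      else (if snd u < snd v then w (False, u) else - w (False, v)))"

definition adjacent :: "vertex \<Rightarrow> vertex \<Rightarrow> bool" where
  "adjacent u v \<longleftrightarrow> \<bar>fst u - fst v\<bar> + \<bar>snd u - snd v\<bar> = 1"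

fun walk :: "env \<Rightarrow> real \<Rightarrow> vertex \<Rightarrow> vertex list \<Rightarrow> bool" where
  "walk w k u [] \<longleftrightarrow> True"
| "walk w k u (v # p) \<longleftrightarrow> adjacent u v \<and> \<bar>crossing w u v\<bar> \<le> k \<and> walk w k v p"

fun wsum :: "env \<Rightarrow> vertex \<Rightarrow> vertex list \<Rightarrow> real" where
  "wsum w u [] = 0"
| "wsum w u (v # p) = crossing w u v + wsum w v p"

lemma last_Cons_append: "last (u # p @ q) = last (last (u # p) # q)"
  by (induction p arbitrary: u) auto

lemma walk_append: "walk w k u (p @ q) \<longleftrightarrow> walk w k u p \<and> walk w k (last (u # p)) q"
  by (induction p arbitrary: u) auto

lemma wsum_append: "wsum w u (p @ q) = wsum w u p + wsum w (last (u # p)) q"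
  by (induction p arbitrary: u) auto

lemma walk_mono: "walk w k u p \<Longrightarrow> k \<le> k' \<Longrightarrow> walk w k' u p"
  by (induction p arbitrary: u) auto

lemma wsum_prefix_bound:
  assumes "walk w k u p" "k \<ge> 0"
  shows "\<bar>wsum w u (take j p)\<bar> \<le> k * real (length p)"
  using assms
proof (induction p arbitrary: u j)
  case (Cons v p)
  show ?case
  proof (cases j)
    case 0
    then show ?thesis using Cons.prems by simp
  next
    case (Suc i)
    have "\<bar>wsum w v (take i p)\<bar> \<le> k * real (length p)" using Cons by simp
    moreover have "\<bar>crossing w u v\<bar> \<le> k" using Cons.prems by simp
    ultimately show ?thesis using Suc by (simp add: algebra_simps)
  qed
qed simp

text \<open>The lattice is bipartite. Walks between two vertices of even coordinate sum have even
length, which is why differences, and not single values, generate the sums below.\<close>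

lemma walk_parity:
  assumes "walk w k u p"
  shows "even (length p) \<longleftrightarrow> even (fst u + snd u + fst (last (u # p)) + snd (last (u # p)))"
  using assms
proof (induction p arbitrary: u)
  case (Cons v p)
  have "odd (fst u + snd u + fst v + snd v)"
  proof -
    have "odd (\<bar>fst u - fst v\<bar> + \<bar>snd u - snd v\<bar>)"
      using Cons.prems unfolding adjacent_def walk.simps by (metis odd_one)
    then show ?thesis by auto
  qed
  moreover have "even (length p) \<longleftrightarrow>
      even (fst v + snd v + fst (last (v # p)) + snd (last (v # p)))"
    using Cons by simp
  ultimately show ?case by (simp add: even_add) blast
qed simp

text \<open>A self-avoiding walk from \<open>u\<close> to \<open>v\<close> with sum
\<open>s\<close>, of which only what matters for concatenation is recorded: the region
\<open>A\<close> that contains all vertices except the first, a bound for the length and a bound for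
the single steps. Together the two bounds control all partial sums.\<close>

definition conn :: "env \<Rightarrow> real \<Rightarrow> nat \<Rightarrow> vertex set \<Rightarrow> vertex \<Rightarrow> vertex \<Rightarrow> real \<Rightarrow> bool" where
  "conn w k L A u v s \<longleftrightarrow> (\<exists>p. walk w k u p \<and> last (u # p) = v \<and> distinct p \<and> set p \<subseteq> A \<and>
     length p \<le> L \<and> wsum w u p = s)"

lemma conn_refl: "conn w k 0 {} u u 0"
  unfolding conn_def by (rule exI[of _ "[]"]) simp

lemma conn_single:
  "adjacent u v \<Longrightarrow> \<bar>crossing w u v\<bar> \<le> k \<Longrightarrow> conn w k 1 {v} u v (crossing w u v)"
  unfolding conn_def by (rule exI[of _ "[v]"]) simp

lemma conn_append:
  assumes "conn w k L A u v s" "conn w k L' A' v z s'" "A \<inter> A' = {}"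
  shows "conn w k (L + L') (A \<union> A') u z (s + s')"
proof -
  obtain p q where p: "walk w k u p" "last (u # p) = v" "distinct p" "set p \<subseteq> A"
      "length p \<le> L" "wsum w u p = s"
    and q: "walk w k v q" "last (v # q) = z" "distinct q" "set q \<subseteq> A'"
      "length q \<le> L'" "wsum w v q = s'"
    using assms unfolding conn_def by blast
  have "last (u # p @ q) = z" using p q unfolding last_Cons_append by simp
  then show ?thesis
    unfolding conn_def using p q assms(3)
    by (intro exI[of _ "p @ q"]) (auto simp: walk_append wsum_append)
qed

lemma conn_mono:
  assumes "conn w k L A u v s" "k \<le> k'" "L \<le> L'" "A \<subseteq> A'"
  shows "conn w k' L' A' u v s"
proof -
  obtain p where "walk w k u p" "last (u # p) = v" "distinct p" "set p \<subseteq> A"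
      "length p \<le> L" "wsum w u p = s"
    using assms(1) unfolding conn_def by blast
  then show ?thesis
    unfolding conn_def using assms(2-4) walk_mono by (intro exI[of _ p]) auto
qed

lemma conn_append':
  assumes "conn w k L A u v s" "conn w k L' A' v z s'" "A \<inter> A' = {}"
    "L + L' = L''" "A \<union> A' \<subseteq> A''" "s + s' = s''"
  shows "conn w k L'' A'' u z s''"
  using conn_mono[OF conn_append[OF assms(1-3)]] assms(4-6) by auto

lemma conn_row:
  assumes "p \<le> q" "\<And>i. i \<in> {p..<q} \<Longrightarrow> \<bar>w (True, x + int i, y)\<bar> \<le> k"
  shows "conn w k (q - p) ({x + int p<..x + int q} \<times> {y}) (x + int p, y) (x + int q, y)
    (\<Sum>i=p..<q. w (True, x + int i, y))"
  using assms
proof (induction q rule: dec_induct)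
  case base
  then show ?case using conn_refl by simp
next
  case (step q)
  have "conn w k 1 {(x + int (Suc q), y)} (x + int q, y) (x + int (Suc q), y) (w (True, x + int q, y))"
    using conn_single[of "(x + int q, y)" "(x + int (Suc q), y)" w k] step.prems[of q] step.hyps
    by (simp add: adjacent_def crossing_def)
  note edge = this
  show ?case
    by (rule conn_append'[OF step.IH edge]) (use step.prems step.hyps in auto)
qed

lemma conn_up:
  assumes "\<And>i. i < t \<Longrightarrow> \<bar>w (False, x, y + int i)\<bar> \<le> k"
  shows "conn w k t ({x} \<times> {y<..y + int t}) (x, y) (x, y + int t) (\<Sum>i<t. w (False, x, y + int i))"
  using assms
proof (induction t)
  case 0
  then show ?case using conn_refl by simp
next
  case (Suc t)
  have "conn w k 1 {(x, y + int (Suc t))} (x, y + int t) (x, y + int (Suc t)) (w (False, x, y + int t))"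
    using conn_single[of "(x, y + int t)" "(x, y + int (Suc t))" w k] Suc.prems[of t]
    by (simp add: adjacent_def crossing_def)
  note step = this
  show ?case
    by (rule conn_append'[OF Suc.IH step]) (use Suc.prems in auto)
qed

lemma conn_down:
  assumes "\<And>i. i < t \<Longrightarrow> \<bar>w (False, x, y + int i)\<bar> \<le> k"
  shows "conn w k t ({x} \<times> {y..<y + int t}) (x, y + int t) (x, y) (- (\<Sum>i<t. w (False, x, y + int i)))"
  using assms
proof (induction t)
  case 0
  then show ?case using conn_refl by simp
next
  case (Suc t)
  have "conn w k 1 {(x, y + int t)} (x, y + int (Suc t)) (x, y + int t) (- w (False, x, y + int t))"
    using conn_single[of "(x, y + int (Suc t))" "(x, y + int t)" w k] Suc.prems[of t]
    by (simp add: adjacent_def crossing_def)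
  note step = this
  show ?case
    by (rule conn_append'[OF step Suc.IH]) (use Suc.prems in auto)
qed

text \<open>The contribution of the two columns of a hump of height \<open>t\<close>, its top edge
excluded.\<close>

definition height_gap :: "env \<Rightarrow> int \<Rightarrow> int \<Rightarrow> nat \<Rightarrow> real" where
  "height_gap w x y t = (\<Sum>i<t. w (False, x, y + int i) - w (False, x + 1, y + int i))"

lemma conn_hump:
  assumes "\<And>i. i < t \<Longrightarrow> \<bar>w (False, x, y + int i)\<bar> \<le> k"
    and "\<And>i. i < t \<Longrightarrow> \<bar>w (False, x + 1, y + int i)\<bar> \<le> k"
    and "\<bar>w (True, x, y + int t)\<bar> \<le> k"
  shows "conn w k (2 * t + 1) ({x} \<times> {y<..} \<union> {x + 1} \<times> UNIV) (x, y) (x + 1, y)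
    (height_gap w x y t + w (True, x, y + int t))"
proof -
  have top: "conn w k 1 {(x + 1, y + int t)} (x, y + int t) (x + 1, y + int t) (w (True, x, y + int t))"
    using conn_single[of "(x, y + int t)" "(x + 1, y + int t)" w k] assms(3)
    by (simp add: adjacent_def crossing_def)
  have "conn w k (1 + t) ({(x + 1, y + int t)} \<union> {x + 1} \<times> {y..<y + int t}) (x, y + int t) (x + 1, y)
      (w (True, x, y + int t) + - (\<Sum>i<t. w (False, x + 1, y + int i)))"
  proof (rule conn_append[OF top])
    show "conn w k t ({x + 1} \<times> {y..<y + int t}) (x + 1, y + int t) (x + 1, y)
        (- (\<Sum>i<t. w (False, x + 1, y + int i)))"
      by (rule conn_down) (rule assms(2))
  qed auto
  note tail = this
  have "conn w k t ({x} \<times> {y<..y + int t}) (x, y) (x, y + int t) (\<Sum>i<t. w (False, x, y + int i))"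
    by (rule conn_up) (rule assms(1))
  note up = this
  show ?thesis by (rule conn_append'[OF up tail])
    (auto simp: height_gap_def sum_subtractf)
qed

section \<open>Lipschitz percolation\<close>

text \<open>Sites of the plane are open or closed. A blocking walk, read from its end back to its
beginning, comes from a site on or below the graph of \<open>b\<close>, may step diagonally
downwards for free, and may step upwards only onto a closed site. The lowest sites above all
blocking walks form an open Lipschitz graph: a closed site there would permit one more upward step,
and a jump larger than one would be bridged by a free step.\<close>

fun step_back :: "int \<Rightarrow> int \<times> int \<Rightarrow> int \<times> int" where
  "step_back m (x, h) = (x + m, if m = 0 then h - 1 else h + 1)"

fun blocking_walk :: "(int \<times> int \<Rightarrow> bool) \<Rightarrow> (int \<Rightarrow> int) \<Rightarrow> int \<times> int \<Rightarrow> int list \<Rightarrow> bool" where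
  "blocking_walk cl b z [] \<longleftrightarrow> snd z \<le> b (fst z)"
| "blocking_walk cl b z (m # ms) \<longleftrightarrow>
     (m = 0 \<longrightarrow> cl z) \<and> m \<in> {-1, 0, 1} \<and> blocking_walk cl b (step_back m z) ms"

fun climbs :: "int \<times> int \<Rightarrow> int list \<Rightarrow> (int \<times> int) list" where
  "climbs z [] = []"
| "climbs z (m # ms) = (if m = 0 then [z] else []) @ climbs (step_back m z) ms"

definition blocked :: "(int \<times> int \<Rightarrow> bool) \<Rightarrow> (int \<Rightarrow> int) \<Rightarrow> int \<times> int \<Rightarrow> bool" where
  "blocked cl b z \<longleftrightarrow> (\<exists>ms. blocking_walk cl b z ms)"

lemma blocked_base: "h \<le> b x \<Longrightarrow> blocked cl b (x, h)"
  unfolding blocked_def by (rule exI[of _ "[]"]) simp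

lemma blocked_climb: "blocked cl b (x, h) \<Longrightarrow> cl (x, h + 1) \<Longrightarrow> blocked cl b (x, h + 1)"
  unfolding blocked_def by (auto intro: exI[of _ "0 # ms" for ms])

lemma blocked_right: "blocked cl b (x, h) \<Longrightarrow> blocked cl b (x + 1, h - 1)"
  unfolding blocked_def by (auto intro: exI[of _ "-1 # ms" for ms])

lemma blocked_left: "blocked cl b (x, h) \<Longrightarrow> blocked cl b (x - 1, h - 1)"
  unfolding blocked_def by (auto intro: exI[of _ "1 # ms" for ms])

lemma climbs_suffix:
  "u \<in> set (climbs z ms) \<Longrightarrow> blocking_walk cl b z ms
    \<Longrightarrow> \<exists>ms'. length ms' \<le> length ms \<and> blocking_walk cl b u ms'"
proof (induction ms arbitrary: z)
  case (Cons m ms)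
  show ?case
  proof (cases "m = 0 \<and> u = z")
    case True
    then show ?thesis using Cons.prems by blast
  next
    case False
    then have "u \<in> set (climbs (step_back m z) ms)" using Cons.prems by (auto split: if_splits)
    then obtain ms' where "length ms' \<le> length ms" "blocking_walk cl b u ms'"
      using Cons.IH[of "step_back m z"] Cons.prems(2) by auto
    then show ?thesis by (intro exI[of _ ms']) auto
  qed
qed simp

text \<open>Between two visits of the same climbed site a shortest walk could be cut. Distinct
climbs are what makes the union bound below multiplicative.\<close>

lemma distinct_climbs_shortest:
  assumes "blocking_walk cl b z ms"
    and "\<And>ms'. blocking_walk cl b z ms' \<Longrightarrow> length ms \<le> length ms'"
  shows "distinct (climbs z ms)"
  using assms
proof (induction ms arbitrary: z)
  case (Cons m ms)
  have walk: "blocking_walk cl b (step_back m z) ms" using Cons.prems(1) by simp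
  have "length ms \<le> length ms'" if "blocking_walk cl b (step_back m z) ms'" for ms'
    using Cons.prems(2)[of "m # ms'"] Cons.prems(1) that by simp
  then have "distinct (climbs (step_back m z) ms)" by (intro Cons.IH walk) auto
  moreover have "z \<notin> set (climbs (step_back m z) ms)"
  proof
    assume "z \<in> set (climbs (step_back m z) ms)"
    then obtain ms' where "length ms' \<le> length ms" "blocking_walk cl b z ms'"
      using climbs_suffix[OF _ walk] by blast
    then show False using Cons.prems(2)[of ms'] by simp
  qed
  ultimately show ?case by (cases "m = 0") auto
qed simp

lemma blocked_obtain_distinct:
  assumes "blocked cl b z"
  obtains ms where "blocking_walk cl b z ms" "distinct (climbs z ms)"
proof -
  let ?n = "LEAST n. \<exists>ms. blocking_walk cl b z ms \<and> length ms = n"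
  have "\<exists>n ms. blocking_walk cl b z ms \<and> length ms = n"
    using assms unfolding blocked_def by blast
  then have "\<exists>ms. blocking_walk cl b z ms \<and> length ms = ?n"
    by (rule LeastI_ex)
  then obtain ms where ms: "blocking_walk cl b z ms" "length ms = ?n" by blast
  have "length ms \<le> length ms'" if "blocking_walk cl b z ms'" for ms'
    unfolding ms(2) by (rule Least_le) (use that in blast)
  then have "distinct (climbs z ms)" by (rule distinct_climbs_shortest[OF ms(1)])
  then show ?thesis using that ms by blast
qed

lemma blocking_walk_moves: "blocking_walk cl b z ms \<Longrightarrow> set ms \<subseteq> {-1, 0, 1}"
proof (induction ms arbitrary: z)
  case (Cons m ms)
  then show ?case using Cons.IH[of "step_back m z"] by simp
qed simp

lemma blocking_walk_climbs_closed:
  "blocking_walk cl b z ms \<Longrightarrow> u \<in> set (climbs z ms) \<Longrightarrow> cl u"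
  by (induction ms arbitrary: z) (auto split: if_splits)

text \<open>A free step loses height one, whereas \<open>b\<close> changes by about one half only: a
walk that ends above the graph of \<open>b\<close> has climbs as a fixed fraction of its
steps.\<close>

lemma climbs_lower_bound:
  assumes "blocking_walk cl b (x, h) ms"
    and slope: "\<And>x y. 2 * \<bar>b x - b y\<bar> \<le> \<bar>x - y\<bar> + 1"
  shows "2 * (h - b x) + int (length ms) \<le> 3 * int (length (climbs (x, h) ms)) + 1"
proof -
  have "\<exists>x' h'. h' \<le> b x' \<and>
      h' = h + int (length ms) - 2 * int (length (climbs (x, h) ms)) \<and>
      \<bar>x - x'\<bar> \<le> int (length ms) - int (length (climbs (x, h) ms))"
    using assms(1)
  proof (induction ms arbitrary: x h)
    case (Cons m ms)
    obtain x1 h1 where z1: "step_back m (x, h) = (x1, h1)" by (cases "step_back m (x, h)")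
    have "blocking_walk cl b (x1, h1) ms" using Cons.prems z1 by simp
    from Cons.IH[OF this] obtain x' h' where *: "h' \<le> b x'"
      "h' = h1 + int (length ms) - 2 * int (length (climbs (x1, h1) ms))"
      "\<bar>x1 - x'\<bar> \<le> int (length ms) - int (length (climbs (x1, h1) ms))" by blast
    define N U where "N = int (length ms)" and "U = int (length (climbs (x1, h1) ms))"
    note * = *[folded N_def U_def]
    have len: "int (length (m # ms)) = N + 1"
      "int (length (climbs (x, h) (m # ms))) = (if m = 0 then U + 1 else U)"
      using z1 unfolding N_def U_def by auto
    consider "m = 0" "x1 = x" "h1 = h - 1" | "m \<noteq> 0" "\<bar>x - x1\<bar> = 1" "h1 = h + 1"
      using z1 Cons.prems by (auto split: if_splits)
    then show ?case
      unfolding len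
    proof cases
      case 1
      then show "\<exists>x' h'. h' \<le> b x' \<and> h' = h + (N + 1) - 2 * (if m = 0 then U + 1 else U) \<and>
          \<bar>x - x'\<bar> \<le> N + 1 - (if m = 0 then U + 1 else U)"
        using * by (intro exI[of _ x'] exI[of _ h']) simp
    next
      case 2
      then show "\<exists>x' h'. h' \<le> b x' \<and> h' = h + (N + 1) - 2 * (if m = 0 then U + 1 else U) \<and>
          \<bar>x - x'\<bar> \<le> N + 1 - (if m = 0 then U + 1 else U)"
        using * by (intro exI[of _ x'] exI[of _ h']) simp
    qed
  qed simp
  then obtain x' h' where *: "h' \<le> b x'"
      "h' = h + int (length ms) - 2 * int (length (climbs (x, h) ms))"
      "\<bar>x - x'\<bar> \<le> int (length ms) - int (length (climbs (x, h) ms))" by blast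
  define N U where "N = int (length ms)" and "U = int (length (climbs (x, h) ms))"
  have "2 * (b x' - b x) \<le> \<bar>x - x'\<bar> + 1"
    using slope[of x x'] by (simp add: abs_if split: if_splits)
  also have "\<dots> \<le> N - U + 1" using *(3) unfolding N_def U_def by simp
  finally show ?thesis using *(1,2) unfolding N_def[symmetric] U_def[symmetric] by presburger
qed

definition surface :: "(int \<times> int \<Rightarrow> bool) \<Rightarrow> (int \<Rightarrow> int) \<Rightarrow> int \<Rightarrow> int" where
  "surface cl b x = b x + 1 + int (GREATEST s. blocked cl b (x, b x + int s))"

definition finite_height :: "(int \<times> int \<Rightarrow> bool) \<Rightarrow> (int \<Rightarrow> int) \<Rightarrow> int \<Rightarrow> bool" where
  "finite_height cl b x \<longleftrightarrow> (\<exists>s0. \<forall>s\<ge>s0. \<not> blocked cl b (x, b x + int s))"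

lemma surface_eqI:
  assumes "finite_height cl b x"
  shows "surface cl b x = h \<longleftrightarrow>
    h > b x \<and> blocked cl b (x, h - 1) \<and> (\<forall>h'\<ge>h. \<not> blocked cl b (x, h'))"
proof -
  let ?P = "\<lambda>s. blocked cl b (x, b x + int s)"
  let ?g = "Greatest ?P"
  obtain s0 where s0: "\<forall>s\<ge>s0. \<not> ?P s" using assms unfolding finite_height_def by blast
  have P0: "?P 0" by (intro blocked_base) simp
  have bd: "\<And>s. ?P s \<Longrightarrow> s \<le> s0" using s0 by (meson nle_le)
  have g: "?P ?g" by (rule GreatestI_nat[of ?P 0 s0, OF P0 bd])
  have top: "\<And>s. ?P s \<Longrightarrow> s \<le> ?g" by (rule Greatest_le_nat[of ?P _ s0]) (use bd in auto)
  have top': "\<not> blocked cl b (x, h')" if "h' \<ge> b x + 1 + int ?g" for h'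
  proof
    assume a: "blocked cl b (x, h')"
    have "h' = b x + int (nat (h' - b x))" using that by simp
    then have "nat (h' - b x) \<le> ?g" using a by (intro top) simp
    then show False using that by linarith
  qed
  show ?thesis
  proof
    assume "surface cl b x = h"
    then have h: "h = b x + 1 + int ?g" unfolding surface_def by simp
    have "h - 1 = b x + int ?g" using h by simp
    then have "blocked cl b (x, h - 1)" using g by simp
    moreover have "\<forall>h'\<ge>h. \<not> blocked cl b (x, h')" unfolding h using top' by blast
    moreover have "h > b x" using h by simp
    ultimately show "h > b x \<and> blocked cl b (x, h - 1) \<and> (\<forall>h'\<ge>h. \<not> blocked cl b (x, h'))"
      by blast
  next
    assume h: "h > b x \<and> blocked cl b (x, h - 1) \<and> (\<forall>h'\<ge>h. \<not> blocked cl b (x, h'))"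
    have "\<not> h - 1 \<ge> b x + 1 + int ?g" using h top' by blast
    moreover have "\<not> b x + int ?g \<ge> h" using h g by blast
    ultimately show "surface cl b x = h" unfolding surface_def by linarith
  qed
qed

lemma surface_props:
  assumes "finite_height cl b x"
  shows "surface cl b x > b x" "blocked cl b (x, surface cl b x - 1)"
    "h \<ge> surface cl b x \<Longrightarrow> \<not> blocked cl b (x, h)"
  using surface_eqI[OF assms, of "surface cl b x"] by auto

lemma surface_open: "finite_height cl b x \<Longrightarrow> \<not> cl (x, surface cl b x)"
  using surface_props[of cl b x] blocked_climb[of cl b x "surface cl b x - 1"] by auto

lemma surface_step:
  assumes "finite_height cl b x" "finite_height cl b (x + 1)"
  shows "\<bar>surface cl b (x + 1) - surface cl b x\<bar> \<le> 1"
proof -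
  have "blocked cl b (x + 1, surface cl b x - 1 - 1)"
    by (rule blocked_right) (rule surface_props[OF assms(1)])
  then have "surface cl b x - 1 - 1 < surface cl b (x + 1)"
    using surface_props(3)[OF assms(2)] by (meson not_le)
  moreover have "blocked cl b (x + 1 - 1, surface cl b (x + 1) - 1 - 1)"
    by (rule blocked_left) (rule surface_props[OF assms(2)])
  then have "surface cl b (x + 1) - 1 - 1 < surface cl b x"
    using surface_props(3)[OF assms(1)] by (metis add_diff_cancel_right' not_le)
  ultimately show ?thesis by linarith
qed

lemma surface_le:
  assumes "\<forall>s\<ge>s0. \<not> blocked cl b (x, b x + int s)" "s0 \<ge> 1"
  shows "surface cl b x \<le> b x + int s0"
proof (rule ccontr)
  assume *: "\<not> ?thesis"
  have fin: "finite_height cl b x" using assms unfolding finite_height_def by blast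
  define s where "s = nat (surface cl b x - 1 - b x)"
  have "surface cl b x - 1 = b x + int s" "s \<ge> s0" using * unfolding s_def by auto
  then show False using surface_props(2)[OF fin] assms(1) by simp
qed

lemma (in prob_space) prob_UN_geometric:
  assumes meas: "\<And>N. G N \<in> events" and bound: "\<And>N :: nat. prob (G N) \<le> c * (1 / 2) ^ N"
  shows "prob (\<Union>N. G N) \<le> 2 * c"
proof -
  have sums: "(\<lambda>N. c * (1 / 2) ^ N) sums (c * (1 / (1 - 1 / 2)))"
    by (intro sums_mult geometric_sums) simp
  have summ: "summable (\<lambda>N. prob (G N))"
    by (rule summable_comparison_test'[OF sums_summable[OF sums], of 0]) (use bound in auto)
  have "prob (\<Union>N. G N) \<le> (\<Sum>N. prob (G N))"
    by (intro finite_measure_subadditive_countably summ) (use meas in auto)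
  also have "\<dots> \<le> (\<Sum>N. c * (1 / 2) ^ N)"
    by (intro suminf_le bound summ sums_summable[OF sums])
  also have "\<dots> = 2 * c" using sums_unique[OF sums] by simp
  finally show ?thesis .
qed

text \<open>The only probabilistic input is an exponential bound for the event that all sites of a
finite set are closed, which tolerates finite-range dependence.\<close>

locale closed_sites = prob_space M for M :: "'a measure" +
  fixes cl :: "'a \<Rightarrow> int \<times> int \<Rightarrow> bool" and \<kappa> :: real
  assumes cl_meas: "\<And>z. {\<omega> \<in> space M. cl \<omega> z} \<in> events"
    and \<kappa>: "0 < \<kappa>" "\<kappa> \<le> 1 / 6"
    and cl_prob: "\<And>C. finite C \<Longrightarrow> prob {\<omega> \<in> space M. \<forall>z\<in>C. cl \<omega> z} \<le> (\<kappa> ^ 3) ^ card C"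
begin

lemma cl_meas_ball: "{\<omega> \<in> space M. \<forall>z\<in>set zs. cl \<omega> z} \<in> events"
proof -
  have "finite (set zs)" by simp
  then show ?thesis by (intro sets.sets_Collect_finite_All) (auto intro: cl_meas)
qed

lemma blocking_walk_meas: "{\<omega> \<in> space M. blocking_walk (cl \<omega>) b z ms} \<in> events"
proof (induction ms arbitrary: z)
  case Nil
  then show ?case by (cases "snd z \<le> b (fst z)") auto
next
  case (Cons m ms)
  show ?case unfolding blocking_walk.simps
    by (intro sets.sets_Collect_conj sets.sets_Collect_imp sets.sets_Collect_const cl_meas Cons.IH)
qed

lemma blocked_meas: "{\<omega> \<in> space M. blocked (cl \<omega>) b z} \<in> events"
  unfolding blocked_def by (intro sets.sets_Collect_countable_Ex blocking_walk_meas)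

context
  fixes b :: "int \<Rightarrow> int"
  assumes slope: "\<And>x y. 2 * \<bar>b x - b y\<bar> \<le> \<bar>x - y\<bar> + 1"
begin

text \<open>Union bound: there are \<open>3 ^ N\<close> candidates for a shortest walk of length
\<open>N\<close>, and each has to climb at least \<open>(N + s) / 3\<close> distinct closed
sites.\<close>

lemma prob_blocked:
  assumes "s \<ge> 1"
  shows "prob {\<omega> \<in> space M. blocked (cl \<omega>) b (x, b x + int s)} \<le> 2 * \<kappa> ^ s"
proof -
  let ?z = "(x, b x + int s)"
  define W :: "nat \<Rightarrow> int list set" where
    "W N = {ms. set ms \<subseteq> {-1, 0, 1} \<and> length ms = N}" for N
  define E where "E ms = {\<omega> \<in> space M. blocking_walk (cl \<omega>) b ?z ms \<and> distinct (climbs ?z ms)}" for ms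
  have E_meas: "E ms \<in> events" for ms
    unfolding E_def by (intro sets.sets_Collect_conj sets.sets_Collect_const blocking_walk_meas)
  have finW: "finite (W N)" for N
    unfolding W_def using finite_lists_length_eq[of "{-1, 0, 1::int}" N] by simp
  have cardW: "card (W N) = 3 ^ N" for N
    unfolding W_def using card_lists_length_eq[of "{-1, 0, 1::int}" N] by (simp add: numeral_3_eq_3)
  have E_prob: "prob (E ms) \<le> \<kappa> ^ (N + s)" if "ms \<in> W N" for ms N
  proof (cases "E ms = {}")
    case True
    then show ?thesis using \<kappa> by simp
  next
    case False
    then obtain \<omega> where \<omega>: "blocking_walk (cl \<omega>) b ?z ms" "distinct (climbs ?z ms)"
      unfolding E_def by blast
    let ?U = "length (climbs ?z ms)"
    have "2 * int s + int N \<le> 3 * int ?U + 1"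
      using climbs_lower_bound[OF \<omega>(1) slope] that unfolding W_def by simp
    then have U: "N + s \<le> 3 * ?U" using assms by linarith
    have "E ms \<subseteq> {\<omega> \<in> space M. \<forall>z\<in>set (climbs ?z ms). cl \<omega> z}"
      unfolding E_def using blocking_walk_climbs_closed by blast
    then have "prob (E ms) \<le> prob {\<omega> \<in> space M. \<forall>z\<in>set (climbs ?z ms). cl \<omega> z}"
      by (intro finite_measure_mono cl_meas_ball)
    also have "\<dots> \<le> (\<kappa> ^ 3) ^ card (set (climbs ?z ms))" by (rule cl_prob) simp
    also have "card (set (climbs ?z ms)) = ?U" using \<omega>(2) by (rule distinct_card)
    also have "(\<kappa> ^ 3) ^ ?U = \<kappa> ^ (3 * ?U)" by (simp add: power_mult)
    also have "\<dots> \<le> \<kappa> ^ (N + s)" using U \<kappa> by (intro power_decreasing) auto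
    finally show ?thesis .
  qed
  define G where "G N = (\<Union>ms\<in>W N. E ms)" for N
  have G_meas: "G N \<in> events" for N
    unfolding G_def using finW E_meas by auto
  have G_prob: "prob (G N) \<le> \<kappa> ^ s * (1 / 2) ^ N" for N
  proof -
    have "prob (G N) \<le> (\<Sum>ms\<in>W N. prob (E ms))"
      unfolding G_def by (intro finite_measure_subadditive_finite finW) (use E_meas in auto)
    also have "\<dots> \<le> (\<Sum>ms\<in>W N. \<kappa> ^ (N + s))" by (intro sum_mono E_prob)
    also have "\<dots> = \<kappa> ^ s * (3 * \<kappa>) ^ N"
      by (simp add: cardW power_add power_mult_distrib)
    also have "\<dots> \<le> \<kappa> ^ s * (1 / 2) ^ N"
      using \<kappa> by (intro mult_left_mono power_mono) auto
    finally show ?thesis .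
  qed
  have "{\<omega> \<in> space M. blocked (cl \<omega>) b ?z} \<subseteq> (\<Union>N. G N)"
  proof
    fix \<omega> assume "\<omega> \<in> {\<omega> \<in> space M. blocked (cl \<omega>) b ?z}"
    then obtain ms where "\<omega> \<in> E ms" "blocking_walk (cl \<omega>) b ?z ms"
      unfolding E_def using blocked_obtain_distinct by blast
    then have "ms \<in> W (length ms)" "\<omega> \<in> E ms" using blocking_walk_moves unfolding W_def by auto
    then show "\<omega> \<in> (\<Union>N. G N)" unfolding G_def by blast
  qed
  then have "prob {\<omega> \<in> space M. blocked (cl \<omega>) b ?z} \<le> prob (\<Union>N. G N)"
    by (intro finite_measure_mono) (use G_meas in auto)
  also have "\<dots> \<le> 2 * \<kappa> ^ s" by (rule prob_UN_geometric[OF G_meas G_prob])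
  finally show ?thesis .
qed

lemma prob_high_blocked:
  assumes "s0 \<ge> 1"
  shows "prob {\<omega> \<in> space M. \<exists>s\<ge>s0. blocked (cl \<omega>) b (x, b x + int s)} \<le> 4 * \<kappa> ^ s0"
proof -
  define G where "G k = {\<omega> \<in> space M. blocked (cl \<omega>) b (x, b x + int (s0 + k))}" for k
  have G_meas: "G k \<in> events" for k unfolding G_def by (rule blocked_meas)
  have G_prob: "prob (G k) \<le> 2 * \<kappa> ^ s0 * (1 / 2) ^ k" for k
  proof -
    have "prob (G k) \<le> 2 * \<kappa> ^ (s0 + k)"
      unfolding G_def by (rule prob_blocked) (use assms in simp)
    also have "\<dots> = 2 * \<kappa> ^ s0 * \<kappa> ^ k" by (simp add: power_add)
    also have "\<dots> \<le> 2 * \<kappa> ^ s0 * (1 / 2) ^ k"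
      using \<kappa> by (intro mult_left_mono power_mono) auto
    finally show ?thesis .
  qed
  have "{\<omega> \<in> space M. \<exists>s\<ge>s0. blocked (cl \<omega>) b (x, b x + int s)} = (\<Union>k. G k)"
    unfolding G_def by (auto simp: le_iff_add)
  also have "prob (\<Union>k. G k) \<le> 2 * (2 * \<kappa> ^ s0)" by (rule prob_UN_geometric[OF G_meas G_prob])
  also have "\<dots> = 4 * \<kappa> ^ s0" by simp
  finally show ?thesis .
qed

lemma AE_finite_height: "AE \<omega> in M. finite_height (cl \<omega>) b x"
proof -
  define A where "A s0 = {\<omega> \<in> space M. \<exists>s\<ge>s0. blocked (cl \<omega>) b (x, b x + int s)}" for s0
  have meas: "A s0 \<in> events" for s0
    unfolding A_def by (intro sets.sets_Collect_countable_Ex sets.sets_Collect_conj sets.sets_Collect_const blocked_meas)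
  have meas': "(\<Inter>s0. A s0) \<in> events"
    by (intro sets.countable_INT) (use meas in blast)+
  have "prob (\<Inter>s0. A s0) \<le> 4 * \<kappa> ^ s0" if "s0 \<ge> 1" for s0
  proof -
    have "prob (\<Inter>s0. A s0) \<le> prob (A s0)"
      by (intro finite_measure_mono meas INT_lower UNIV_I)
    also have "\<dots> \<le> 4 * \<kappa> ^ s0" unfolding A_def by (rule prob_high_blocked[OF that])
    finally show ?thesis .
  qed
  moreover have "(\<lambda>s0. 4 * \<kappa> ^ s0) \<longlonglongrightarrow> 4 * 0"
    using \<kappa> by (intro tendsto_mult LIMSEQ_realpow_zero) auto
  ultimately have "prob (\<Inter>s0. A s0) \<le> 0"
    by (intro LIMSEQ_le_const[of "\<lambda>s0. 4 * \<kappa> ^ s0"]) auto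
  then have "prob (\<Inter>s0. A s0) = 0" by (simp add: measure_le_0_iff)
  then have null: "(\<Inter>s0. A s0) \<in> null_sets M"
    using meas' by (intro null_setsI) (simp_all add: emeasure_eq_measure)
  show ?thesis
    by (rule AE_I'[OF null]) (auto simp: finite_height_def A_def)
qed

end

end

section \<open>Independent edge variables\<close>

definition depends_on :: "(env \<Rightarrow> bool) \<Rightarrow> (bool \<times> int \<times> int) set \<Rightarrow> bool" where
  "depends_on Q E \<longleftrightarrow> (\<forall>w w'. (\<forall>e\<in>E. w e = w' e) \<longrightarrow> Q w = Q w')"

lemma depends_onD: "depends_on Q E \<Longrightarrow> (\<And>e. e \<in> E \<Longrightarrow> w e = w' e) \<Longrightarrow> Q w = Q w'"
  unfolding depends_on_def by blast

lemma depends_on_not: "depends_on Q E \<Longrightarrow> depends_on (\<lambda>w. \<not> Q w) E"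
  unfolding depends_on_def by blast

text \<open>The properties of the laws of horizontal (\<open>True\<close>) and vertical
(\<open>False\<close>) edges that the construction uses.\<close>

locale edge_field =
  fixes law :: "bool \<Rightarrow> real measure"
  assumes law_prob: "\<And>b. prob_space (law b)"
    and law_sets: "\<And>b. sets (law b) = sets borel"
    and law_null: "\<And>S. S \<in> sets borel \<Longrightarrow> measure (law True) S = 0 \<longleftrightarrow> measure (law False) S = 0"
    and law_sym: "\<And>S b. S \<in> sets borel \<Longrightarrow> measure (law b) (uminus -` S) = 0 \<longleftrightarrow> measure (law b) S = 0"
    and law_nontrivial: "measure (law False) (- {0}) \<noteq> 0"
begin

definition field :: "env measure" where "field = PiM UNIV (\<lambda>e. law (fst e))"

sublocale coord: product_prob_space "\<lambda>e. law (fst e)" UNIV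
  by (intro product_prob_spaceI law_prob)

sublocale prob_space field
  unfolding field_def by (rule prob_space_PiM) (rule law_prob)

lemma space_law: "space (law b) = UNIV"
  using sets_eq_imp_space_eq[OF law_sets] by simp

lemma space_field [simp]: "space field = UNIV"
  unfolding field_def space_PiM by (simp add: space_law)

lemma sets_field: "sets field = sets (PiM UNIV (\<lambda>_. borel))"
  unfolding field_def by (rule sets_PiM_cong) (simp_all add: law_sets)

lemma coord_measurable [measurable]: "(\<lambda>w. w e) \<in> borel_measurable field"
proof -
  have "(\<lambda>w. w e) \<in> measurable (PiM UNIV (\<lambda>_. borel)) borel" by (rule measurable_component_singleton) simp
  then show ?thesis using measurable_cong_sets[OF sets_field refl] by blast
qed

lemma prob_coord:
  assumes "S \<in> sets borel"
  shows "prob {w. w e \<in> S} = measure (law (fst e)) S"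
proof -
  have "emeasure field {x \<in> space (PiM UNIV (\<lambda>e. law (fst e))). x e \<in> S} = emeasure (law (fst e)) S"
    unfolding field_def by (rule coord.emeasure_PiM_Collect_single) (simp_all add: assms law_sets)
  then show ?thesis
    unfolding measure_def by (simp add: field_def[symmetric])
qed

lemma indep_coord: "indep_vars (\<lambda>_. borel) (\<lambda>e w. w e) UNIV"
proof (subst indep_vars_iff_distr_eq_PiM)
  have "distr field (PiM UNIV (\<lambda>_. borel)) (\<lambda>w. \<lambda>e\<in>UNIV. w e) = distr field field (\<lambda>w. w)"
    by (rule distr_cong) (simp_all add: sets_field restrict_def)
  also have "\<dots> = field" by (rule distr_id2) simp
  also have "\<dots> = PiM UNIV (\<lambda>e. distr field borel (\<lambda>w. w e))"
  proof -
    have "distr field borel (\<lambda>w. w e) = law (fst e)" for e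
    proof -
      have "distr field borel (\<lambda>w. w e) = distr field (law (fst e)) (\<lambda>w. w e)"
        by (rule distr_cong) (simp_all add: law_sets)
      also have "\<dots> = law (fst e)"
        unfolding field_def by (rule coord.PiM_component) simp
      finally show ?thesis .
    qed
    then show ?thesis unfolding field_def by simp
  qed
  finally show "distr field (PiM UNIV (\<lambda>_. borel)) (\<lambda>w. \<lambda>e\<in>UNIV. w e) =
      PiM UNIV (\<lambda>e. distr field borel (\<lambda>w. w e))" .
qed simp_all

text \<open>The form in which independence is applied: the events are given as predicates on the
whole field together with the edges that they read.\<close>

lemma prob_disjoint_local:
  assumes fin: "finite C" and dep: "\<And>c. c \<in> C \<Longrightarrow> depends_on (Q c) (E c)"
    and meas: "\<And>c. c \<in> C \<Longrightarrow> {w. Q c w} \<in> events"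
    and disj: "\<And>c c'. c \<in> C \<Longrightarrow> c' \<in> C \<Longrightarrow> c \<noteq> c' \<Longrightarrow> E c \<inter> E c' = {}"
  shows "prob {w. \<forall>c\<in>C. Q c w} = (\<Prod>c\<in>C. prob {w. Q c w})"
proof (cases "C = {}")
  case True
  then show ?thesis using prob_space by simp
next
  case False
  define ext where "ext c f = (\<lambda>e. if e \<in> E c then f e else 0)" for c and f :: env
  have ind: "indep_vars (\<lambda>c. PiM (E c) (\<lambda>_. borel)) (\<lambda>c w. restrict (\<lambda>e. w e) (E c)) C"
    by (rule indep_vars_restrict[OF indep_coord]) (use disj in \<open>auto simp: disjoint_family_on_def\<close>)
  have "indep_events (\<lambda>c. {w \<in> space field. Q c (ext c (restrict (\<lambda>e. w e) (E c)))}) C"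
  proof (rule indep_eventsI_indep_vars[OF ind])
    fix c assume c: "c \<in> C"
    have "ext c \<in> measurable (PiM (E c) (\<lambda>_. borel)) (PiM UNIV (\<lambda>_. borel))"
    proof (rule measurable_PiM_single')
      fix e :: "bool \<times> int \<times> int"
      show "(\<lambda>f. ext c f e) \<in> borel_measurable (PiM (E c) (\<lambda>_. borel))"
        unfolding ext_def by (cases "e \<in> E c") (auto intro: measurable_component_singleton)
    qed (auto simp: space_PiM)
    then have m: "ext c \<in> measurable (PiM (E c) (\<lambda>_. borel)) field"
      using measurable_cong_sets[OF refl sets_field] by blast
    have "ext c -` {w. Q c w} \<inter> space (PiM (E c) (\<lambda>_. borel)) \<in> sets (PiM (E c) (\<lambda>_. borel))"
      by (rule measurable_sets[OF m meas[OF c]])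
    moreover have "ext c -` {w. Q c w} \<inter> space (PiM (E c) (\<lambda>_. borel)) =
        {x \<in> space (PiM (E c) (\<lambda>_. borel)). Q c (ext c x)}" by auto
    ultimately show "{x \<in> space (PiM (E c) (\<lambda>_. borel)). Q c (ext c x)} \<in> sets (PiM (E c) (\<lambda>_. borel))"
      by simp
  qed
  then have "prob (\<Inter>c\<in>C. {w \<in> space field. Q c (ext c (restrict (\<lambda>e. w e) (E c)))}) =
      (\<Prod>c\<in>C. prob {w \<in> space field. Q c (ext c (restrict (\<lambda>e. w e) (E c)))})"
    unfolding indep_events_def using fin False by blast
  moreover have Q: "Q c (ext c (restrict (\<lambda>e. w e) (E c))) = Q c w" if "c \<in> C" for c w
    by (rule depends_onD[OF dep[OF that]]) (simp add: ext_def)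
  moreover have "(\<Inter>c\<in>C. {w \<in> space field. Q c (ext c (restrict (\<lambda>e. w e) (E c)))}) = {w. \<forall>c\<in>C. Q c w}"
    using Q by auto
  ultimately show ?thesis by (simp cong: prod.cong)
qed

text \<open>Finite-range dependence costs a root: some residue class contains at least the
\<open>r\<close>-th part of the sites, and within one class the sites are independent.\<close>

lemma prob_all_closed:
  fixes closed :: "int \<times> int \<Rightarrow> env \<Rightarrow> bool"
  assumes dep: "\<And>c. depends_on (closed c) (E c)"
    and meas: "\<And>c. {w. closed c w} \<in> events"
    and disj: "\<And>c c'. c \<noteq> c' \<Longrightarrow> snd c mod int r = snd c' mod int r \<Longrightarrow> E c \<inter> E c' = {}"
    and p: "\<And>c. prob {w. closed c w} \<le> \<rho> ^ r" and \<rho>: "0 \<le> \<rho>" "\<rho> \<le> 1" and r: "r > 0"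
    and fin: "finite C"
  shows "prob {w. \<forall>c\<in>C. closed c w} \<le> \<rho> ^ card C"
proof -
  define part where "part i = {c \<in> C. snd c mod int r = i}" for i
  have "C = (\<Union>i\<in>{0..<int r}. part i)" unfolding part_def using r by auto
  then have total: "card C \<le> (\<Sum>i\<in>{0..<int r}. card (part i))"
    using card_UN_le[of "{0..<int r}" part] by simp
  have "\<exists>i\<in>{0..<int r}. card C \<le> r * card (part i)"
  proof (rule ccontr)
    assume *: "\<not> ?thesis"
    have "r * card C \<le> r * (\<Sum>i\<in>{0..<int r}. card (part i))" using total by simp
    also have "\<dots> = (\<Sum>i\<in>{0..<int r}. r * card (part i))" by (simp add: sum_distrib_left)
    also have "\<dots> < (\<Sum>i\<in>{0..<int r}. card C)"
      by (rule sum_strict_mono) (use * r in \<open>auto simp: not_le\<close>)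
    also have "\<dots> = r * card C" by simp
    finally show False by simp
  qed
  then obtain i where i: "card C \<le> r * card (part i)" by blast
  have finp: "finite (part i)" unfolding part_def using fin by simp
  have sub: "{w. \<forall>c\<in>C. closed c w} \<subseteq> {w. \<forall>c\<in>part i. closed c w}" unfolding part_def by auto
  have "{w \<in> space field. \<forall>c\<in>part i. closed c w} \<in> events"
    using finp by (intro sets.sets_Collect_finite_All) (simp_all add: meas)
  then have "prob {w. \<forall>c\<in>C. closed c w} \<le> prob {w. \<forall>c\<in>part i. closed c w}"
    using sub by (intro finite_measure_mono) auto
  also have "\<dots> = (\<Prod>c\<in>part i. prob {w. closed c w})"
    by (rule prob_disjoint_local[OF finp dep meas]) (use disj in \<open>auto simp: part_def\<close>)
  also have "\<dots> \<le> (\<Prod>c\<in>part i. \<rho> ^ r)" by (intro prod_mono) (use p in auto)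
  also have "\<dots> = \<rho> ^ (r * card (part i))" by (simp add: power_mult)
  also have "\<dots> \<le> \<rho> ^ card C" using i \<rho> by (intro power_decreasing) auto
  finally show ?thesis .
qed

lemma distr_reindex:
  assumes "bij \<sigma>" "\<And>e. fst (\<sigma> e) = fst e"
  shows "distr field field (\<lambda>w. w \<circ> \<sigma>) = field"
proof -
  have "distr (PiM UNIV (\<lambda>e. law (fst e))) (PiM UNIV (\<lambda>e. law (fst (\<sigma> e)))) (\<lambda>w. \<lambda>e\<in>UNIV. w (\<sigma> e))
      = PiM UNIV (\<lambda>e. law (fst (\<sigma> e)))"
    by (rule distr_PiM_reindex) (use assms law_prob bij_is_inj in \<open>auto\<close>)
  then show ?thesis unfolding field_def assms(2) comp_def by (simp add: restrict_def)
qed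

lemma reindex_measurable [measurable]: "(\<lambda>w. w \<circ> \<sigma>) \<in> measurable field field"
proof -
  have "(\<lambda>w e. w (\<sigma> e)) \<in> measurable field (PiM UNIV (\<lambda>_. borel))"
    by (rule measurable_PiM_single') auto
  then show ?thesis using measurable_cong_sets[OF refl sets_field] unfolding comp_def by blast
qed

lemma prob_reindex:
  assumes "bij \<sigma>" "\<And>e. fst (\<sigma> e) = fst e" "{w. Q w} \<in> events"
  shows "prob {w. Q (w \<circ> \<sigma>)} = prob {w. Q w}"
proof -
  have "prob {w. Q w} = measure (distr field field (\<lambda>w. w \<circ> \<sigma>)) {w. Q w}"
    using distr_reindex[OF assms(1,2)] by simp
  also have "\<dots> = prob ((\<lambda>w. w \<circ> \<sigma>) -` {w. Q w} \<inter> space field)"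
    by (rule measure_distr) (simp_all add: assms)
  also have "(\<lambda>w. w \<circ> \<sigma>) -` {w. Q w} \<inter> space field = {w. Q (w \<circ> \<sigma>)}" by auto
  finally show ?thesis by simp
qed

end

section \<open>Cells\<close>

text \<open>Cells are \<open>4 * n + 4\<close> wide and \<open>B\<close> high. From left to right, a
cell has a gadget slot (columns 1 and 2), \<open>n\<close> slots for humps (columns 3 to \<open>2 *
n + 2\<close>) and \<open>n\<close> columns for changing the level. The row costs at most
\<open>R\<close>, a hump can gain \<open>C\<close>, the column sums have median about
\<open>m\<close>, and no edge in use exceeds \<open>K\<close>. Width and height are even, so that
all cells start at vertices of even coordinate sum.\<close>

locale cell_geometry =
  fixes n B :: nat and R C K m :: real
  assumes B: "even B" "B \<ge> 2" and K: "K \<ge> 0" and R: "R \<ge> 0" and C: "C \<ge> 3 * R + 2"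
begin

definition width :: int where "width = 4 * int n + 4"

abbreviation height :: int where "height \<equiv> int B"

text \<open>For vertical edges, the range of columns of a cell is open on the left and closed on the
right, like the range of the vertices that a crossing visits after its first one.\<close>

definition block :: "bool \<times> int \<times> int \<Rightarrow> int \<times> int" where
  "block e = (case e of (b, x, y) \<Rightarrow> ((if b then x else x - 1) div width, y div height))"

text \<open>A walk that leaves a cell one level up or down reads edges of the adjacent
cells.\<close>

definition window :: "int \<Rightarrow> int \<Rightarrow> (bool \<times> int \<times> int) set" where
  "window i j = {e. fst (block e) = i \<and> \<bar>snd (block e) - j\<bar> \<le> 1}"

definition gadget_edges :: "(bool \<times> int \<times> int) set" where
  "gadget_edges = {(b, x, y). if b then x mod width = 1 \<and> y mod height = 1
     else x mod width \<in> {1, 2} \<and> y mod height = 0}"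

definition row_cost :: "env \<Rightarrow> int \<Rightarrow> int \<Rightarrow> real" where
  "row_cost w x y = (\<Sum>i=0..<4 * n + 4. \<bar>w (True, x + int i, y)\<bar>)"

definition column_sum :: "env \<Rightarrow> int \<Rightarrow> int \<Rightarrow> real" where
  "column_sum w x y = (\<Sum>i<B. w (False, x, y + int i))"

definition high_hump :: "env \<Rightarrow> int \<Rightarrow> int \<Rightarrow> bool" where
  "high_hump w x y \<longleftrightarrow>
     (\<exists>t\<in>{1..<B}. height_gap w x y t \<ge> C \<and> \<bar>w (True, x, y + int t)\<bar> \<le> R)"

definition low_hump :: "env \<Rightarrow> int \<Rightarrow> int \<Rightarrow> bool" where
  "low_hump w x y \<longleftrightarrow>
     (\<exists>t\<in>{1..<B}. height_gap w x y t \<le> - C \<and> \<bar>w (True, x, y + int t)\<bar> \<le> R)"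

text \<open>The slack of one between the two conditions avoids exact medians.\<close>

definition balanced_columns :: "env \<Rightarrow> int \<Rightarrow> int \<Rightarrow> bool" where
  "balanced_columns w x y \<longleftrightarrow>
     (\<exists>k<n. column_sum w (x + int k) y \<ge> m) \<and> (\<exists>k<n. column_sum w (x + int k) y \<le> m + 1)"

definition good_cell :: "env \<Rightarrow> int \<Rightarrow> int \<Rightarrow> bool" where
  "good_cell w i j \<longleftrightarrow>
     (\<forall>d\<in>{-1, 0, 1}. row_cost w (width * i) (height * (j + d)) \<le> R) \<and>
     (\<exists>k<n. high_hump w (width * i + 3 + 2 * int k) (height * j)) \<and>
     (\<exists>k<n. low_hump w (width * i + 3 + 2 * int k) (height * j)) \<and>
     (\<forall>d\<in>{-1, 0}. balanced_columns w (width * i + 2 * int n + 3) (height * (j + d))) \<and>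
     (\<forall>e\<in>window i j - gadget_edges. \<bar>w e\<bar> \<le> K)"

lemma width_pos: "width > 0" unfolding width_def by simp

lemma height_pos: "height > 0" using B by simp

lemma horizontal_in_window:
  assumes "0 \<le> x" "x < width" "0 \<le> y" "y < height" "\<bar>d\<bar> \<le> 1" "x \<noteq> 1 \<or> y \<noteq> 1"
  shows "(True, width * i + x, height * (j + d) + y) \<in> window i j - gadget_edges"
  using assms unfolding window_def gadget_edges_def block_def
  by (simp add: div_pos_pos_trivial mod_pos_pos_trivial)

lemma vertical_in_window:
  assumes "3 \<le> x" "x \<le> width" "0 \<le> y" "y < height" "\<bar>d\<bar> \<le> 1"
  shows "(False, width * i + x, height * (j + d) + y) \<in> window i j - gadget_edges"
proof -
  have col: "(width * i + x - 1) div width = i"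
    using div_mult_self2[of width "x - 1" i] assms width_pos by (simp add: algebra_simps div_pos_pos_trivial)
  have "(width * i + x) mod width \<notin> {1, 2}"
    using assms by (cases "x = width") (auto simp: mod_pos_pos_trivial)
  then show ?thesis
    using assms col unfolding window_def gadget_edges_def block_def
    by (simp add: div_pos_pos_trivial mod_pos_pos_trivial)
qed


lemma height_gap_cong:
  assumes "\<And>i. i < t \<Longrightarrow> w (False, x, y + int i) = w' (False, x, y + int i)"
    and "\<And>i. i < t \<Longrightarrow> w (False, x + 1, y + int i) = w' (False, x + 1, y + int i)"
  shows "height_gap w x y t = height_gap w' x y t"
  unfolding height_gap_def using assms by (intro sum.cong) auto

lemma good_cell_cong_imp:
  assumes good: "good_cell w i j" and eq: "\<And>e. e \<in> window i j - gadget_edges \<Longrightarrow> w e = w' e"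
  shows "good_cell w' i j"
proof -
  have h: "w (True, width * i + x, height * (j + d) + y) = w' (True, width * i + x, height * (j + d) + y)"
    if "0 \<le> x" "x < width" "0 \<le> y" "y < height" "\<bar>d\<bar> \<le> 1" "x \<noteq> 1 \<or> y \<noteq> 1" for x y d
    by (rule eq) (rule horizontal_in_window[OF that])
  have v: "w (False, width * i + x, height * (j + d) + y) = w' (False, width * i + x, height * (j + d) + y)"
    if "3 \<le> x" "x \<le> width" "0 \<le> y" "y < height" "\<bar>d\<bar> \<le> 1" for x y d
    by (rule eq) (rule vertical_in_window[OF that])
  have rows: "row_cost w (width * i) (height * (j + d)) = row_cost w' (width * i) (height * (j + d))"
    if "\<bar>d\<bar> \<le> 1" for d
    unfolding row_cost_def
  proof (rule sum.cong[OF refl])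
    fix x assume "x \<in> {0..<4 * n + 4}"
    then show "\<bar>w (True, width * i + int x, height * (j + d))\<bar> = \<bar>w' (True, width * i + int x, height * (j + d))\<bar>"
      using h[of "int x" 0 d] that height_pos unfolding width_def by simp
  qed
  have cols: "column_sum w (width * i + 2 * int n + 3 + int k) (height * (j + d)) =
      column_sum w' (width * i + 2 * int n + 3 + int k) (height * (j + d))"
    if "\<bar>d\<bar> \<le> 1" "k < n" for d k
    unfolding column_sum_def
  proof (rule sum.cong[OF refl])
    fix y assume "y \<in> {..<B}"
    then show "w (False, width * i + 2 * int n + 3 + int k, height * (j + d) + int y) =
        w' (False, width * i + 2 * int n + 3 + int k, height * (j + d) + int y)"
      using v[of "2 * int n + 3 + int k" "int y" d] that unfolding width_def by (simp add: algebra_simps)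
  qed
  have gaps: "height_gap w (width * i + 3 + 2 * int k) (height * j) t =
      height_gap w' (width * i + 3 + 2 * int k) (height * j) t"
    if "t < B" "k < n" for t k
  proof (rule height_gap_cong)
    fix y assume "y < t"
    then show "w (False, width * i + 3 + 2 * int k, height * j + int y) =
        w' (False, width * i + 3 + 2 * int k, height * j + int y)"
      using v[of "3 + 2 * int k" "int y" 0] that unfolding width_def by (simp add: algebra_simps)
    show "w (False, width * i + 3 + 2 * int k + 1, height * j + int y) =
        w' (False, width * i + 3 + 2 * int k + 1, height * j + int y)"
      using v[of "4 + 2 * int k" "int y" 0] that \<open>y < t\<close> unfolding width_def by (simp add: algebra_simps)
  qed
  have tops: "w (True, width * i + 3 + 2 * int k, height * j + int t) =
      w' (True, width * i + 3 + 2 * int k, height * j + int t)"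
    if "t < B" "k < n" for t k
    using h[of "3 + 2 * int k" "int t" 0] that unfolding width_def by (simp add: algebra_simps)
  have 1: "\<forall>d\<in>{-1, 0, 1}. row_cost w' (width * i) (height * (j + d)) \<le> R"
  proof
    fix d :: int assume d: "d \<in> {-1, 0, 1}"
    then have "row_cost w (width * i) (height * (j + d)) \<le> R"
      using good unfolding good_cell_def by blast
    then show "row_cost w' (width * i) (height * (j + d)) \<le> R"
      using rows[of d] d by auto
  qed
  have 2: "\<exists>k<n. high_hump w' (width * i + 3 + 2 * int k) (height * j)"
  proof -
    obtain k where k: "k < n" "high_hump w (width * i + 3 + 2 * int k) (height * j)"
      using good unfolding good_cell_def by blast
    then have "high_hump w' (width * i + 3 + 2 * int k) (height * j)"
      using gaps[OF _ k(1)] tops[OF _ k(1)] unfolding high_hump_def by auto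
    then show ?thesis using k by blast
  qed
  have 3: "\<exists>k<n. low_hump w' (width * i + 3 + 2 * int k) (height * j)"
  proof -
    obtain k where k: "k < n" "low_hump w (width * i + 3 + 2 * int k) (height * j)"
      using good unfolding good_cell_def by blast
    then have "low_hump w' (width * i + 3 + 2 * int k) (height * j)"
      using gaps[OF _ k(1)] tops[OF _ k(1)] unfolding low_hump_def by auto
    then show ?thesis using k by blast
  qed
  have 4: "\<forall>d\<in>{-1, 0}. balanced_columns w' (width * i + 2 * int n + 3) (height * (j + d))"
  proof
    fix d :: int assume d: "d \<in> {-1, 0}"
    then have "balanced_columns w (width * i + 2 * int n + 3) (height * (j + d))"
      using good unfolding good_cell_def by blast
    then show "balanced_columns w' (width * i + 2 * int n + 3) (height * (j + d))"
      using cols[of d] d unfolding balanced_columns_def by auto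
  qed
  have 5: "\<forall>e\<in>window i j - gadget_edges. \<bar>w' e\<bar> \<le> K"
    using good eq unfolding good_cell_def by auto
  show ?thesis unfolding good_cell_def using 1 2 3 4 5 by blast
qed

lemma good_cell_cong:
  assumes "\<And>e. e \<in> window i j - gadget_edges \<Longrightarrow> w e = w' e"
  shows "good_cell w i j \<longleftrightarrow> good_cell w' i j"
  using good_cell_cong_imp[of w i j w'] good_cell_cong_imp[of w' i j w] assms by auto

definition entrance :: "env \<Rightarrow> int \<Rightarrow> int \<Rightarrow> real" where
  "entrance w x y = w (True, x, y) + w (True, x + 1, y)"

definition crossing_length :: nat where "crossing_length = 2 * (4 * n + 4) + 3 * B + 1"

text \<open>Row, hump, row, change of level in column \<open>c\<close>, row of the new level. The
pieces use disjoint sets of vertices because they use disjoint ranges of columns.\<close>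

lemma cell_route:
  assumes good: "good_cell w i j" and d: "d \<in> {-1, 0, 1}" and k: "k < n" "k' < n" and t: "t < B"
  defines "X \<equiv> width * i" and "Y \<equiv> height * j"
  defines "c \<equiv> 2 * n + 3 + k'"
  shows "conn w K crossing_length ({X + 2<..X + width} \<times> UNIV) (X + 2, Y) (X + width, Y + d * height)
    ((\<Sum>x=2..<2 * k + 3. w (True, X + int x, Y))
     + (height_gap w (X + 3 + 2 * int k) Y t + w (True, X + 3 + 2 * int k, Y + int t))
     + (\<Sum>x=2 * k + 4..<c. w (True, X + int x, Y))
     + (if d = 1 then column_sum w (X + int c) Y else if d = -1 then - column_sum w (X + int c) (Y - height) else 0)
     + (\<Sum>x=c..<4 * n + 4. w (True, X + int x, Y + d * height)))"
proof -
  have bd: "\<bar>w e\<bar> \<le> K" if "e \<in> window i j - gadget_edges" for e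
    using good that unfolding good_cell_def by blast
  have h: "\<bar>w (True, X + x, Y + y)\<bar> \<le> K"
    if "0 \<le> x" "x < width" "0 \<le> y" "y < height" "x \<noteq> 1 \<or> y \<noteq> 1" for x y
    using bd[OF horizontal_in_window[of x y 0 i j]] that unfolding X_def Y_def by simp
  have hd: "\<bar>w (True, X + x, Y + d * height)\<bar> \<le> K" if "0 \<le> x" "x < width" for x
    using bd[OF horizontal_in_window[of x 0 d i j]] that d height_pos
    unfolding X_def Y_def by (auto simp: algebra_simps)
  have v: "\<bar>w (False, X + x, Y + y)\<bar> \<le> K"
    if "3 \<le> x" "x \<le> width" "0 \<le> y" "y < height" for x y
    using bd[OF vertical_in_window[of x y 0 i j]] that unfolding X_def Y_def by simp
  have vd: "\<bar>w (False, X + x, Y - height + y)\<bar> \<le> K"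
    if "3 \<le> x" "x \<le> width" "0 \<le> y" "y < height" for x y
    using bd[OF vertical_in_window[of x y "-1" i j]] that unfolding X_def Y_def
    by (auto simp: algebra_simps)
  have w1: "conn w K (2 * k + 3 - 2) ({X + int 2<..X + int (2 * k + 3)} \<times> {Y}) (X + int 2, Y) (X + int (2 * k + 3), Y)
      (\<Sum>x=2..<2 * k + 3. w (True, X + int x, Y))"
    by (rule conn_row) (use k h[of _ 0] height_pos in \<open>auto simp: width_def\<close>)
  have w2: "conn w K (2 * t + 1) ({X + 3 + 2 * int k} \<times> {Y<..} \<union> {X + 3 + 2 * int k + 1} \<times> UNIV)
      (X + 3 + 2 * int k, Y) (X + 3 + 2 * int k + 1, Y)
      (height_gap w (X + 3 + 2 * int k) Y t + w (True, X + 3 + 2 * int k, Y + int t))"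
  proof (rule conn_hump)
    fix y assume y: "y < t"
    show "\<bar>w (False, X + 3 + 2 * int k, Y + int y)\<bar> \<le> K"
      using v[of "3 + 2 * int k" "int y"] y t k unfolding width_def by (simp add: algebra_simps)
    show "\<bar>w (False, X + 3 + 2 * int k + 1, Y + int y)\<bar> \<le> K"
      using v[of "4 + 2 * int k" "int y"] y t k unfolding width_def by (simp add: algebra_simps)
  next
    show "\<bar>w (True, X + 3 + 2 * int k, Y + int t)\<bar> \<le> K"
      using h[of "3 + 2 * int k" "int t"] t k unfolding width_def by (simp add: algebra_simps)
  qed
  have w3: "conn w K (c - (2 * k + 4)) ({X + int (2 * k + 4)<..X + int c} \<times> {Y}) (X + int (2 * k + 4), Y) (X + int c, Y)
      (\<Sum>x=2 * k + 4..<c. w (True, X + int x, Y))"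
    by (rule conn_row) (use k h[of _ 0] height_pos in \<open>auto simp: width_def c_def\<close>)
  have w4: "conn w K B ({X + int c} \<times> - {Y}) (X + int c, Y) (X + int c, Y + d * height)
      (if d = 1 then column_sum w (X + int c) Y else if d = -1 then - column_sum w (X + int c) (Y - height) else 0)"
  proof -
    consider "d = 0" | "d = 1" | "d = -1" using d by blast
    then show ?thesis
    proof cases
      case 1
      then show ?thesis using conn_mono[OF conn_refl[of w K "(X + int c, Y)"]] by simp
    next
      case 2
      have "conn w K B ({X + int c} \<times> {Y<..Y + height}) (X + int c, Y) (X + int c, Y + height)
          (column_sum w (X + int c) Y)"
        unfolding column_sum_def
        by (rule conn_up) (use v k in \<open>auto simp: width_def c_def\<close>)
      moreover have "{X + int c} \<times> {Y<..Y + height} \<subseteq> {X + int c} \<times> - {Y}" by auto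
      ultimately show ?thesis unfolding 2 using conn_mono[OF _ order_refl order_refl] by simp
    next
      case 3
      have "conn w K B ({X + int c} \<times> {Y - height..<Y - height + height}) (X + int c, Y - height + height)
          (X + int c, Y - height) (- column_sum w (X + int c) (Y - height))"
        unfolding column_sum_def
        by (rule conn_down) (use vd k in \<open>auto simp: width_def c_def\<close>)
      moreover have "{X + int c} \<times> {Y - height..<Y - height + height} \<subseteq> {X + int c} \<times> - {Y}" by auto
      ultimately show ?thesis unfolding 3 using conn_mono[OF _ order_refl order_refl] by simp
    qed
  qed
  have w5: "conn w K (4 * n + 4 - c) ({X + int c<..X + int (4 * n + 4)} \<times> {Y + d * height})
      (X + int c, Y + d * height) (X + int (4 * n + 4), Y + d * height)
      (\<Sum>x=c..<4 * n + 4. w (True, X + int x, Y + d * height))"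
    by (rule conn_row) (use k hd in \<open>auto simp: width_def c_def\<close>)
  have w1': "conn w K (2 * k + 1) ({X + 2<..X + 3 + 2 * int k} \<times> {Y}) (X + 2, Y) (X + 3 + 2 * int k, Y)
      (\<Sum>x=2..<2 * k + 3. w (True, X + int x, Y))"
    using w1 by (simp add: algebra_simps)
  have w3': "conn w K (c - (2 * k + 4)) ({X + 4 + 2 * int k<..X + int c} \<times> {Y}) (X + 3 + 2 * int k + 1, Y) (X + int c, Y)
      (\<Sum>x=2 * k + 4..<c. w (True, X + int x, Y))"
    using w3 by (simp add: algebra_simps)
  have w5': "conn w K (4 * n + 4 - c) ({X + int c<..X + width} \<times> {Y + d * height})
      (X + int c, Y + d * height) (X + width, Y + d * height)
      (\<Sum>x=c..<4 * n + 4. w (True, X + int x, Y + d * height))"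
    using w5 unfolding width_def by (simp add: algebra_simps)
  have w12: "conn w K (2 * k + 1 + (2 * t + 1)) ({X + 2<..X + 4 + 2 * int k} \<times> UNIV) (X + 2, Y) (X + 3 + 2 * int k + 1, Y)
      ((\<Sum>x=2..<2 * k + 3. w (True, X + int x, Y))
       + (height_gap w (X + 3 + 2 * int k) Y t + w (True, X + 3 + 2 * int k, Y + int t)))"
    by (rule conn_append'[OF w1' w2]) auto
  have w123: "conn w K (2 * k + 1 + (2 * t + 1) + (c - (2 * k + 4)))
      ({X + 2<..X + int c} \<times> UNIV - {X + int c} \<times> - {Y}) (X + 2, Y) (X + int c, Y)
      ((\<Sum>x=2..<2 * k + 3. w (True, X + int x, Y))
       + (height_gap w (X + 3 + 2 * int k) Y t + w (True, X + 3 + 2 * int k, Y + int t))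
       + (\<Sum>x=2 * k + 4..<c. w (True, X + int x, Y)))"
    by (rule conn_append'[OF w12 w3']) (use k in \<open>auto simp: c_def\<close>)
  note w1234 = conn_append[OF w123 w4]
  note w12345 = conn_append[OF w1234 w5']
  have "c \<le> 4 * n + 4" "2 * k + 4 \<le> c" using k unfolding c_def by auto
  then have L: "2 * k + 1 + (2 * t + 1) + (c - (2 * k + 4)) + B + (4 * n + 4 - c) \<le> crossing_length"
    unfolding crossing_length_def using k t by auto
  show ?thesis
  proof (rule conn_mono[OF w12345 order_refl L])
  qed (use k in \<open>auto simp: c_def width_def\<close>)
qed

lemma row_part:
  assumes "I \<subseteq> {0..<4 * n + 4}"
  shows "\<bar>\<Sum>x\<in>I. w (True, X + int x, Y)\<bar> \<le> row_cost w X Y"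
proof -
  have "\<bar>\<Sum>x\<in>I. w (True, X + int x, Y)\<bar> \<le> (\<Sum>x\<in>I. \<bar>w (True, X + int x, Y)\<bar>)" by (rule sum_abs)
  also have "\<dots> \<le> row_cost w X Y"
    unfolding row_cost_def using assms by (intro sum_mono2) auto
  finally show ?thesis .
qed

definition crossing_bound :: real where "crossing_bound = K * (real crossing_length + 2)"

lemma conn_sum_bound:
  assumes "conn w k L A u v s" "k \<ge> 0"
  shows "\<bar>s\<bar> \<le> k * real L"
proof -
  obtain p where p: "walk w k u p" "length p \<le> L" "wsum w u p = s"
    using assms unfolding conn_def by blast
  have "\<bar>s\<bar> \<le> k * real (length p)"
    using wsum_prefix_bound[OF p(1) assms(2), of "length p"] p(3) by simp
  also have "\<dots> \<le> k * real L" using p(2) assms(2) by (intro mult_left_mono) auto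
  finally show ?thesis .
qed

lemma entrance_bound:
  assumes "good_cell w i j"
  shows "\<bar>w (True, width * i, height * j)\<bar> \<le> K" "\<bar>w (True, width * i + 1, height * j)\<bar> \<le> K"
proof -
  have bd: "\<bar>w e\<bar> \<le> K" if "e \<in> window i j - gadget_edges" for e
    using assms that unfolding good_cell_def by blast
  have "width \<ge> 4" unfolding width_def by simp
  then show "\<bar>w (True, width * i, height * j)\<bar> \<le> K" "\<bar>w (True, width * i + 1, height * j)\<bar> \<le> K"
    using bd[OF horizontal_in_window[of 0 0 0 i j]] bd[OF horizontal_in_window[of 1 0 0 i j]] height_pos
    by simp_all
qed

text \<open>The rows contribute at most \<open>2 * R\<close>, the top of the hump at most
\<open>R\<close> and the column at most 1 on the wrong side of \<open>d * m\<close>; a hump with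
\<open>C \<ge> 3 * R + 2\<close> outweighs all of this. The sign \<open>\<sigma>\<close> selects the
side. The first two edges are treated separately because a gadget may replace them.\<close>

lemma cell_crossing:
  assumes good: "good_cell w i j" and d: "d \<in> {-1, 0, 1}" and \<sigma>: "\<sigma> \<in> {-1, 1}"
  shows "\<exists>s. conn w K crossing_length ({width * i + 2<..width * i + width} \<times> UNIV)
      (width * i + 2, height * j) (width * (i + 1), height * (j + d)) s \<and>
    \<sigma> * (entrance w (width * i) (height * j) + s - of_int d * m) \<ge> 1 \<and>
    \<bar>entrance w (width * i) (height * j) + s\<bar> \<le> crossing_bound"
proof -
  define X Y where "X = width * i" and "Y = height * j"
  obtain k t where k: "k < n" and t: "1 \<le> t" "t < B"
    and hump: "\<sigma> * height_gap w (X + 3 + 2 * int k) Y t \<ge> C" "\<bar>w (True, X + 3 + 2 * int k, Y + int t)\<bar> \<le> R"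
  proof (cases "\<sigma> = 1")
    case True
    then show ?thesis
      using good that unfolding good_cell_def high_hump_def X_def Y_def by fastforce
  next
    case False
    then have "\<sigma> = -1" using \<sigma> by simp
    obtain k t where "k < n" "t \<in> {1..<B}" "height_gap w (X + 3 + 2 * int k) Y t \<le> - C"
      "\<bar>w (True, X + 3 + 2 * int k, Y + int t)\<bar> \<le> R"
      using good unfolding good_cell_def low_hump_def X_def Y_def by blast
    then show ?thesis using that[of k t] \<open>\<sigma> = -1\<close> by simp
  qed
  define vert where "vert k' = (if d = 1 then column_sum w (X + int (2 * n + 3 + k')) Y
     else if d = -1 then - column_sum w (X + int (2 * n + 3 + k')) (Y - height) else 0)" for k'
  have "\<exists>k'<n. \<sigma> * (vert k' - of_int d * m) \<ge> -1"
  proof -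
    define y where "y = (if d = -1 then Y - height else Y)"
    have "y = height * (j + (if d = -1 then -1 else 0))" unfolding y_def Y_def by (simp add: algebra_simps)
    then have "balanced_columns w (X + 2 * int n + 3) y"
      using good unfolding good_cell_def X_def by auto
    then obtain k1 k2 where kk: "k1 < n" "column_sum w (X + 2 * int n + 3 + int k1) y \<ge> m"
        "k2 < n" "column_sum w (X + 2 * int n + 3 + int k2) y \<le> m + 1"
      unfolding balanced_columns_def by blast
    have pos: "X + int (2 * n + 3 + k') = X + 2 * int n + 3 + int k'" for k' by simp
    consider "d = 0" | "d = 1" "\<sigma> = 1" | "d = 1" "\<sigma> = -1" | "d = -1" "\<sigma> = 1" | "d = -1" "\<sigma> = -1"
      using d \<sigma> by blast
    then show ?thesis
    proof cases
      case 1
      then show ?thesis using k unfolding vert_def by auto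
    next
      case 2
      then show ?thesis using kk unfolding vert_def pos y_def by (intro exI[of _ k1]) simp
    next
      case 3
      then show ?thesis using kk unfolding vert_def pos y_def by (intro exI[of _ k2]) simp
    next
      case 4
      then show ?thesis using kk unfolding vert_def pos y_def by (intro exI[of _ k2]) simp
    next
      case 5
      then show ?thesis using kk unfolding vert_def pos y_def by (intro exI[of _ k1]) simp
    qed
  qed
  then obtain k' where k': "k' < n" "\<sigma> * (vert k' - of_int d * m) \<ge> -1" by blast
  define r1 r2 r3 where "r1 = (\<Sum>x=2..<2 * k + 3. w (True, X + int x, Y))"
    and "r2 = (\<Sum>x=2 * k + 4..<2 * n + 3 + k'. w (True, X + int x, Y))"
    and "r3 = (\<Sum>x=2 * n + 3 + k'..<4 * n + 4. w (True, X + int x, Y + d * height))"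
  define s where "s = r1 + (height_gap w (X + 3 + 2 * int k) Y t + w (True, X + 3 + 2 * int k, Y + int t))
     + r2 + vert k' + r3"
  have "conn w K crossing_length ({X + 2<..X + width} \<times> UNIV) (X + 2, Y) (X + width, Y + d * height) s"
    unfolding s_def r1_def r2_def r3_def vert_def X_def Y_def
    by (rule cell_route[OF good d k k'(1) t(2)])
  moreover have "X + width = width * (i + 1)" "Y + d * height = height * (j + d)"
    unfolding X_def Y_def by (simp_all add: algebra_simps)
  ultimately have route: "conn w K crossing_length ({X + 2<..X + width} \<times> UNIV) (X + 2, Y)
      (width * (i + 1), height * (j + d)) s" by simp
  have "row_cost w X (height * (j + 0)) \<le> R"
    using good unfolding good_cell_def X_def by blast
  then have "row_cost w X Y \<le> R" unfolding Y_def by simp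
  note row0 = this
  have "entrance w X Y = (\<Sum>x\<in>{0..<2}. w (True, X + int x, Y))"
    unfolding entrance_def by (simp add: numeral_2_eq_2)
  then have "entrance w X Y + r1 = (\<Sum>x\<in>{0..<2 * k + 3}. w (True, X + int x, Y))"
    unfolding r1_def by (simp add: sum.atLeastLessThan_concat)
  then have "entrance w X Y + r1 + r2 =
      (\<Sum>x\<in>{0..<2 * k + 3} \<union> {2 * k + 4..<2 * n + 3 + k'}. w (True, X + int x, Y))"
    unfolding r2_def by (subst sum.union_disjoint) auto
  moreover have "{0..<2 * k + 3} \<union> {2 * k + 4..<2 * n + 3 + k'} \<subseteq> {0..<4 * n + 4}"
    using k k' by auto
  ultimately have e12: "\<bar>entrance w X Y + r1 + r2\<bar> \<le> R"
    using row_part[of "{0..<2 * k + 3} \<union> {2 * k + 4..<2 * n + 3 + k'}" w X Y] row0 by linarith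
  have "row_cost w X (height * (j + d)) \<le> R"
    using good d unfolding good_cell_def X_def by blast
  then have e3: "\<bar>r3\<bar> \<le> R"
    using row_part[of "{2 * n + 3 + k'..<4 * n + 4}" w X "height * (j + d)"]
    unfolding r3_def Y_def by (auto simp: algebra_simps)
  have sg: "\<sigma> * z \<ge> - R" if "\<bar>z\<bar> \<le> R" for z using that \<sigma> by auto
  have "\<sigma> * (entrance w X Y + s - of_int d * m) =
      \<sigma> * (entrance w X Y + r1 + r2) + \<sigma> * height_gap w (X + 3 + 2 * int k) Y t
      + \<sigma> * w (True, X + 3 + 2 * int k, Y + int t) + \<sigma> * (vert k' - of_int d * m) + \<sigma> * r3"
    unfolding s_def by (simp add: algebra_simps)
  also have "\<dots> \<ge> - R + C + - R + -1 + - R"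
    by (intro add_mono sg e12 e3 hump k'(2))
  finally have "\<sigma> * (entrance w X Y + s - of_int d * m) \<ge> 1" using C by linarith
  moreover have "\<bar>entrance w X Y + s\<bar> \<le> crossing_bound"
  proof -
    have "\<bar>entrance w X Y\<bar> \<le> 2 * K"
      using entrance_bound[OF good] unfolding entrance_def X_def Y_def by linarith
    moreover have "\<bar>s\<bar> \<le> K * real crossing_length" by (rule conn_sum_bound[OF route K])
    ultimately show ?thesis unfolding crossing_bound_def by (simp add: algebra_simps)
  qed
  ultimately show ?thesis using route unfolding X_def Y_def by blast
qed

lemma conn_entrance:
  assumes "\<bar>w (True, x, y)\<bar> \<le> k" "\<bar>w (True, x + 1, y)\<bar> \<le> k"
  shows "conn w k 2 ({x<..x + 2} \<times> UNIV) (x, y) (x + 2, y) (entrance w x y)"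
proof -
  have "conn w k (2 - 0) ({x + int 0<..x + int 2} \<times> {y}) (x + int 0, y) (x + int 2, y)
      (\<Sum>i=0..<2. w (True, x + int i, y))"
    by (rule conn_row) (use assms in \<open>auto simp: numeral_2_eq_2 less_Suc_eq\<close>)
  then have "conn w k 2 ({x<..x + 2} \<times> {y}) (x, y) (x + 2, y) (entrance w x y)"
    unfolding entrance_def by (simp add: numeral_2_eq_2)
  moreover have "{x<..x + 2} \<times> {y} \<subseteq> {x<..x + 2} \<times> UNIV" by auto
  ultimately show ?thesis using conn_mono[OF _ order_refl order_refl] by blast
qed

definition gadget_effect :: "env \<Rightarrow> int \<Rightarrow> int \<Rightarrow> real" where
  "gadget_effect w x y = w (False, x + 1, y) - w (False, x + 2, y) + w (True, x + 1, y + 1) - w (True, x + 1, y)"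

lemma conn_gadget:
  assumes "\<bar>w (True, x, y)\<bar> \<le> k" "\<bar>w (False, x + 1, y)\<bar> \<le> k" "\<bar>w (False, x + 2, y)\<bar> \<le> k"
    "\<bar>w (True, x + 1, y + 1)\<bar> \<le> k"
  shows "conn w k 4 ({x<..x + 2} \<times> UNIV) (x, y) (x + 2, y) (entrance w x y + gadget_effect w x y)"
proof -
  have 1: "conn w k 1 {(x + 1, y)} (x, y) (x + 1, y) (w (True, x, y))"
    using conn_single[of "(x, y)" "(x + 1, y)" w k] assms(1) by (simp add: adjacent_def crossing_def)
  have 2: "conn w k (2 * 1 + 1) ({x + 1} \<times> {y<..} \<union> {x + 1 + 1} \<times> UNIV) (x + 1, y) (x + 1 + 1, y)
      (height_gap w (x + 1) y 1 + w (True, x + 1, y + int 1))"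
    by (rule conn_hump) (use assms in \<open>auto simp: add.commute[of 2]\<close>)
  have "conn w k 4 ({x<..x + 2} \<times> UNIV) (x, y) (x + 1 + 1, y) (entrance w x y + gadget_effect w x y)"
    by (rule conn_append'[OF 1 2])
       (auto simp: entrance_def gadget_effect_def height_gap_def add.commute[of 2])
  then show ?thesis by (simp add: add.commute[of 2])
qed

end

section \<open>Blocks of cells\<close>

text \<open>The length of a block makes the gain of 1 per cell exceed the cost of a change of level
by \<open>tall\<close>.\<close>

locale block_geometry = cell_geometry +
  fixes len tall :: nat
  assumes len: "real len \<ge> \<bar>m\<bar> * real tall + 1"
begin

lemma len_pos: "len \<ge> 1"
proof -
  have "\<bar>m\<bar> * real tall \<ge> 0" by simp
  then have "real len \<ge> 1" using len by linarith
  then show ?thesis by simp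
qed

text \<open>The heights of the cells are stored in a list, so that the quantifier ranges over a
countable type.\<close>

definition good_block :: "env \<Rightarrow> int \<Rightarrow> int \<Rightarrow> bool" where
  "good_block w I J \<longleftrightarrow> (\<forall>D\<in>{-1, 0, 1}. \<exists>hs :: int list.
     hs ! 0 = int tall * J \<and> hs ! len = int tall * (J + D) \<and>
     (\<forall>x<len. \<bar>hs ! Suc x - hs ! x\<bar> \<le> 1 \<and> hs ! x \<in> {int tall * (J - 1)..int tall * (J + 2)} \<and>
        good_cell w (int len * I + int x) (hs ! x)))"

definition port :: "int \<Rightarrow> int \<Rightarrow> vertex" where
  "port I J = (width * (int len * I), height * (int tall * J))"

definition span :: "int \<Rightarrow> vertex set" where
  "span I = {width * (int len * I)<..width * (int len * (I + 1))} \<times> UNIV"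

definition block_length :: nat where "block_length = len * (crossing_length + 2) + 4"

definition block_bound :: real where "block_bound = real len * crossing_bound"

text \<open>The multiples of \<open>m\<close> telescope along consecutive cells, while the
remainders have a common sign and add up.\<close>

lemma cells_crossing:
  assumes cells: "\<And>x. x < t \<Longrightarrow> \<bar>\<phi> (Suc x) - \<phi> x\<bar> \<le> 1 \<and> good_cell w (i + int x) (\<phi> x)"
    and \<sigma>: "\<sigma> \<in> {-1, 1}" and "t \<ge> 1"
  shows "\<exists>s. conn w K (t * (crossing_length + 2)) ({width * i + 2<..width * (i + int t)} \<times> UNIV)
      (width * i + 2, height * \<phi> 0) (width * (i + int t), height * \<phi> t) s \<and>
    \<sigma> * (entrance w (width * i) (height * \<phi> 0) + s - of_int (\<phi> t - \<phi> 0) * m) \<ge> real t \<and>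
    \<bar>entrance w (width * i) (height * \<phi> 0) + s\<bar> \<le> real t * crossing_bound"
  using \<open>t \<ge> 1\<close> cells
proof (induction t rule: dec_induct)
  case base
  define d where "d = \<phi> 1 - \<phi> 0"
  have d: "d \<in> {-1, 0, 1}" and good: "good_cell w i (\<phi> 0)"
    using base[of 0] unfolding d_def by auto
  obtain s where s: "conn w K crossing_length ({width * i + 2<..width * i + width} \<times> UNIV)
      (width * i + 2, height * \<phi> 0) (width * (i + 1), height * (\<phi> 0 + d)) s"
    "\<sigma> * (entrance w (width * i) (height * \<phi> 0) + s - of_int d * m) \<ge> 1"
    "\<bar>entrance w (width * i) (height * \<phi> 0) + s\<bar> \<le> crossing_bound"
    using cell_crossing[OF good d \<sigma>] by blast
  have "conn w K (1 * (crossing_length + 2)) ({width * i + 2<..width * (i + int 1)} \<times> UNIV)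
      (width * i + 2, height * \<phi> 0) (width * (i + int 1), height * \<phi> 1) s"
    using conn_mono[OF s(1) order_refl, of "1 * (crossing_length + 2)" "{width * i + 2<..width * (i + int 1)} \<times> UNIV"]
    unfolding d_def by (simp add: algebra_simps)
  then show ?case using s unfolding d_def by (intro exI[of _ s]) simp
next
  case (step t)
  define d where "d = \<phi> (Suc t) - \<phi> t"
  have d: "d \<in> {-1, 0, 1}" and good: "good_cell w (i + int t) (\<phi> t)"
    using step.prems[of t] unfolding d_def by auto
  obtain s where s: "conn w K (t * (crossing_length + 2)) ({width * i + 2<..width * (i + int t)} \<times> UNIV)
      (width * i + 2, height * \<phi> 0) (width * (i + int t), height * \<phi> t) s"
    "\<sigma> * (entrance w (width * i) (height * \<phi> 0) + s - of_int (\<phi> t - \<phi> 0) * m) \<ge> real t"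
    "\<bar>entrance w (width * i) (height * \<phi> 0) + s\<bar> \<le> real t * crossing_bound"
    using step.IH step.prems by auto
  let ?x = "width * (i + int t)"
  obtain s' where s': "conn w K crossing_length ({?x + 2<..?x + width} \<times> UNIV)
      (?x + 2, height * \<phi> t) (width * (i + int t + 1), height * (\<phi> t + d)) s'"
    "\<sigma> * (entrance w ?x (height * \<phi> t) + s' - of_int d * m) \<ge> 1"
    "\<bar>entrance w ?x (height * \<phi> t) + s'\<bar> \<le> crossing_bound"
    using cell_crossing[OF good d \<sigma>] by blast
  have w4: "width \<ge> 4" unfolding width_def by simp
  have e: "conn w K 2 ({?x<..?x + 2} \<times> UNIV) (?x, height * \<phi> t) (?x + 2, height * \<phi> t)
      (entrance w ?x (height * \<phi> t))"
    by (rule conn_entrance) (use entrance_bound[OF good] in auto)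
  have c1: "conn w K (2 + crossing_length) ({?x<..?x + width} \<times> UNIV) (?x, height * \<phi> t)
      (width * (i + int t + 1), height * (\<phi> t + d)) (entrance w ?x (height * \<phi> t) + s')"
    by (rule conn_append'[OF e s'(1)]) (use w4 in auto)
  have x: "?x + width = width * (i + int (Suc t))" by (simp add: algebra_simps)
  have le: "width * i + 4 \<le> ?x"
  proof -
    have "width * 1 \<le> width * int t" using step.hyps width_pos by (intro mult_left_mono) auto
    moreover have "?x = width * i + width * int t" by (rule distrib_left)
    ultimately show ?thesis using w4 by linarith
  qed
  have c: "conn w K (Suc t * (crossing_length + 2)) ({width * i + 2<..width * (i + int (Suc t))} \<times> UNIV)
      (width * i + 2, height * \<phi> 0) (width * (i + int t + 1), height * (\<phi> t + d))
      (s + (entrance w ?x (height * \<phi> t) + s'))"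
    unfolding x[symmetric] by (rule conn_append'[OF s(1) c1]) (use le w4 in auto)
  have "(width * (i + int t + 1), height * (\<phi> t + d)) = (width * (i + int (Suc t)), height * \<phi> (Suc t))"
    unfolding d_def by (simp add: algebra_simps)
  with c have c': "conn w K (Suc t * (crossing_length + 2)) ({width * i + 2<..width * (i + int (Suc t))} \<times> UNIV)
      (width * i + 2, height * \<phi> 0) (width * (i + int (Suc t)), height * \<phi> (Suc t))
      (s + (entrance w ?x (height * \<phi> t) + s'))" by simp
  have "of_int (\<phi> (Suc t) - \<phi> 0) * m = of_int (\<phi> t - \<phi> 0) * m + of_int d * m"
    unfolding d_def by (simp add: algebra_simps)
  then have "\<sigma> * (entrance w (width * i) (height * \<phi> 0) + (s + (entrance w ?x (height * \<phi> t) + s'))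
      - of_int (\<phi> (Suc t) - \<phi> 0) * m) =
     \<sigma> * (entrance w (width * i) (height * \<phi> 0) + s - of_int (\<phi> t - \<phi> 0) * m)
     + \<sigma> * (entrance w ?x (height * \<phi> t) + s' - of_int d * m)"
    by (simp add: algebra_simps)
  then have "\<sigma> * (entrance w (width * i) (height * \<phi> 0) + (s + (entrance w ?x (height * \<phi> t) + s'))
      - of_int (\<phi> (Suc t) - \<phi> 0) * m) \<ge> real (Suc t)"
    using s(2) s'(2) by simp
  moreover have "\<bar>entrance w (width * i) (height * \<phi> 0) + (s + (entrance w ?x (height * \<phi> t) + s'))\<bar>
      \<le> real (Suc t) * crossing_bound"
    using s(3) s'(3) by (simp add: algebra_simps)
  ultimately show ?case using c' by blast
qed

lemma block_crossing:
  assumes good: "good_block w I J" and D: "D \<in> {-1, 0, 1}" and \<sigma>: "\<sigma> \<in> {-1, 1}"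
  shows "\<exists>r. \<sigma> * r \<ge> 1 \<and> \<bar>r\<bar> \<le> block_bound \<and>
    conn w K block_length (span I) (port I J) (port (I + 1) (J + D)) r \<and>
    (\<forall>k\<ge>K. \<bar>w (False, fst (port I J) + 1, snd (port I J))\<bar> \<le> k \<longrightarrow>
        \<bar>w (False, fst (port I J) + 2, snd (port I J))\<bar> \<le> k \<longrightarrow>
        \<bar>w (True, fst (port I J) + 1, snd (port I J) + 1)\<bar> \<le> k \<longrightarrow>
      conn w k block_length (span I) (port I J) (port (I + 1) (J + D))
        (r + gadget_effect w (fst (port I J)) (snd (port I J))))"
proof -
  obtain hs :: "int list" where hs: "hs ! 0 = int tall * J" "hs ! len = int tall * (J + D)"
    "\<And>x. x < len \<Longrightarrow> \<bar>hs ! Suc x - hs ! x\<bar> \<le> 1 \<and> good_cell w (int len * I + int x) (hs ! x)"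
    using good D unfolding good_block_def by meson
  obtain \<phi> :: "nat \<Rightarrow> int" where \<phi>: "\<phi> 0 = int tall * J" "\<phi> len = int tall * (J + D)"
    "\<And>x. x < len \<Longrightarrow> \<bar>\<phi> (Suc x) - \<phi> x\<bar> \<le> 1 \<and> good_cell w (int len * I + int x) (\<phi> x)"
    using that[of "\<lambda>x. hs ! x"] hs by blast
  define x y where "x = width * (int len * I)" and "y = height * (int tall * J)"
  obtain s where s: "conn w K (len * (crossing_length + 2)) ({x + 2<..width * (int len * I + int len)} \<times> UNIV)
      (x + 2, y) (width * (int len * I + int len), height * (int tall * (J + D))) s"
    "\<sigma> * (entrance w x y + s - of_int (\<phi> len - \<phi> 0) * m) \<ge> real len"
    "\<bar>entrance w x y + s\<bar> \<le> real len * crossing_bound"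
    using cells_crossing[of len \<phi> w "int len * I", OF \<phi>(3) \<sigma> len_pos] unfolding \<phi> x_def y_def by blast
  have "int len * I + int len = int len * (I + 1)" by (simp add: algebra_simps)
  then have s1: "conn w K (len * (crossing_length + 2)) ({x + 2<..width * (int len * (I + 1))} \<times> UNIV)
      (x + 2, y) (port (I + 1) (J + D)) s"
    using s(1) unfolding port_def by simp
  have good0: "good_cell w (int len * I) (int tall * J)"
    using \<phi>(3)[of 0] \<phi>(1) len_pos by simp
  note eb = entrance_bound[OF good0, folded x_def y_def]
  have far: "x + 2 \<le> width * (int len * (I + 1))"
  proof -
    have "width * 1 \<le> width * int len" using len_pos width_pos by (intro mult_left_mono) auto
    moreover have "width \<ge> 4" unfolding width_def by simp
    moreover have "width * (int len * (I + 1)) = x + width * int len"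
      unfolding x_def by (simp add: algebra_simps)
    ultimately show ?thesis by linarith
  qed
  have p: "port I J = (x, y)" unfolding port_def x_def y_def ..
  have c: "conn w K block_length (span I) (port I J) (port (I + 1) (J + D)) (entrance w x y + s)"
  proof -
    have "conn w K (2 + len * (crossing_length + 2)) ({x<..x + 2} \<times> UNIV \<union> {x + 2<..width * (int len * (I + 1))} \<times> UNIV)
      (x, y) (port (I + 1) (J + D)) (entrance w x y + s)"
      by (rule conn_append[OF conn_entrance[OF eb] s1]) auto
    then show ?thesis unfolding p
      by (rule conn_mono) (use far in \<open>auto simp: block_length_def span_def x_def\<close>)
  qed
  have g: "conn w k block_length (span I) (port I J) (port (I + 1) (J + D))
        (entrance w x y + s + gadget_effect w x y)"
    if k: "k \<ge> K" "\<bar>w (False, x + 1, y)\<bar> \<le> k" "\<bar>w (False, x + 2, y)\<bar> \<le> k" "\<bar>w (True, x + 1, y + 1)\<bar> \<le> k" for k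
  proof -
    have "\<bar>w (True, x, y)\<bar> \<le> k" using eb k by simp
    note gad = conn_gadget[OF this k(2-4)]
    have "conn w k (4 + len * (crossing_length + 2)) ({x<..x + 2} \<times> UNIV \<union> {x + 2<..width * (int len * (I + 1))} \<times> UNIV)
      (x, y) (port (I + 1) (J + D)) (entrance w x y + gadget_effect w x y + s)"
      by (rule conn_append[OF gad conn_mono[OF s1 k(1) order_refl order_refl]]) auto
    then have "conn w k block_length (span I) (x, y) (port (I + 1) (J + D)) (entrance w x y + gadget_effect w x y + s)"
      by (rule conn_mono) (use far in \<open>auto simp: block_length_def span_def x_def\<close>)
    then show ?thesis unfolding p by (simp add: algebra_simps)
  qed
  have "\<bar>of_int (\<phi> len - \<phi> 0) * m\<bar> \<le> \<bar>m\<bar> * real tall"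
  proof -
    have "\<phi> len - \<phi> 0 = int tall * D" unfolding \<phi> by (simp add: algebra_simps)
    then show ?thesis using D by (auto simp: abs_mult mult.commute)
  qed
  then have "\<sigma> * (of_int (\<phi> len - \<phi> 0) * m) \<ge> - (\<bar>m\<bar> * real tall)" using \<sigma> by auto
  moreover have "\<sigma> * (entrance w x y + s) =
     \<sigma> * (entrance w x y + s - of_int (\<phi> len - \<phi> 0) * m) + \<sigma> * (of_int (\<phi> len - \<phi> 0) * m)"
    by (simp add: algebra_simps)
  ultimately have "\<sigma> * (entrance w x y + s) \<ge> 1" using s(2) len by linarith
  then show ?thesis using c g s(3) unfolding block_bound_def p
    by (intro exI[of _ "entrance w x y + s"]) auto
qed

end

section \<open>Steering\<close>

definition balanced_path :: "env \<Rightarrow> bool" where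
  "balanced_path w \<longleftrightarrow> (\<exists>\<eta>. \<eta> 0 = (0, 0) \<and> (\<forall>i. adjacent (\<eta> i) (\<eta> (Suc i))) \<and> inj \<eta> \<and>
     (\<exists>b. \<forall>N. \<bar>\<Sum>i<N. crossing w (\<eta> i) (\<eta> (Suc i))\<bar> \<le> b) \<and>
     (\<forall>\<epsilon>>0. \<forall>n. \<exists>N\<ge>n. \<bar>\<Sum>i<N. crossing w (\<eta> i) (\<eta> (Suc i))\<bar> < \<epsilon>))"

lemma wsum_nth: "wsum w u p = (\<Sum>i<length p. crossing w ((u # p) ! i) ((u # p) ! Suc i))"
proof (induction p arbitrary: u)
  case (Cons v p)
  then show ?case by (simp add: sum.lessThan_Suc_shift del: sum.lessThan_Suc)
qed simp

lemma walk_nth: "walk w k u p \<Longrightarrow> i < length p \<Longrightarrow> adjacent ((u # p) ! i) ((u # p) ! Suc i)"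
proof (induction p arbitrary: u i)
  case (Cons v p)
  then show ?case by (cases i) auto
qed simp

text \<open>An increasing sequence of finite walks has a limit path, and all required properties
concern finite initial parts.\<close>

lemma balanced_path_limit:
  assumes ext: "\<And>n. \<exists>q. p (Suc n) = p n @ q \<and> q \<noteq> []"
    and walk: "\<And>n. walk w k (0, 0) (p n)" and dist: "\<And>n. distinct ((0, 0) # p n)"
    and bd: "\<And>n j. \<bar>wsum w (0, 0) (take j (p n))\<bar> \<le> b"
    and small: "\<And>n. \<bar>wsum w (0, 0) (p (Suc n))\<bar> < inverse (real (Suc n))"
  shows "balanced_path w"
proof -
  let ?O = "(0, 0) :: vertex"
  have len: "length (p n) \<ge> n" for n
  proof (induction n)
    case (Suc n)
    obtain q where "p (Suc n) = p n @ q" "q \<noteq> []" using ext by blast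
    then show ?case using Suc by (cases q) auto
  qed simp
  have pre: "\<exists>r. p n = p i @ r" if "i \<le> n" for i n
    using that
  proof (induction n rule: dec_induct)
    case (step n)
    then show ?case using ext[of n] by (metis append_assoc)
  qed simp
  define \<eta> where "\<eta> i = (?O # p i) ! i" for i
  have eta: "(?O # p n) ! j = \<eta> j" if "j \<le> length (p n)" for j n
  proof (cases "j \<le> n")
    case True
    then obtain r where "p n = p j @ r" using pre by blast
    then have "?O # p n = (?O # p j) @ r" by simp
    moreover have "j < length (?O # p j)" using len[of j] by simp
    ultimately show ?thesis unfolding \<eta>_def by (metis nth_append)
  next
    case False
    then obtain r where "p j = p n @ r" using pre[of n j] by auto
    then have "?O # p j = (?O # p n) @ r" by simp
    moreover have "j < length (?O # p n)" using that by simp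
    ultimately show ?thesis unfolding \<eta>_def by (metis nth_append)
  qed
  have S: "(\<Sum>i<N. crossing w (\<eta> i) (\<eta> (Suc i))) = wsum w ?O (take N (p n))"
    if "N \<le> length (p n)" for N n
  proof -
    have "length (take N (p n)) = N" using that by simp
    then have "wsum w ?O (take N (p n)) =
        (\<Sum>i<N. crossing w ((?O # take N (p n)) ! i) ((?O # take N (p n)) ! Suc i))"
      unfolding wsum_nth by simp
    also have "\<dots> = (\<Sum>i<N. crossing w (\<eta> i) (\<eta> (Suc i)))"
    proof (rule sum.cong[OF refl])
      fix i assume i: "i \<in> {..<N}"
      have "(?O # take N (p n)) ! j = (?O # p n) ! j" if "j \<le> N" for j
        using that by (cases j) auto
      then have e: "(?O # take N (p n)) ! j = \<eta> j" if "j \<le> N" for j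
        using eta[of j n] that \<open>N \<le> length (p n)\<close> by simp
      show "crossing w ((?O # take N (p n)) ! i) ((?O # take N (p n)) ! Suc i) =
          crossing w (\<eta> i) (\<eta> (Suc i))"
        using i e[of i] e[of "Suc i"] by (simp del: nth_Cons_Suc)
    qed
    finally show ?thesis by simp
  qed
  have "\<eta> 0 = ?O" unfolding \<eta>_def by simp
  moreover have "adjacent (\<eta> i) (\<eta> (Suc i))" for i
  proof -
    have "i < length (p (Suc i))" using len[of "Suc i"] by simp
    then show ?thesis
      using walk_nth[OF walk[of "Suc i"], of i] eta[of i "Suc i"] eta[of "Suc i" "Suc i"]
      by (simp del: nth_Cons_Suc)
  qed
  moreover have "inj \<eta>"
  proof (rule injI)
    fix i j assume ij: "\<eta> i = \<eta> j"
    let ?n = "max i j"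
    have "i \<le> length (p ?n)" "j \<le> length (p ?n)" using len[of ?n] by auto
    then show "i = j" using ij eta[of i ?n] eta[of j ?n] dist[of ?n]
      by (metis le_imp_less_Suc length_Cons nth_eq_iff_index_eq)
  qed
  moreover have "\<bar>\<Sum>i<N. crossing w (\<eta> i) (\<eta> (Suc i))\<bar> \<le> b" for N
  proof -
    have "(\<Sum>i<N. crossing w (\<eta> i) (\<eta> (Suc i))) = wsum w ?O (take N (p N))"
      by (rule S) (rule len)
    then show ?thesis using bd[of N N] by (simp only:)
  qed
  moreover have "\<exists>N\<ge>n. \<bar>\<Sum>i<N. crossing w (\<eta> i) (\<eta> (Suc i))\<bar> < \<epsilon>" if pos: "\<epsilon> > 0" for \<epsilon> n
  proof -
    obtain n1 where n1: "inverse (real (Suc n1)) < \<epsilon>" using reals_Archimedean[OF pos] by auto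
    define n' where "n' = max n n1"
    have "inverse (real (Suc n')) \<le> inverse (real (Suc n1))" unfolding n'_def by (intro le_imp_inverse_le) auto
    then have "\<bar>wsum w ?O (p (Suc n'))\<bar> < \<epsilon>" using small[of n'] n1 by linarith
    moreover have "n \<le> length (p (Suc n'))" using len[of "Suc n'"] unfolding n'_def by simp
    moreover have "(\<Sum>i<length (p (Suc n')). crossing w (\<eta> i) (\<eta> (Suc i))) = wsum w ?O (p (Suc n'))"
      unfolding S[OF order_refl] by simp
    ultimately show ?thesis by (intro exI[of _ "length (p (Suc n'))"]) auto
  qed
  ultimately show ?thesis unfolding balanced_path_def by blast
qed

text \<open>Choose the next summand so that it points back whenever the running sum is outside the
range of the total.\<close>

lemma reorder_small_prefix:
  fixes l :: "real list"
  assumes "\<And>a. a \<in> set l \<Longrightarrow> \<bar>a\<bar> \<le> c" and "\<bar>p\<bar> \<le> \<bar>p + sum_list l\<bar> + c" and "c \<ge> 0"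
  shows "\<exists>l'. set l' \<subseteq> set l \<and> sum_list l' = sum_list l \<and>
    (\<forall>j. \<bar>p + sum_list (take j l')\<bar> \<le> \<bar>p + sum_list l\<bar> + c)"
  using assms
proof (induction "length l" arbitrary: l p)
  case 0
  then show ?case by (intro exI[of _ "[]"]) simp
next
  case (Suc n)
  define T where "T = p + sum_list l"
  have ne: "l \<noteq> []" using Suc.hyps(2) by auto
  have "\<exists>a\<in>set l. \<bar>p + a\<bar> \<le> \<bar>T\<bar> + c"
  proof -
    consider "p > \<bar>T\<bar>" | "p < - \<bar>T\<bar>" | "\<bar>p\<bar> \<le> \<bar>T\<bar>" by linarith
    then show ?thesis
    proof cases
      case 1
      have "\<exists>a\<in>set l. a < 0"
      proof (rule ccontr)
        assume "\<not> ?thesis"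
        then have "sum_list l \<ge> 0" by (intro sum_list_nonneg) auto
        then show False using 1 unfolding T_def by linarith
      qed
      then obtain a where a: "a \<in> set l" "a < 0" by blast
      have "\<bar>a\<bar> \<le> c" using a Suc.prems by blast
      then have "\<bar>p + a\<bar> \<le> \<bar>T\<bar> + c" using 1 a Suc.prems(2) unfolding T_def by linarith
      then show ?thesis using a by blast
    next
      case 2
      have "\<exists>a\<in>set l. a > 0"
      proof (rule ccontr)
        assume "\<not> ?thesis"
        then have "sum_list l \<le> 0" by (intro sum_list_nonpos) auto
        then show False using 2 unfolding T_def by linarith
      qed
      then obtain a where a: "a \<in> set l" "a > 0" by blast
      have "\<bar>a\<bar> \<le> c" using a Suc.prems by blast
      then have "\<bar>p + a\<bar> \<le> \<bar>T\<bar> + c" using 2 a Suc.prems(2) unfolding T_def by linarith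
      then show ?thesis using a by blast
    next
      case 3
      have "hd l \<in> set l" using ne by simp
      moreover from this have "\<bar>hd l\<bar> \<le> c" using Suc.prems by blast
      ultimately show ?thesis using 3 by (intro bexI[of _ "hd l"]) linarith
    qed
  qed
  then obtain a where a: "a \<in> set l" "\<bar>p + a\<bar> \<le> \<bar>T\<bar> + c" by blast
  define l1 where "l1 = remove1 a l"
  have sum1: "sum_list l = a + sum_list l1" unfolding l1_def using a(1) by (rule sum_list_map_remove1[where f = "\<lambda>x. x", simplified])
  have len1: "n = length l1" unfolding l1_def using Suc.hyps(2) a(1) by (simp add: length_remove1)
  have set1: "set l1 \<subseteq> set l" unfolding l1_def by (rule set_remove1_subset)
  have T1: "p + a + sum_list l1 = T" unfolding T_def sum1 by simp
  have "\<exists>l'. set l' \<subseteq> set l1 \<and> sum_list l' = sum_list l1 \<and>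
    (\<forall>j. \<bar>p + a + sum_list (take j l')\<bar> \<le> \<bar>p + a + sum_list l1\<bar> + c)"
    by (rule Suc.hyps(1)[OF len1]) (use Suc.prems set1 a(2) T1 in auto)
  then obtain l' where l': "set l' \<subseteq> set l1" "sum_list l' = sum_list l1"
    "\<And>j. \<bar>p + a + sum_list (take j l')\<bar> \<le> \<bar>T\<bar> + c" unfolding T1 by blast
  have "\<bar>p + sum_list (take j (a # l'))\<bar> \<le> \<bar>T\<bar> + c" for j
  proof (cases j)
    case 0
    then show ?thesis using Suc.prems(2) unfolding T_def by simp
  next
    case (Suc i)
    then show ?thesis using l'(3)[of i] by (simp add: add.assoc)
  qed
  then show ?case
    using l' a(1) set1 sum1 unfolding T_def by (intro exI[of _ "a # l'"]) auto
qed

text \<open>An abstract chain of crossings from \<open>P i\<close> to \<open>P (Suc i)\<close> in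
disjoint regions, each available with a nonnegative sum \<open>rp i\<close> and with a nonpositive
sum \<open>rn i\<close>. At usable indices, both sums can be shifted by \<open>\<gamma> i\<close>,
and these shifts approximate every difference of two possible steps. The walk \<open>p0\<close>
leads from the origin to the first entrance.\<close>

locale steered_walk =
  fixes w :: env and k :: real and L :: nat and bnd :: real and spn :: "nat \<Rightarrow> vertex set"
    and P :: "nat \<Rightarrow> vertex" and \<gamma> rp rn :: "nat \<Rightarrow> real" and usable :: "nat \<Rightarrow> bool"
    and V :: "real set" and p0 :: "vertex list"
  assumes k: "k \<ge> 0"
    and rp: "\<And>i. 0 \<le> rp i \<and> rp i \<le> bnd \<and> conn w k L (spn i) (P i) (P (Suc i)) (rp i)"
    and rn: "\<And>i. - bnd \<le> rn i \<and> rn i \<le> 0 \<and> conn w k L (spn i) (P i) (P (Suc i)) (rn i)"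
    and gadget: "\<And>i. usable i \<Longrightarrow> conn w k L (spn i) (P i) (P (Suc i)) (rp i + \<gamma> i) \<and>
        conn w k L (spn i) (P i) (P (Suc i)) (rn i + \<gamma> i)"
    and spn: "\<And>i j. i \<noteq> j \<Longrightarrow> spn i \<inter> spn j = {}"
    and P_ne: "\<And>i. P i \<noteq> P (Suc i)"
    and P_even: "\<And>i. even (fst (P i) + snd (P i))"
    and V: "\<And>u v. adjacent u v \<Longrightarrow> \<bar>crossing w u v\<bar> \<le> k \<Longrightarrow> crossing w u v \<in> V"
    and V_minus: "\<And>x. x \<in> V \<Longrightarrow> - x \<in> V" and V_bd: "\<And>x. x \<in> V \<Longrightarrow> \<bar>x\<bar> \<le> k"
    and types: "\<And>x y \<epsilon> N. x \<in> V \<Longrightarrow> y \<in> V \<Longrightarrow> \<epsilon> > 0 \<Longrightarrow> \<exists>i\<ge>N. usable i \<and> \<bar>\<gamma> i - (x - y)\<bar> < \<epsilon>"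
    and p0: "walk w k (0, 0) p0" "last ((0, 0) # p0) = P 0" "distinct ((0, 0) # p0)"
      "\<And>i. set ((0, 0) # p0) \<inter> spn i = {}"
begin

definition differences :: "real set" where "differences = {x - y | x y. x \<in> V \<and> y \<in> V}"

definition generated :: "real set" where
  "generated = {s. \<exists>l. set l \<subseteq> differences \<and> sum_list l = s}"

lemma generated_add: "s \<in> generated \<Longrightarrow> t \<in> generated \<Longrightarrow> s + t \<in> generated"
proof -
  assume "s \<in> generated" "t \<in> generated"
  then obtain l l' where "set l \<subseteq> differences" "sum_list l = s" "set l' \<subseteq> differences" "sum_list l' = t"
    unfolding generated_def by blast
  then show ?thesis unfolding generated_def by (intro CollectI exI[of _ "l @ l'"]) auto
qed

lemma generated_minus: "s \<in> generated \<Longrightarrow> - s \<in> generated"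
proof -
  assume "s \<in> generated"
  then obtain l where l: "set l \<subseteq> differences" "sum_list l = s" unfolding generated_def by blast
  have "set (map uminus l) \<subseteq> differences"
  proof
    fix z assume "z \<in> set (map uminus l)"
    then obtain x y where "x \<in> V" "y \<in> V" "z = - (x - y)" using l unfolding differences_def by auto
    then show "z \<in> differences" unfolding differences_def by (intro CollectI exI[of _ y] exI[of _ x]) simp
  qed
  moreover have "sum_list (map uminus l) = - s" using l(2) by (induction l arbitrary: s) auto
  ultimately show ?thesis unfolding generated_def by blast
qed

lemma even_walk_generated: "walk w k u p \<Longrightarrow> even (length p) \<Longrightarrow> wsum w u p \<in> generated"
proof (induction "length p" arbitrary: u p rule: less_induct)
  case less
  show ?case
  proof (cases p)
    case Nil
    then show ?thesis unfolding generated_def by (auto intro: exI[of _ "[]"])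
  next
    case (Cons v q)
    then obtain x r where q: "q = x # r" using less.prems by (cases q) auto
    have 1: "crossing w u v \<in> V" "- crossing w v x \<in> V"
      using V V_minus less.prems unfolding Cons q by auto
    have "crossing w u v + crossing w v x = crossing w u v - - crossing w v x" by simp
    then have "crossing w u v + crossing w v x \<in> differences"
      unfolding differences_def using 1 by blast
    then have "crossing w u v + crossing w v x \<in> generated"
      unfolding generated_def by (intro CollectI exI[of _ "[crossing w u v + crossing w v x]"]) auto
    moreover have "wsum w x r \<in> generated"
      using less unfolding Cons q by auto
    ultimately show ?thesis unfolding Cons q using generated_add by (simp add: add.assoc[symmetric])
  qed
qed

lemma conn_generated: "conn w k L' A (P i) (P j) s \<Longrightarrow> s \<in> generated"
proof -
  assume "conn w k L' A (P i) (P j) s"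
  then obtain p where p: "walk w k (P i) p" "last (P i # p) = P j" "wsum w (P i) p = s"
    unfolding conn_def by blast
  have "even (length p)" using walk_parity[OF p(1)] P_even[of i] P_even[of j] unfolding p(2)
    by (simp add: even_add)
  then show ?thesis using even_walk_generated[OF p(1)] p(3) by simp
qed

text \<open>Wait for a shift close to the first summand of \<open>l\<close>, then for one close to
the second, and so on. The errors add up to at most \<open>\<delta>\<close> per summand.\<close>

lemma gather:
  assumes "set l \<subseteq> differences" "\<delta> > 0"
  shows "\<exists>u e. e \<ge> N \<and> u \<subseteq> {N..<e} \<and> (\<forall>i\<in>u. usable i) \<and>
    (\<forall>i. \<exists>j\<le>length l. \<bar>(\<Sum>t\<in>u \<inter> {..<i}. \<gamma> t) - sum_list (take j l)\<bar> \<le> \<delta> * real j) \<and>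
    \<bar>(\<Sum>t\<in>u. \<gamma> t) - sum_list l\<bar> \<le> \<delta> * real (length l)"
  using assms(1)
proof (induction l arbitrary: N)
  case Nil
  then show ?case by (intro exI[of _ "{}"] exI[of _ N]) auto
next
  case (Cons a l)
  obtain x y where xy: "x \<in> V" "y \<in> V" "a = x - y" using Cons.prems unfolding differences_def by auto
  obtain i0 where i0: "i0 \<ge> N" "usable i0" "\<bar>\<gamma> i0 - a\<bar> < \<delta>"
    using types[OF xy(1,2) assms(2), of N] xy(3) by blast
  obtain u e where ue: "e \<ge> Suc i0" "u \<subseteq> {Suc i0..<e}" "\<forall>i\<in>u. usable i"
    "\<forall>i. \<exists>j\<le>length l. \<bar>(\<Sum>t\<in>u \<inter> {..<i}. \<gamma> t) - sum_list (take j l)\<bar> \<le> \<delta> * real j"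
    "\<bar>(\<Sum>t\<in>u. \<gamma> t) - sum_list l\<bar> \<le> \<delta> * real (length l)"
    using Cons.IH[of "Suc i0"] Cons.prems by auto
  have finu: "finite u" using ue(2) finite_subset by blast
  have notin: "i0 \<notin> u" using ue(2) by auto
  have step: "\<bar>\<gamma> i0 + z - (a + z')\<bar> \<le> \<delta> * real (Suc j)" if "\<bar>z - z'\<bar> \<le> \<delta> * real j" for z z' j
    using that i0(3) by (simp add: algebra_simps)
  have 1: "\<exists>j\<le>length (a # l). \<bar>(\<Sum>t\<in>insert i0 u \<inter> {..<i}. \<gamma> t) - sum_list (take j (a # l))\<bar> \<le> \<delta> * real j" for i
  proof (cases "i \<le> i0")
    case True
    then have "insert i0 u \<inter> {..<i} = {}" using ue(2) by auto
    then show ?thesis by (intro exI[of _ 0]) simp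
  next
    case False
    obtain j where j: "j \<le> length l" "\<bar>(\<Sum>t\<in>u \<inter> {..<i}. \<gamma> t) - sum_list (take j l)\<bar> \<le> \<delta> * real j"
      using ue(4) by blast
    have "insert i0 u \<inter> {..<i} = insert i0 (u \<inter> {..<i})" using False by auto
    then have "(\<Sum>t\<in>insert i0 u \<inter> {..<i}. \<gamma> t) = \<gamma> i0 + (\<Sum>t\<in>u \<inter> {..<i}. \<gamma> t)"
      using finu notin by simp
    then show ?thesis using step[OF j(2)] j(1) by (intro exI[of _ "Suc j"]) simp
  qed
  have 2: "\<bar>(\<Sum>t\<in>insert i0 u. \<gamma> t) - sum_list (a # l)\<bar> \<le> \<delta> * real (length (a # l))"
    using step[OF ue(5)] finu notin by simp
  show ?case
    using 1 2 ue(1-3) i0(1,2) by (intro exI[of _ "insert i0 u"] exI[of _ e]) auto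
qed

text \<open>The bounds for the sums at the ends of the stages, for the sums at all entrances, and
for all partial sums.\<close>

definition D :: real where "D = max 1 (max bnd \<bar>wsum w (0, 0) p0\<bar>)"

definition B1 :: real where "B1 = 2 * D + 2 * k + 1"

definition B2 :: real where "B2 = B1 + k * real L + k * real (length p0)"

definition reached :: "vertex list \<Rightarrow> nat \<Rightarrow> bool" where
  "reached p I \<longleftrightarrow> walk w k (0, 0) p \<and> last ((0, 0) # p) = P I \<and> distinct ((0, 0) # p) \<and>
     (\<forall>i\<ge>I. set ((0, 0) # p) \<inter> spn i = {}) \<and> (\<forall>j. \<bar>wsum w (0, 0) (take j p)\<bar> \<le> B2)"

lemma reached_extend:
  assumes "reached p I" "conn w k L (spn I) (P I) (P (Suc I)) c" "\<bar>wsum w (0, 0) p\<bar> \<le> B1"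
  shows "\<exists>q. q \<noteq> [] \<and> reached (p @ q) (Suc I) \<and> wsum w (0, 0) (p @ q) = wsum w (0, 0) p + c"
proof -
  note r = assms(1)[unfolded reached_def]
  obtain q where q: "walk w k (P I) q" "last (P I # q) = P (Suc I)" "distinct q" "set q \<subseteq> spn I"
    "length q \<le> L" "wsum w (P I) q = c" using assms(2) unfolding conn_def by blast
  have ne: "q \<noteq> []" using q(2) P_ne[of I] by auto
  have last: "last ((0, 0) # p) = P I" using r by blast
  have pre: "\<bar>wsum w (0, 0) (take j (p @ q))\<bar> \<le> B2" for j
  proof (cases "j \<le> length p")
    case True
    then show ?thesis using r by simp
  next
    case False
    then have "wsum w (0, 0) (take j (p @ q)) = wsum w (0, 0) p + wsum w (P I) (take (j - length p) q)"
      by (simp add: wsum_append last del: last.simps)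
    moreover have "\<bar>wsum w (P I) (take (j - length p) q)\<bar> \<le> k * real (length q)"
      by (rule wsum_prefix_bound[OF q(1) k])
    moreover have "k * real (length q) \<le> k * real L" using q(5) k by (intro mult_left_mono) auto
    moreover have "k * real (length p0) \<ge> 0" using k by simp
    ultimately show ?thesis using assms(3) unfolding B2_def by linarith
  qed
  have disj: "set ((0, 0) # p) \<inter> set q = {}" using r q(4) by blast
  have "reached (p @ q) (Suc I)"
    unfolding reached_def
  proof (intro conjI allI impI)
    show "walk w k (0, 0) (p @ q)" unfolding walk_append last using r q(1) by blast
    show "last ((0, 0) # p @ q) = P (Suc I)" unfolding last_Cons_append last by (rule q(2))
    show "distinct ((0, 0) # p @ q)" using r q(3) disj by auto
    show "set ((0, 0) # p @ q) \<inter> spn i = {}" if "Suc I \<le> i" for i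
    proof -
      have "set ((0, 0) # p) \<inter> spn i = {}" using r that by (meson Suc_leD)
      moreover have "set q \<inter> spn i = {}" using q(4) spn[of I i] that by auto
      ultimately show ?thesis by auto
    qed
    show "\<bar>wsum w (0, 0) (take j (p @ q))\<bar> \<le> B2" for j by (rule pre)
  qed
  moreover have "wsum w (0, 0) (p @ q) = wsum w (0, 0) p + c"
    unfolding wsum_append last q(6) by simp
  ultimately show ?thesis using ne by blast
qed

lemma reached_extend_many:
  assumes "reached p I" "\<And>t. conn w k L (spn t) (P t) (P (Suc t)) (c t)"
    and "\<And>i. i < n \<Longrightarrow> \<bar>wsum w (0, 0) p + (\<Sum>t<i. c (I + t))\<bar> \<le> B1"
  shows "\<exists>q. (n > 0 \<longrightarrow> q \<noteq> []) \<and> reached (p @ q) (I + n) \<and>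
    wsum w (0, 0) (p @ q) = wsum w (0, 0) p + (\<Sum>t<n. c (I + t))"
  using assms(3)
proof (induction n)
  case 0
  then show ?case using assms(1) by (intro exI[of _ "[]"]) simp
next
  case (Suc n)
  then obtain q where q: "reached (p @ q) (I + n)"
    "wsum w (0, 0) (p @ q) = wsum w (0, 0) p + (\<Sum>t<n. c (I + t))" by auto
  have "\<bar>wsum w (0, 0) (p @ q)\<bar> \<le> B1" unfolding q(2) using Suc.prems[of n] by simp
  from reached_extend[OF q(1) assms(2) this] obtain q' where
    "q' \<noteq> []" "reached ((p @ q) @ q') (Suc (I + n))"
    "wsum w (0, 0) ((p @ q) @ q') = wsum w (0, 0) (p @ q) + c (I + n)" by blast
  then show ?case using q(2) by (intro exI[of _ "q @ q'"]) simp
qed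

lemma generated_wsum_reached: "reached p I \<Longrightarrow> wsum w (0, 0) p \<in> generated"
proof -
  assume r: "reached p I"
  then have "even (length p)"
    using walk_parity[of w k "(0, 0)" p] P_even[of I] unfolding reached_def by simp
  then show ?thesis using r even_walk_generated unfolding reached_def by blast
qed

text \<open>Steer by the crossings alone; the sums \<open>z n\<close> remain bounded by
\<open>D\<close> and in the generated group, and come close to one of their own values
\<open>g\<close> infinitely often. Superimposing shifts of total size about \<open>- g\<close> on
the same choices leaves a sum close to 0 at a later time at which \<open>z\<close> is close to
\<open>g\<close>.\<close>

lemma stage:
  assumes reached: "reached p I" and D: "\<bar>wsum w (0, 0) p\<bar> \<le> D" and "\<epsilon> > 0"
  shows "\<exists>q I'. q \<noteq> [] \<and> reached (p @ q) I' \<and> \<bar>wsum w (0, 0) (p @ q)\<bar> \<le> D \<and>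
    \<bar>wsum w (0, 0) (p @ q)\<bar> < \<epsilon>"
proof -
  define \<epsilon>' where "\<epsilon>' = min \<epsilon> 1"
  have \<epsilon>': "\<epsilon>' > 0" "\<epsilon>' \<le> \<epsilon>" "\<epsilon>' \<le> 1" using \<open>\<epsilon> > 0\<close> unfolding \<epsilon>'_def by auto
  have bnd: "bnd \<le> D" "D \<ge> 1" unfolding D_def by auto
  \<comment> \<open>Each crossing is chosen against the sign of the sum.\<close>
  define z where "z = rec_nat (wsum w (0, 0) p) (\<lambda>n s. s + (if s > 0 then rn (I + n) else rp (I + n)))"
  define c where "c n = (if z n > 0 then rn (I + n) else rp (I + n))" for n
  have z0: "z 0 = wsum w (0, 0) p" and zS: "z (Suc n) = z n + c n" for n
    unfolding z_def c_def by simp_all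
  have zsum: "z n = wsum w (0, 0) p + (\<Sum>t<n. c t)" for n
    by (induction n) (simp_all add: z0 zS)
  have zD: "\<bar>z n\<bar> \<le> D" for n
  proof (induction n)
    case 0
    then show ?case using D z0 by simp
  next
    case (Suc n)
    then show ?case using rp[of "I + n"] rn[of "I + n"] bnd unfolding zS c_def by auto
  qed
  have zG: "z n \<in> generated" for n
  proof (induction n)
    case 0
    then show ?case using generated_wsum_reached[OF reached] z0 by simp
  next
    case (Suc n)
    have "c n \<in> generated" unfolding c_def using rp[of "I + n"] rn[of "I + n"] conn_generated by auto
    then show ?case unfolding zS using Suc generated_add by blast
  qed
  have "bounded (range z)" using zD by (auto simp: bounded_iff)
  then obtain l r where r: "strict_mono r" "(z \<circ> r) \<longlonglongrightarrow> l" using bounded_imp_convergent_subsequence by blast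
  obtain n0 where n0: "\<And>n. n \<ge> n0 \<Longrightarrow> \<bar>z (r n) - l\<bar> < \<epsilon>' / 4"
    using LIMSEQ_D[OF r(2), of "\<epsilon>' / 4"] \<epsilon>' by auto
  define g where "g = z (r n0)"
  have near: "\<bar>z (r n) - g\<bar> < \<epsilon>' / 2" if "n \<ge> n0" for n
    using n0[OF that] n0[OF order_refl] unfolding g_def by linarith
  obtain l0 where l0: "set l0 \<subseteq> differences" "sum_list l0 = - g"
    using generated_minus[OF zG[of "r n0"]] unfolding g_def generated_def by blast
  have "\<bar>a\<bar> \<le> 2 * k" if "a \<in> differences" for a
  proof -
    obtain x y where "x \<in> V" "y \<in> V" "a = x - y" using \<open>a \<in> differences\<close> unfolding differences_def by blast
    then show ?thesis using V_bd[of x] V_bd[of y] by linarith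
  qed
  then have "\<exists>l'. set l' \<subseteq> set l0 \<and> sum_list l' = sum_list l0 \<and>
    (\<forall>j. \<bar>0 + sum_list (take j l')\<bar> \<le> \<bar>0 + sum_list l0\<bar> + 2 * k)"
    using l0(1) k by (intro reorder_small_prefix) auto
  then obtain l1 where l1: "set l1 \<subseteq> differences" "sum_list l1 = - g"
    "\<And>j. \<bar>sum_list (take j l1)\<bar> \<le> D + 2 * k"
  proof -
    assume *: "\<And>l1. set l1 \<subseteq> differences \<Longrightarrow> sum_list l1 = - g \<Longrightarrow>
      (\<And>j. \<bar>sum_list (take j l1)\<bar> \<le> D + 2 * k) \<Longrightarrow> thesis"
    assume "\<exists>l'. set l' \<subseteq> set l0 \<and> sum_list l' = sum_list l0 \<and>
      (\<forall>j. \<bar>0 + sum_list (take j l')\<bar> \<le> \<bar>0 + sum_list l0\<bar> + 2 * k)"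
    then obtain l' where l': "set l' \<subseteq> set l0" "sum_list l' = sum_list l0"
      "\<And>j. \<bar>sum_list (take j l')\<bar> \<le> \<bar>sum_list l0\<bar> + 2 * k" by auto
    have "\<bar>g\<bar> \<le> D" unfolding g_def by (rule zD)
    then have "\<bar>sum_list (take j l')\<bar> \<le> D + 2 * k" for j
      using l'(3)[of j] l0(2) by linarith
    note bd = this
    have "set l' \<subseteq> differences" using l'(1) l0(1) by (rule order_trans)
    moreover have "sum_list l' = - g" using l'(2) l0(2) by simp
    ultimately show thesis by (rule *) (rule bd)
  qed
  \<comment> \<open>The index of the denominator is increased by one because \<open>l1\<close> may be empty.\<close>
  define \<delta> where "\<delta> = \<epsilon>' / 4 / real (Suc (length l1))"
  have \<delta>: "\<delta> > 0" unfolding \<delta>_def using \<epsilon>' by simp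
  have \<delta>j: "\<delta> * real j \<le> \<epsilon>' / 4" if "j \<le> length l1" for j
  proof -
    have "\<delta> * real j \<le> \<delta> * real (Suc (length l1))" using that \<delta> by (intro mult_left_mono) auto
    also have "\<dots> = \<epsilon>' / 4" unfolding \<delta>_def
      by (subst times_divide_eq_left, rule nonzero_mult_div_cancel_right) simp
    finally show ?thesis .
  qed
  obtain u e where u: "e \<ge> I" "u \<subseteq> {I..<e}" "\<And>i. i \<in> u \<Longrightarrow> usable i"
    "\<And>i. \<exists>j\<le>length l1. \<bar>(\<Sum>t\<in>u \<inter> {..<i}. \<gamma> t) - sum_list (take j l1)\<bar> \<le> \<delta> * real j"
    "\<bar>(\<Sum>t\<in>u. \<gamma> t) - sum_list l1\<bar> \<le> \<delta> * real (length l1)"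
    using gather[OF l1(1) \<delta>, of I] by blast
  have finu: "finite u" using u(2) finite_subset by blast
  define M where "M = r (max n0 (Suc e))"
  have M: "M \<ge> Suc e" "\<bar>z M - g\<bar> < \<epsilon>' / 2"
    using seq_suble[OF r(1), of "max n0 (Suc e)"] near[of "max n0 (Suc e)"] unfolding M_def by auto
  define c' where "c' t = (if z (t - I) > 0 then rn t else rp t) + (if t \<in> u then \<gamma> t else 0)" for t
  have c'conn: "conn w k L (spn t) (P t) (P (Suc t)) (c' t)" for t
    unfolding c'_def using rp[of t] rn[of t] gadget[of t] u(3)[of t] by auto
  have c'I: "c' (I + t) = c t + (if I + t \<in> u then \<gamma> (I + t) else 0)" for t
    unfolding c'_def c_def by simp
  have gsum: "(\<Sum>t<i. if I + t \<in> u then \<gamma> (I + t) else 0) = (\<Sum>t\<in>u \<inter> {..<I + i}. \<gamma> t)" for i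
  proof -
    have "(\<Sum>t\<in>u \<inter> {..<I + i}. \<gamma> t) = (\<Sum>t\<in>{I..<I + i}. if t \<in> u then \<gamma> t else 0)"
      using u(2) by (subst sum.inter_restrict[symmetric]) (auto intro!: sum.cong)
    also have "\<dots> = (\<Sum>t\<in>{0..<i}. if I + t \<in> u then \<gamma> (I + t) else 0)"
      using sum.shift_bounds_nat_ivl[of "\<lambda>t. if t \<in> u then \<gamma> t else 0" 0 I i]
      by (simp add: add.commute cong: if_cong)
    finally show ?thesis by (simp add: atLeast0LessThan)
  qed
  have tot: "wsum w (0, 0) p + (\<Sum>t<i. c' (I + t)) = z i + (\<Sum>t\<in>u \<inter> {..<I + i}. \<gamma> t)" for i
    unfolding zsum c'I sum.distrib gsum by simp
  have port_bd: "\<bar>wsum w (0, 0) p + (\<Sum>t<i. c' (I + t))\<bar> \<le> B1" for i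
  proof -
    obtain j where j: "j \<le> length l1" "\<bar>(\<Sum>t\<in>u \<inter> {..<I + i}. \<gamma> t) - sum_list (take j l1)\<bar> \<le> \<delta> * real j"
      using u(4) by blast
    then show ?thesis unfolding tot B1_def using \<delta>j[OF j(1)] l1(3)[of j] zD[of i] \<epsilon>'(3) by linarith
  qed
  have "\<exists>q. (M > 0 \<longrightarrow> q \<noteq> []) \<and> reached (p @ q) (I + M) \<and>
    wsum w (0, 0) (p @ q) = wsum w (0, 0) p + (\<Sum>t<M. c' (I + t))"
    by (rule reached_extend_many[OF reached c'conn]) (rule port_bd)
  then obtain q where q: "M > 0 \<longrightarrow> q \<noteq> []" "reached (p @ q) (I + M)"
    "wsum w (0, 0) (p @ q) = z M + (\<Sum>t\<in>u \<inter> {..<I + M}. \<gamma> t)" unfolding tot by blast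
  have "u \<inter> {..<I + M} = u" using u(2) M(1) by auto
  then have "wsum w (0, 0) (p @ q) = z M + (\<Sum>t\<in>u. \<gamma> t)" using q(3) by simp
  then have "\<bar>wsum w (0, 0) (p @ q)\<bar> < \<epsilon>'"
    using u(5) \<delta>j[OF order_refl] M(2) l1(2) \<epsilon>'(1) by linarith
  then show ?thesis using q(1,2) M(1) \<epsilon>' bnd by (intro exI[of _ q] exI[of _ "I + M"]) auto
qed

theorem balanced_path: "balanced_path w"
proof -
  let ?Q = "\<lambda>n (x :: vertex list \<times> nat) y. \<exists>q. q \<noteq> [] \<and> fst y = fst x @ q \<and>
    \<bar>wsum w (0, 0) (fst y)\<bar> < inverse (real (Suc n))"
  let ?R = "\<lambda>n (x :: vertex list \<times> nat). reached (fst x) (snd x) \<and> \<bar>wsum w (0, 0) (fst x)\<bar> \<le> D"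
  have "\<exists>f. \<forall>n. ?R n (f n) \<and> ?Q n (f n) (f (Suc n))"
  proof (rule dependent_nat_choice)
    have "\<bar>wsum w (0, 0) (take j p0)\<bar> \<le> B2" for j
    proof -
      have "k * real L \<ge> 0" "D \<ge> 1" using k unfolding D_def by auto
      then show ?thesis
        using wsum_prefix_bound[OF p0(1) k, of j] k unfolding B2_def B1_def by linarith
    qed
    then have "reached p0 0" unfolding reached_def using p0 by blast
    moreover have "\<bar>wsum w (0, 0) p0\<bar> \<le> D" unfolding D_def by simp
    ultimately show "\<exists>x. ?R 0 x" by (intro exI[of _ "(p0, 0)"]) simp
  next
    fix x n assume "?R n x"
    then obtain q I' where q: "q \<noteq> []" "reached (fst x @ q) I'" "\<bar>wsum w (0, 0) (fst x @ q)\<bar> \<le> D"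
      "\<bar>wsum w (0, 0) (fst x @ q)\<bar> < inverse (real (Suc n))"
      using stage[of "fst x" "snd x" "inverse (real (Suc n))"] by auto
    then show "\<exists>y. ?R (Suc n) y \<and> ?Q n x y" by (intro exI[of _ "(fst x @ q, I')"]) auto
  qed
  then obtain f where f: "\<And>n. ?R n (f n)" "\<And>n. ?Q n (f n) (f (Suc n))" by blast
  show ?thesis
  proof (rule balanced_path_limit[of "\<lambda>n. fst (f n)" w k B2])
    show "\<exists>q. fst (f (Suc n)) = fst (f n) @ q \<and> q \<noteq> []" for n using f(2)[of n] by blast
    show "walk w k (0, 0) (fst (f n))" "distinct ((0, 0) # fst (f n))" for n
      using f(1)[of n] unfolding reached_def by blast+
    show "\<bar>wsum w (0, 0) (take j (fst (f n)))\<bar> \<le> B2" for n j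
      using f(1)[of n] unfolding reached_def by blast
    show "\<bar>wsum w (0, 0) (fst (f (Suc n)))\<bar> < inverse (real (Suc n))" for n using f(2)[of n] by blast
  qed
qed

end

section \<open>Good cells are likely\<close>

context edge_field
begin

lemma tight:
  fixes Z :: "env \<Rightarrow> real"
  assumes [measurable]: "Z \<in> borel_measurable field" and "\<epsilon> > 0"
  shows "\<exists>r\<ge>0. \<forall>r'\<ge>r. prob {w. \<bar>Z w\<bar> > r'} \<le> \<epsilon>"
proof -
  define A where "A n = {w. \<bar>Z w\<bar> > real n}" for n
  have A: "A n \<in> events" for n
  proof -
    have "{w \<in> space field. \<bar>Z w\<bar> > real n} \<in> events" by measurable
    then show ?thesis unfolding A_def by simp
  qed
  have "(\<lambda>n. prob (A n)) \<longlonglongrightarrow> prob (\<Inter>n. A n)"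
  proof (rule finite_Lim_measure_decseq)
    show "range A \<subseteq> events" using A by blast
    show "decseq A" by (auto simp: decseq_def A_def)
  qed
  moreover have "(\<Inter>n. A n) = {}"
  proof -
    have "w \<notin> (\<Inter>n. A n)" for w
    proof -
      obtain n where "real n > \<bar>Z w\<bar>" using reals_Archimedean2 by blast
      then have "w \<notin> A n" unfolding A_def by simp
      then show ?thesis by blast
    qed
    then show ?thesis by blast
  qed
  ultimately have "(\<lambda>n. prob (A n)) \<longlonglongrightarrow> 0" by simp
  then have "\<forall>\<^sub>F n in sequentially. prob (A n) < \<epsilon>" using \<open>\<epsilon> > 0\<close> by (rule order_tendstoD)
  then obtain n where n: "prob (A n) < \<epsilon>" unfolding eventually_sequentially by blast
  have "prob {w. \<bar>Z w\<bar> > r'} \<le> \<epsilon>" if "r' \<ge> real n" for r'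
  proof -
    have "prob {w. \<bar>Z w\<bar> > r'} \<le> prob (A n)"
      by (rule finite_measure_mono[OF _ A]) (use that in \<open>auto simp: A_def\<close>)
    then show ?thesis using n by simp
  qed
  then show ?thesis by (intro exI[of _ "real n"]) simp
qed

lemma law_tight:
  assumes "\<epsilon> > 0"
  shows "\<exists>r\<ge>0. \<forall>r'\<ge>r. \<forall>e. prob {w. \<bar>w e\<bar> > r'} \<le> \<epsilon>"
proof -
  have "\<exists>r\<ge>0. \<forall>r'\<ge>r. measure (law b) {x. \<bar>x\<bar> > r'} \<le> \<epsilon>" for b
  proof -
    have eq: "prob {w. \<bar>w (b, 0, 0)\<bar> > r'} = measure (law b) {x. \<bar>x\<bar> > r'}" for r'
    proof -
      have "{x :: real. \<bar>x\<bar> > r'} \<in> sets borel" by measurable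
      from prob_coord[OF this, of "(b, 0, 0)"] show ?thesis by simp
    qed
    show ?thesis using tight[of "\<lambda>w. w (b, 0, 0)" \<epsilon>] assms unfolding eq by simp
  qed
  then obtain r where r: "\<And>b. r b \<ge> 0" "\<And>b r'. r' \<ge> r b \<Longrightarrow> measure (law b) {x. \<bar>x\<bar> > r'} \<le> \<epsilon>" by metis
  have "prob {w. \<bar>w e\<bar> > r'} \<le> \<epsilon>" if "r' \<ge> max (r True) (r False)" for r' e
  proof -
    have "{x :: real. \<bar>x\<bar> > r'} \<in> sets borel" by measurable
    from prob_coord[OF this, of e] have "prob {w. \<bar>w e\<bar> > r'} = measure (law (fst e)) {x. \<bar>x\<bar> > r'}" by simp
    then show ?thesis using r(2)[of "fst e" r'] that by (cases "fst e") auto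
  qed
  moreover have "max (r True) (r False) \<ge> 0" using r(1)[of True] by simp
  ultimately show ?thesis by blast
qed

lemma law_half_lines_pos:
  "measure (law b) {0<..} > 0" "measure (law b) {..<0} > 0"
proof -
  interpret l: prob_space "law False" by (rule law_prob)
  have neg: "measure (law b) {..<0} = 0 \<longleftrightarrow> measure (law b) {0<..} = 0" for b
  proof -
    have "uminus -` {0<..} = {..<0 :: real}" by auto
    then show ?thesis using law_sym[of "{0<..}" b] by simp
  qed
  have "measure (law False) {0<..} \<noteq> 0"
  proof
    assume 0: "measure (law False) {0<..} = 0"
    have "- {0} = {0<..} \<union> {..<0 :: real}" by auto
    then have "measure (law False) (- {0}) \<le> measure (law False) {0<..} + measure (law False) {..<0}"
      by (simp add: measure_Un_le law_sets)
    then show False using 0 neg[of False] law_nontrivial by (simp add: measure_le_0_iff)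
  qed
  then have "measure (law b) {0<..} \<noteq> 0" for b using law_null[of "{0<..}"] by (cases b) auto
  then show "measure (law b) {0<..} > 0" "measure (law b) {..<0} > 0"
    using neg by (simp_all add: zero_less_measure_iff)
qed

lemma law_positive_gap: "\<exists>\<alpha>>0. measure (law False) {\<alpha>..} > 0"
proof (rule ccontr)
  assume *: "\<not> ?thesis"
  interpret l: prob_space "law False" by (rule law_prob)
  define A where "A n = {inverse (real (Suc n))..}" for n
  have "A n \<in> null_sets (law False)" for n
  proof (rule null_setsI)
    have "measure (law False) (A n) = 0"
      using * unfolding A_def by (auto simp: zero_less_measure_iff)
    then show "emeasure (law False) (A n) = 0" by (simp add: l.emeasure_eq_measure)
  qed (simp add: A_def law_sets)
  then have "(\<Union>n. A n) \<in> null_sets (law False)" by (rule null_sets_UN)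
  moreover have "{0<..} \<subseteq> (\<Union>n. A n)"
  proof
    fix x :: real assume "x \<in> {0<..}"
    then obtain n where "inverse (real (Suc n)) < x" using reals_Archimedean by auto
    then show "x \<in> (\<Union>n. A n)" unfolding A_def by (intro UN_I[of n]) auto
  qed
  ultimately have "{0<..} \<in> null_sets (law False)" using null_sets_subset[of "\<Union>n. A n"] by (simp add: law_sets)
  then show False using law_half_lines_pos(1)[of False] by (simp add: measure_eq_0_null_sets)
qed

lemma prob_pattern:
  assumes "finite E" "\<And>e. e \<in> E \<Longrightarrow> S e \<in> sets borel"
    and "\<And>e. e \<in> E \<Longrightarrow> measure (law (fst e)) (S e) \<ge> p" "0 \<le> p" "p \<le> 1" "card E \<le> c"
  shows "prob {w. \<forall>e\<in>E. w e \<in> S e} \<ge> p ^ c"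
proof -
  have "{w. w e \<in> S e} \<in> events" if "e \<in> E" for e
  proof -
    have [measurable]: "S e \<in> sets borel" using assms that by blast
    have "{w \<in> space field. w e \<in> S e} \<in> events" by measurable
    then show ?thesis by simp
  qed
  then have "prob {w. \<forall>e\<in>E. w e \<in> S e} = (\<Prod>e\<in>E. prob {w. w e \<in> S e})"
    by (intro prob_disjoint_local[of E _ "\<lambda>e. {e}"] assms) (auto simp: depends_on_def)
  also have "\<dots> = (\<Prod>e\<in>E. measure (law (fst e)) (S e))"
    by (intro prod.cong refl prob_coord assms)
  also have "\<dots> \<ge> (\<Prod>e\<in>E. p)" using assms by (intro prod_mono) auto
  also have "(\<Prod>e\<in>E. p) = p ^ card E" by simp
  finally show ?thesis using power_decreasing[OF assms(6,4,5)] by linarith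
qed

lemma height_gap_measurable [measurable]: "(\<lambda>w. height_gap w x y t) \<in> borel_measurable field"
  unfolding height_gap_def by measurable

lemma height_gap_add:
  "height_gap w x y (t + L) = height_gap w x y t + (\<Sum>i<L. w (False, x, y + int t + int i) - w (False, x + 1, y + int t + int i))"
  unfolding height_gap_def by (induction L) (simp_all add: add.assoc)

text \<open>\<open>L\<close> consecutive levels in which the left column gains at least
\<open>\<alpha>\<close> and the right one does not gain, with moderate top edges at both ends. The
gap of the two columns grows by at least \<open>L * \<alpha>\<close> during a run, so its absolute
value is at least half of this before or after the run.\<close>

definition run :: "real \<Rightarrow> real \<Rightarrow> nat \<Rightarrow> int \<Rightarrow> int \<Rightarrow> nat \<Rightarrow> env \<Rightarrow> bool" where
  "run \<alpha> R L x y t w \<longleftrightarrow>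
     (\<forall>i<L. w (False, x, y + int t + int i) \<ge> \<alpha> \<and> w (False, x + 1, y + int t + int i) \<le> 0) \<and>
     \<bar>w (True, x, y + int t)\<bar> \<le> R \<and> \<bar>w (True, x, y + int t + int L)\<bar> \<le> R"

lemma run_prob:
  assumes \<alpha>: "measure (law False) {\<alpha>..} > 0" and R: "measure (law True) {x. \<bar>x\<bar> \<le> R} > 0"
  shows "\<exists>\<theta>>0. \<forall>x y t. prob {w. run \<alpha> R L x y t w} \<ge> \<theta>"
proof -
  have le0: "measure (law False) {..0} > 0"
  proof -
    interpret l: prob_space "law False" by (rule law_prob)
    have "measure (law False) {..<0} \<le> measure (law False) {..0}"
      by (rule l.finite_measure_mono) (auto simp: law_sets)
    then show ?thesis using law_half_lines_pos(2)[of False] by linarith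
  qed
  define p where "p = min (measure (law False) {\<alpha>..}) (min (measure (law False) {..0}) (measure (law True) {x. \<bar>x\<bar> \<le> R}))"
  have p: "p > 0" "p \<le> 1"
    unfolding p_def using \<alpha> R le0 prob_space.prob_le_1[OF law_prob, of True] by (auto simp: min_le_iff_disj)
  have "prob {w. run \<alpha> R L x y t w} \<ge> p ^ (2 * L + 2)" for x y t
  proof -
    define S :: "bool \<times> int \<times> int \<Rightarrow> real set" where "S = (\<lambda>(b, x', y'). if b then {z. \<bar>z\<bar> \<le> R} else if x' = x then {\<alpha>..} else {..0 :: real})"
    define E where "E = (\<lambda>i. (False, x, y + int t + int i)) ` {..<L} \<union>
      (\<lambda>i. (False, x + 1, y + int t + int i)) ` {..<L} \<union> {(True, x, y + int t), (True, x, y + int t + int L)}"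
    have "card E \<le> card ((\<lambda>i. (False, x, y + int t + int i)) ` {..<L} \<union>
      (\<lambda>i. (False, x + 1, y + int t + int i)) ` {..<L}) + card {(True, x, y + int t), (True, x, y + int t + int L)}"
      unfolding E_def by (rule card_Un_le)
    also have "\<dots> \<le> card ((\<lambda>i. (False, x, y + int t + int i)) ` {..<L}) +
       card ((\<lambda>i. (False, x + 1, y + int t + int i)) ` {..<L}) + 2"
      by (intro add_mono card_Un_le) (simp add: card_insert_if)
    also have "\<dots> \<le> L + L + 2"
      by (intro add_mono order_refl card_image_le[THEN order_trans]) simp_all
    finally have card: "card E \<le> 2 * L + 2" by simp
    have "{z :: real. \<bar>z\<bar> \<le> R} \<in> sets borel" by measurable
    then have Sb: "S e \<in> sets borel" for e unfolding S_def by (cases e) auto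
    have "{w. run \<alpha> R L x y t w} = {w. \<forall>e\<in>E. w e \<in> S e}"
      unfolding run_def E_def S_def by (auto simp: ball_Un)
    moreover have "prob {w. \<forall>e\<in>E. w e \<in> S e} \<ge> p ^ (2 * L + 2)"
    proof (rule prob_pattern[OF _ Sb _ _ _ card])
      show "finite E" unfolding E_def by simp
      show "p \<le> measure (law (fst e)) (S e)" if "e \<in> E" for e
        using that unfolding E_def S_def p_def by (auto simp: min_le_iff_disj)
    qed (use p in auto)
    ultimately show ?thesis by simp
  qed
  then show ?thesis using p by (intro exI[of _ "p ^ (2 * L + 2)"]) simp
qed

lemma run_escape:
  assumes "run \<alpha> R L x y t w" "real L * \<alpha> \<ge> 2 * C"
  shows "\<exists>t'\<in>{t, t + L}. \<bar>height_gap w x y t'\<bar> \<ge> C \<and> \<bar>w (True, x, y + int t')\<bar> \<le> R"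
proof -
  have "(\<Sum>i<L. \<alpha>) \<le> (\<Sum>i<L. w (False, x, y + int t + int i) - w (False, x + 1, y + int t + int i))"
    by (rule sum_mono) (use assms(1) in \<open>force simp: run_def\<close>)
  then have "height_gap w x y (t + L) - height_gap w x y t \<ge> 2 * C"
    using assms(2) unfolding height_gap_add by simp
  then have "\<bar>height_gap w x y t\<bar> \<ge> C \<or> \<bar>height_gap w x y (t + L)\<bar> \<ge> C" by linarith
  then show ?thesis using assms(1) unfolding run_def by (auto simp: add.assoc)
qed

text \<open>Exchanging the two columns of a hump reverses the sign of the gap and leaves the top
edges and the law unchanged.\<close>

definition swap_columns :: "int \<Rightarrow> bool \<times> int \<times> int \<Rightarrow> bool \<times> int \<times> int" where
  "swap_columns x = (\<lambda>(b, x', y). (b, if b then x' else if x' = x then x + 1 else if x' = x + 1 then x else x', y))"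

lemma swap_columns_bij: "bij (swap_columns x)"
  by (rule o_bij[of "swap_columns x"]) (auto simp: swap_columns_def fun_eq_iff)

lemma height_gap_swap: "height_gap (w \<circ> swap_columns x) x y t = - height_gap w x y t"
  unfolding height_gap_def sum_negf[symmetric] by (rule sum.cong) (auto simp: swap_columns_def)

text \<open>In a tall hump a run occurs with probability at least 1/2, which makes the gap large in
absolute value. By symmetry, each sign accounts for half of this.\<close>

lemma hump_prob:
  assumes R: "measure (law True) {x. \<bar>x\<bar> \<le> R} > 0"
  shows "\<exists>B0. \<forall>B\<ge>B0. \<forall>x y.
    prob {w. \<exists>t\<in>{1..<B}. height_gap w x y t \<ge> C \<and> \<bar>w (True, x, y + int t)\<bar> \<le> R} \<ge> 1 / 4 \<and>
    prob {w. \<exists>t\<in>{1..<B}. height_gap w x y t \<le> - C \<and> \<bar>w (True, x, y + int t)\<bar> \<le> R} \<ge> 1 / 4"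
proof -
  obtain \<alpha> where \<alpha>: "\<alpha> > 0" "measure (law False) {\<alpha>..} > 0" using law_positive_gap by blast
  obtain L :: nat where "real L > 2 * C / \<alpha>" using reals_Archimedean2 by blast
  then have L: "real L * \<alpha> \<ge> 2 * C" using \<alpha> by (simp add: field_simps)
  obtain \<theta> where \<theta>: "\<theta> > 0" "\<And>x y t. prob {w. run \<alpha> R L x y t w} \<ge> \<theta>"
    using run_prob[OF \<alpha>(2) R] by blast
  have \<theta>1: "\<theta> \<le> 1" using \<theta>(2)[of 0 0 0] prob_le_1 by (meson order_trans)
  obtain n where n: "(1 - \<theta>) ^ n < 1 / 2"
    using real_arch_pow_inv[of "1 / 2" "1 - \<theta>"] \<theta> by auto
  define pos where "pos s = 1 + s * (L + 1)" for s
  have run_meas: "{w. run \<alpha> R L x y t w} \<in> events" for x y t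
  proof -
    have "{w \<in> space field. run \<alpha> R L x y t w} \<in> events" unfolding run_def by measurable
    then show ?thesis by simp
  qed
  have main: "prob {w. \<exists>t\<in>{1..<B}. height_gap w x y t \<ge> C \<and> \<bar>w (True, x, y + int t)\<bar> \<le> R} \<ge> 1 / 4 \<and>
    prob {w. \<exists>t\<in>{1..<B}. height_gap w x y t \<le> - C \<and> \<bar>w (True, x, y + int t)\<bar> \<le> R} \<ge> 1 / 4"
    if B: "B \<ge> 1 + n * (L + 1)" for B x y
  proof -
    define H where "H w \<longleftrightarrow> (\<exists>t\<in>{1..<B}. height_gap w x y t \<ge> C \<and> \<bar>w (True, x, y + int t)\<bar> \<le> R)" for w
    define H' where "H' w \<longleftrightarrow> (\<exists>t\<in>{1..<B}. height_gap w x y t \<le> - C \<and> \<bar>w (True, x, y + int t)\<bar> \<le> R)" for w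
    have "{w \<in> space field. H w} \<in> events" unfolding H_def by measurable
    then have Hm: "{w. H w} \<in> events" by simp
    have "{w \<in> space field. H' w} \<in> events" unfolding H'_def by measurable
    then have H'm: "{w. H' w} \<in> events" by simp
    have "H' w = H (w \<circ> swap_columns x)" for w
      unfolding H_def H'_def height_gap_swap le_minus_iff[of C] by (simp add: swap_columns_def)
    then have sym: "prob {w. H' w} = prob {w. H w}"
      using prob_reindex[OF swap_columns_bij _ Hm, of x] by (simp add: swap_columns_def split_beta)
    have "prob {w. \<forall>s\<in>{..<n}. \<not> run \<alpha> R L x y (pos s) w} = (\<Prod>s\<in>{..<n}. prob {w. \<not> run \<alpha> R L x y (pos s) w})"
    proof (rule prob_disjoint_local)
      let ?E = "\<lambda>s. UNIV \<times> UNIV \<times> {y + int (pos s)..y + int (pos s) + int L}"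
      show "depends_on (\<lambda>w. \<not> run \<alpha> R L x y (pos s) w) (?E s)" for s
        unfolding depends_on_def run_def by auto
      show "{w. \<not> run \<alpha> R L x y (pos s) w} \<in> events" for s
        using sets.compl_sets[OF run_meas] by (simp add: Collect_neg_eq Compl_eq_Diff_UNIV)
      have lt: "pos s + L < pos s'" if "s < s'" for s s'
      proof -
        have "Suc s * (L + 1) \<le> s' * (L + 1)" using that by (intro mult_right_mono) auto
        then show ?thesis unfolding pos_def by simp
      qed
      show "?E s \<inter> ?E s' = {}" if "s \<noteq> s'" for s s'
        using lt[of s s'] lt[of s' s] that by (cases "s < s'") auto
    qed simp
    also have "\<dots> \<le> (\<Prod>s\<in>{..<n}. 1 - \<theta>)"
    proof (rule prod_mono, safe)
      fix s
      have "prob {w. \<not> run \<alpha> R L x y (pos s) w} = 1 - prob {w. run \<alpha> R L x y (pos s) w}"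
        using prob_compl[OF run_meas] by (simp add: Collect_neg_eq Compl_eq_Diff_UNIV)
      then show "prob {w. \<not> run \<alpha> R L x y (pos s) w} \<le> 1 - \<theta>" using \<theta>(2)[of x y "pos s"] by simp
    qed simp
    also have "\<dots> = (1 - \<theta>) ^ n" by simp
    finally have none: "prob {w. \<forall>s\<in>{..<n}. \<not> run \<alpha> R L x y (pos s) w} \<le> 1 / 2" using n by simp
    have sub: "space field - ({w. H w} \<union> {w. H' w}) \<subseteq> {w. \<forall>s\<in>{..<n}. \<not> run \<alpha> R L x y (pos s) w}"
    proof (safe)
      fix w s assume w: "\<not> H w" "\<not> H' w" "s < n" "run \<alpha> R L x y (pos s) w"
      obtain t where t: "t \<in> {pos s, pos s + L}" "\<bar>height_gap w x y t\<bar> \<ge> C" "\<bar>w (True, x, y + int t)\<bar> \<le> R"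
        using run_escape[OF w(4) L] by blast
      have "Suc s * (L + 1) \<le> n * (L + 1)" using w(3) by (intro mult_right_mono) auto
      then have "t \<in> {1..<B}" using t(1) B unfolding pos_def by auto
      moreover have "height_gap w x y t \<ge> C \<or> height_gap w x y t \<le> - C" using t(2) by linarith
      ultimately show False using w(1,2) t(3) unfolding H_def H'_def by blast
    qed
    have "{w \<in> space field. \<forall>s\<in>{..<n}. \<not> run \<alpha> R L x y (pos s) w} \<in> events"
      by (intro sets.sets_Collect_finite_All sets.sets_Collect_neg) (use run_meas in auto)
    then have "prob (space field - ({w. H w} \<union> {w. H' w})) \<le> 1 / 2"
      using finite_measure_mono[OF sub] none by simp
    then have "prob ({w. H w} \<union> {w. H' w}) \<ge> 1 / 2"
      using prob_compl[of "{w. H w} \<union> {w. H' w}"] Hm H'm by auto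
    moreover have "prob ({w. H w} \<union> {w. H' w}) \<le> prob {w. H w} + prob {w. H' w}"
      by (rule measure_Un_le[OF Hm H'm])
    ultimately have "prob {w. H w} \<ge> 1 / 4" "prob {w. H' w} \<ge> 1 / 4" using sym by linarith+
    then show ?thesis unfolding H_def H'_def by blast
  qed
  then show ?thesis by blast
qed

definition column :: "nat \<Rightarrow> env \<Rightarrow> int \<Rightarrow> int \<Rightarrow> real" where
  "column B w x y = (\<Sum>i<B. w (False, x, y + int i))"

lemma column_measurable [measurable]: "(\<lambda>w. column B w x y) \<in> borel_measurable field"
  unfolding column_def by measurable

lemma events_Collect: "{w \<in> space field. Q w} \<in> events \<Longrightarrow> {w. Q w} \<in> events"
  by simp

lemma events_Collect_not: "{w. Q w} \<in> events \<Longrightarrow> {w. \<not> Q w} \<in> events"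
  using sets.compl_sets[of "{w. Q w}" field] by (simp add: Collect_neg_eq Compl_eq_Diff_UNIV)

text \<open>Scanning \<open>r \<mapsto> P (column \<ge> r)\<close> in unit steps from a value where
it is at least 1/2 finds the last such value \<open>m\<close>; at \<open>m + 1\<close> it is smaller
than 1/2.\<close>

lemma column_median:
  "\<exists>m. \<forall>x y. prob {w. column B w x y \<ge> m} \<ge> 1 / 2 \<and> prob {w. column B w x y \<le> m + 1} \<ge> 1 / 2"
proof -
  define f where "f r = prob {w. column B w 0 0 \<ge> r}" for r
  obtain r where r: "r \<ge> 0" "\<And>r'. r' \<ge> r \<Longrightarrow> prob {w. \<bar>column B w 0 0\<bar> > r'} \<le> 1 / 3"
    using tight[of "\<lambda>w. column B w 0 0" "1 / 3"] by auto
  have ge: "{w. column B w x y \<ge> c} \<in> events" for c x y by (rule events_Collect) measurable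
  have le: "{w. column B w x y \<le> c} \<in> events" for c x y by (rule events_Collect) measurable
  have gt: "{w. \<bar>column B w 0 0\<bar> > c} \<in> events" for c by (rule events_Collect) measurable
  have low: "f (- r) \<ge> 1 / 2"
  proof -
    have "prob (space field - {w. \<bar>column B w 0 0\<bar> > r}) = 1 - prob {w. \<bar>column B w 0 0\<bar> > r}"
      by (rule prob_compl[OF gt])
    moreover have "prob (space field - {w. \<bar>column B w 0 0\<bar> > r}) \<le> f (- r)"
      unfolding f_def by (rule finite_measure_mono[OF _ ge]) auto
    ultimately show ?thesis using r(2)[OF order_refl] by linarith
  qed
  obtain d :: nat where d: "real d > 2 * r" using reals_Archimedean2 by blast
  have high: "f (- r + real d) < 1 / 2"
  proof -
    have "f (- r + real d) \<le> prob {w. \<bar>column B w 0 0\<bar> > r}"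
      unfolding f_def by (rule finite_measure_mono[OF _ gt]) (use d in auto)
    then show ?thesis using r(2)[OF order_refl] by linarith
  qed
  define d0 where "d0 = (LEAST d. f (- r + real d) < 1 / 2)"
  have d0: "f (- r + real d0) < 1 / 2" unfolding d0_def using high by (rule LeastI)
  have "d0 \<noteq> 0" using d0 low by (cases d0) auto
  then obtain d1 where d1: "d0 = Suc d1" by (cases d0) auto
  have fd1: "f (- r + real d1) \<ge> 1 / 2"
    using not_less_Least[of d1 "\<lambda>d. f (- r + real d) < 1 / 2"] d1 unfolding d0_def by simp
  define m where "m = - r + real d1"
  have m1: "prob {w. column B w 0 0 \<le> m + 1} \<ge> 1 / 2"
  proof -
    have "prob (space field - {w. column B w 0 0 \<ge> m + 1}) = 1 - f (m + 1)"
      unfolding f_def by (rule prob_compl[OF ge])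
    moreover have "prob (space field - {w. column B w 0 0 \<ge> m + 1}) \<le> prob {w. column B w 0 0 \<le> m + 1}"
      by (rule finite_measure_mono[OF _ le]) auto
    moreover have "f (m + 1) < 1 / 2" using d0 unfolding m_def d1 by (simp add: add_ac)
    ultimately show ?thesis by linarith
  qed
  have shift: "prob {w. column B w x y \<ge> c} = prob {w. column B w 0 0 \<ge> c}"
      "prob {w. column B w x y \<le> c} = prob {w. column B w 0 0 \<le> c}" for x y c
  proof -
    define \<sigma> where "\<sigma> = (\<lambda>(b :: bool, x', y'). (b, x' + x, y' + y))"
    have bij: "bij \<sigma>"
      by (rule o_bij[of "\<lambda>(b, x', y'). (b, x' - x, y' - y)"]) (auto simp: \<sigma>_def fun_eq_iff)
    have col: "column B (w \<circ> \<sigma>) 0 0 = column B w x y" for w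
      unfolding column_def \<sigma>_def by (simp add: add.commute)
    have fst: "fst (\<sigma> e) = fst e" for e unfolding \<sigma>_def by (cases e) simp
    show "prob {w. column B w x y \<ge> c} = prob {w. column B w 0 0 \<ge> c}"
      "prob {w. column B w x y \<le> c} = prob {w. column B w 0 0 \<le> c}"
      using prob_reindex[OF bij fst ge[of c 0 0]] prob_reindex[OF bij fst le[of 0 0 c]]
      unfolding col by simp_all
  qed
  show ?thesis
  proof (intro exI[of _ m] allI conjI)
    fix x y
    show "prob {w. column B w x y \<ge> m} \<ge> 1 / 2"
      by (subst shift(1)) (rule fd1[unfolded f_def m_def[symmetric]])
    show "prob {w. column B w x y \<le> m + 1} \<ge> 1 / 2"
      by (subst shift(2)) (rule m1)
  qed
qed

lemma prob_none:
  assumes "\<And>k. depends_on (Q k) (E k)" "\<And>k. {w. Q k w} \<in> events"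
    and "\<And>k k'. k \<noteq> k' \<Longrightarrow> E k \<inter> E k' = {}" and "\<And>k. prob {w. Q k w} \<ge> p"
  shows "prob {w. \<not> (\<exists>k<n. Q k w)} \<le> (1 - p) ^ n"
proof -
  have neg: "{w. \<not> Q k w} \<in> events" for k
    using sets.compl_sets[OF assms(2)] by (simp add: Collect_neg_eq Compl_eq_Diff_UNIV)
  have "{w. \<not> (\<exists>k<n. Q k w)} = {w. \<forall>k\<in>{..<n}. \<not> Q k w}" by auto
  also have "prob {w. \<forall>k\<in>{..<n}. \<not> Q k w} = (\<Prod>k\<in>{..<n}. prob {w. \<not> Q k w})"
    by (rule prob_disjoint_local[OF _ depends_on_not[OF assms(1)] neg assms(3)]) simp_all
  also have "\<dots> \<le> (\<Prod>k\<in>{..<n}. 1 - p)"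
  proof (rule prod_mono, safe)
    fix k
    have "prob {w. \<not> Q k w} = 1 - prob {w. Q k w}"
      using prob_compl[OF assms(2)] by (simp add: Collect_neg_eq Compl_eq_Diff_UNIV)
    then show "prob {w. \<not> Q k w} \<le> 1 - p" using assms(4)[of k] by simp
  qed simp
  finally show ?thesis by simp
qed

lemma row_cost_tight:
  assumes "\<epsilon> > 0"
  shows "\<exists>r\<ge>0. \<forall>r'\<ge>r. \<forall>x y. prob {w. \<not> (\<Sum>i=0..<N. \<bar>w (True, x + int i, y)\<bar>) \<le> r'} \<le> \<epsilon>"
proof -
  obtain r where r: "r \<ge> 0" "\<And>r' e. r' \<ge> r \<Longrightarrow> prob {w. \<bar>w e\<bar> > r'} \<le> \<epsilon> / real (Suc N)"
    using law_tight[of "\<epsilon> / real (Suc N)"] assms by auto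
  have gt: "{w. \<bar>w e\<bar> > c} \<in> events" for c e by (rule events_Collect) measurable
  have "prob {w. \<not> (\<Sum>i=0..<N. \<bar>w (True, x + int i, y)\<bar>) \<le> r'} \<le> \<epsilon>" if r': "r' \<ge> real (Suc N) * r" for r' x y
  proof -
    define s where "s = r' / real (Suc N)"
    have s: "s \<ge> r" "real (Suc N) * s = r'" unfolding s_def using r' by (simp_all add: field_simps)
    have "{w. \<not> (\<Sum>i=0..<N. \<bar>w (True, x + int i, y)\<bar>) \<le> r'} \<subseteq> (\<Union>i\<in>{0..<N}. {w. \<bar>w (True, x + int i, y)\<bar> > s})"
    proof
      fix w assume w: "w \<in> {w. \<not> (\<Sum>i=0..<N. \<bar>w (True, x + int i, y)\<bar>) \<le> r'}"
      show "w \<in> (\<Union>i\<in>{0..<N}. {w. \<bar>w (True, x + int i, y)\<bar> > s})"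
      proof (rule ccontr)
        assume "\<not> ?thesis"
        then have "(\<Sum>i=0..<N. \<bar>w (True, x + int i, y)\<bar>) \<le> (\<Sum>i=0..<N. s)"
          by (intro sum_mono) (auto simp: not_less)
        also have "\<dots> \<le> r'" using s r by (simp add: algebra_simps)
        finally show False using w by simp
      qed
    qed
    then have "prob {w. \<not> (\<Sum>i=0..<N. \<bar>w (True, x + int i, y)\<bar>) \<le> r'} \<le>
        prob (\<Union>i\<in>{0..<N}. {w. \<bar>w (True, x + int i, y)\<bar> > s})"
      by (intro finite_measure_mono sets.finite_UN) (use gt in auto)
    also have "\<dots> \<le> (\<Sum>i\<in>{0..<N}. prob {w. \<bar>w (True, x + int i, y)\<bar> > s})"
      by (rule finite_measure_subadditive_finite) (use gt in auto)
    also have "\<dots> \<le> (\<Sum>i\<in>{0..<N}. \<epsilon> / real (Suc N))" by (intro sum_mono r(2) s)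
    also have "\<dots> \<le> \<epsilon>" using assms by (simp add: field_simps)
    finally show ?thesis .
  qed
  then show ?thesis using r(1) by (intro exI[of _ "real (Suc N) * r"]) simp
qed

end

context cell_geometry
begin

lemma window_finite: "finite (window i j)" "card (window i j) \<le> 2 * ((nat width + 1) * (3 * B + 1))"
proof -
  let ?W = "UNIV \<times> {width * i..width * (i + 1)} \<times> {height * (j - 1)..height * (j + 2)} :: (bool \<times> int \<times> int) set"
  have sub: "window i j \<subseteq> ?W"
  proof
    fix e assume "e \<in> window i j"
    moreover obtain b x y where e: "e = (b, x, y)" by (cases e)
    ultimately have x: "(if b then x else x - 1) div width = i" and y: "\<bar>y div height - j\<bar> \<le> 1"
      unfolding window_def block_def by auto
    let ?x = "if b then x else x - 1"
    have "width * i \<le> ?x" "?x < width * (i + 1)"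
      using x width_pos by (metis minus_mod_eq_mult_div le_add_same_cancel1 mult_div_mod_eq pos_mod_sign,
        metis add.commute add_strict_left_mono distrib_left mult.right_neutral mult_div_mod_eq pos_mod_bound)
    then have 1: "width * i \<le> x" "x \<le> width * (i + 1)" by (auto split: if_splits)
    have y0: "height * (y div height) \<le> y" "y < height * (y div height) + height"
      using height_pos by (metis le_add_same_cancel1 mult_div_mod_eq pos_mod_sign,
        metis add_strict_left_mono mult_div_mod_eq pos_mod_bound)
    have "height * (j - 1) \<le> height * (y div height)" "height * (y div height) \<le> height * (j + 1)"
      using y height_pos by (intro mult_left_mono; simp)+
    then have "height * (j - 1) \<le> y" "y \<le> height * (j + 2)" using y0 by (simp_all add: algebra_simps)
    then show "e \<in> ?W" using 1 e by auto
  qed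
  then show "finite (window i j)" by (rule finite_subset) auto
  have "card (window i j) \<le> card ?W" by (rule card_mono[OF _ sub]) auto
  also have "card ?W = 2 * ((nat width + 1) * (3 * B + 1))"
  proof -
    have "nat (width * (i + 1) - width * i + 1) = nat width + 1" using width_pos by (simp add: algebra_simps)
    moreover have "nat (height * (j + 2) - height * (j - 1) + 1) = 3 * B + 1" by (simp add: algebra_simps)
    ultimately show ?thesis by (simp only: card_cartesian_product card_atLeastAtMost_int card_UNIV_bool)
  qed
  finally show "card (window i j) \<le> 2 * ((nat width + 1) * (3 * B + 1))" .
qed

end

context edge_field
begin

text \<open>The order of the choices matters: the number \<open>n\<close> of attempts first, then
the bound \<open>R\<close> for rows of this length, then \<open>C\<close>, then a height
\<open>B\<close> at which humps reach \<open>C\<close>, then the median of column sums of this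
height, and finally \<open>K\<close>, which bounds the edges of a region whose size has been fixed
by then.\<close>

lemma good_cell_likely:
  assumes "q > 0"
  shows "\<exists>n B R C K m. cell_geometry B R C K \<and>
    (\<forall>i j. {w. cell_geometry.good_cell n B R C K m w i j} \<in> events \<and>
       prob {w. \<not> cell_geometry.good_cell n B R C K m w i j} \<le> q)"
proof -
  obtain n :: nat where n: "(3 / 4) ^ n < q / 12"
    using real_arch_pow_inv[of "q / 12" "3 / 4"] assms by auto
  obtain r1 where r1: "r1 \<ge> 0"
    "\<And>r' x y. r' \<ge> r1 \<Longrightarrow> prob {w. \<not> (\<Sum>i=0..<4 * n + 4. \<bar>w (True, x + int i, y)\<bar>) \<le> r'} \<le> q / 8"
    using row_cost_tight[of "q / 8" "4 * n + 4"] assms by auto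
  obtain r2 where r2: "r2 \<ge> 0" "\<And>r' e. r' \<ge> r2 \<Longrightarrow> prob {w. \<bar>w e\<bar> > r'} \<le> 1 / 2"
    using law_tight[of "1 / 2"] by auto
  define R where "R = max r1 r2"
  have R0: "R \<ge> 0" unfolding R_def using r1 by simp
  have Rpos: "measure (law True) {x. \<bar>x\<bar> \<le> R} > 0"
  proof -
    have "{x :: real. \<bar>x\<bar> \<le> R} \<in> sets borel" by measurable
    from prob_coord[OF this, of "(True, 0, 0)"]
    have 1: "prob {w. \<bar>w (True, 0, 0)\<bar> \<le> R} = measure (law True) {x. \<bar>x\<bar> \<le> R}" by simp
    have m: "{w. \<bar>w (True, 0, 0)\<bar> > R} \<in> events" by (rule events_Collect) measurable
    have "space field - {w. \<bar>w (True, 0, 0)\<bar> > R} = {w. \<bar>w (True, 0, 0)\<bar> \<le> R}" by auto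
    then have "prob {w. \<bar>w (True, 0, 0)\<bar> \<le> R} = 1 - prob {w. \<bar>w (True, 0, 0)\<bar> > R}"
      using prob_compl[OF m] by simp
    then show ?thesis using 1 r2(2)[of R "(True, 0, 0)"] unfolding R_def by simp
  qed
  define C where "C = 3 * R + 2"
  obtain B0 where B0: "\<And>B x y. B \<ge> B0 \<Longrightarrow>
    prob {w. \<exists>t\<in>{1..<B}. height_gap w x y t \<ge> C \<and> \<bar>w (True, x, y + int t)\<bar> \<le> R} \<ge> 1 / 4 \<and>
    prob {w. \<exists>t\<in>{1..<B}. height_gap w x y t \<le> - C \<and> \<bar>w (True, x, y + int t)\<bar> \<le> R} \<ge> 1 / 4"
    using hump_prob[OF Rpos, of C] by blast
  define B where "B = 2 * (B0 + 1)"
  have Bprops: "B \<ge> B0" "even B" "B \<ge> 2" unfolding B_def by auto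
  obtain m where m: "\<And>x y. prob {w. column B w x y \<ge> m} \<ge> 1 / 2"
    "\<And>x y. prob {w. column B w x y \<le> m + 1} \<ge> 1 / 2" using column_median[of B] by blast
  define c where "c = 2 * ((nat (4 * int n + 4) + 1) * (3 * B + 1))"
  obtain K where Kprops: "K \<ge> 0" "\<And>e. prob {w. \<bar>w e\<bar> > K} \<le> q / 8 / real (Suc c)"
    using law_tight[of "q / 8 / real (Suc c)"] assms by (metis divide_pos_pos of_nat_0_less_iff order_refl zero_less_Suc zero_less_numeral)
  interpret cell_geometry n B R C K m
    by unfold_locales (use Bprops R0 Kprops in \<open>auto simp: C_def\<close>)
  have gt: "{w. \<bar>w e\<bar> > r} \<in> events" for r e by (rule events_Collect) measurable
  have row_meas: "{w. row_cost w x y \<le> R} \<in> events" for x y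
    by (rule events_Collect) (unfold row_cost_def, measurable)
  have hi_meas: "{w. high_hump w x y} \<in> events" for x y
    by (rule events_Collect) (unfold high_hump_def, measurable)
  have lo_meas: "{w. low_hump w x y} \<in> events" for x y
    by (rule events_Collect) (unfold low_hump_def, measurable)
  have col: "column_sum w x y = column B w x y" for w x y unfolding column_sum_def column_def ..
  have geq: "{w. column_sum w x y \<ge> m} \<in> events" for x y
    unfolding col by (rule events_Collect) measurable
  have leq: "{w. column_sum w x y \<le> m + 1} \<in> events" for x y
    unfolding col by (rule events_Collect) measurable
  have ex_meas: "{w. \<exists>k<n. Q k w} \<in> events" if "\<And>k. {w. Q k w} \<in> events" for Q :: "nat \<Rightarrow> env \<Rightarrow> bool"
  proof -
    have "{w. \<exists>k<n. Q k w} = (\<Union>k\<in>{..<n}. {w. Q k w})" by auto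
    then show ?thesis using that by auto
  qed
  have bal_meas: "{w. balanced_columns w x y} \<in> events" for x y
    unfolding balanced_columns_def Collect_conj_eq by (intro sets.Int ex_meas geq leq)
  have bnd_meas: "{w. \<forall>e\<in>window i j - gadget_edges. \<bar>w e\<bar> \<le> K} \<in> events" for i j
  proof -
    have "{w \<in> space field. \<forall>e\<in>window i j - gadget_edges. \<bar>w e\<bar> \<le> K} \<in> events"
      using window_finite(1)[of i j] by (intro sets.sets_Collect_finite_All) measurable
    then show ?thesis by simp
  qed
  define W where "W i j d = {w. row_cost w (width * i) (height * (j + d)) \<le> R}" for i j d
  define H1 where "H1 i j = {w. \<exists>k<n. high_hump w (width * i + 3 + 2 * int k) (height * j)}" for i j
  define H2 where "H2 i j = {w. \<exists>k<n. low_hump w (width * i + 3 + 2 * int k) (height * j)}" for i j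
  define U where "U i j d = {w. balanced_columns w (width * i + 2 * int n + 3) (height * (j + d))}" for i j d
  define T where "T i j = {w. \<forall>e\<in>window i j - gadget_edges. \<bar>w e\<bar> \<le> K}" for i j
  have meas: "W i j d \<in> events" "H1 i j \<in> events" "H2 i j \<in> events" "U i j d \<in> events" "T i j \<in> events" for i j d
    unfolding W_def H1_def H2_def U_def T_def
    by (rule row_meas, rule ex_meas, rule hi_meas, rule ex_meas, rule lo_meas, rule bal_meas, rule bnd_meas)
  have good_eq: "{w. good_cell w i j} = W i j (-1) \<inter> W i j 0 \<inter> W i j 1 \<inter> H1 i j \<inter> H2 i j \<inter> U i j (-1) \<inter> U i j 0 \<inter> T i j" for i j
    unfolding good_cell_def W_def H1_def H2_def U_def T_def by (simp add: set_eq_iff)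
  have good_meas: "{w. good_cell w i j} \<in> events" for i j
    unfolding good_eq by (intro sets.Int meas)
  have W: "prob (- W i j d) \<le> q / 8" for i j d
    unfolding W_def row_cost_def Collect_neg_eq[symmetric]
    by (rule r1(2)) (simp add: R_def)
  have H1: "prob (- H1 i j) \<le> (3 / 4) ^ n" for i j
  proof -
    have "prob {w. \<not> (\<exists>k<n. high_hump w (width * i + 3 + 2 * int k) (height * j))} \<le> (1 - 1 / 4) ^ n"
    proof (rule prob_none)
      let ?E = "\<lambda>k. UNIV \<times> {width * i + 3 + 2 * int k, width * i + 3 + 2 * int k + 1} \<times> UNIV"
      show "depends_on (\<lambda>w. high_hump w (width * i + 3 + 2 * int k) (height * j)) (?E k)" for k
        unfolding depends_on_def high_hump_def height_gap_def by auto
      show "?E k \<inter> ?E k' = {}" if "k \<noteq> k'" for k k' using that by auto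
      show "1 / 4 \<le> prob {w. high_hump w (width * i + 3 + 2 * int k) (height * j)}" for k
        unfolding high_hump_def using B0[OF Bprops(1)] by blast
    qed (rule hi_meas)
    then show ?thesis unfolding H1_def Collect_neg_eq[symmetric] by simp
  qed
  have H2: "prob (- H2 i j) \<le> (3 / 4) ^ n" for i j
  proof -
    have "prob {w. \<not> (\<exists>k<n. low_hump w (width * i + 3 + 2 * int k) (height * j))} \<le> (1 - 1 / 4) ^ n"
    proof (rule prob_none)
      let ?E = "\<lambda>k. UNIV \<times> {width * i + 3 + 2 * int k, width * i + 3 + 2 * int k + 1} \<times> UNIV"
      show "depends_on (\<lambda>w. low_hump w (width * i + 3 + 2 * int k) (height * j)) (?E k)" for k
        unfolding depends_on_def low_hump_def height_gap_def by auto
      show "?E k \<inter> ?E k' = {}" if "k \<noteq> k'" for k k' using that by auto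
      show "1 / 4 \<le> prob {w. low_hump w (width * i + 3 + 2 * int k) (height * j)}" for k
        unfolding low_hump_def using B0[OF Bprops(1)] by blast
    qed (rule lo_meas)
    then show ?thesis unfolding H2_def Collect_neg_eq[symmetric] by simp
  qed
  have halves: "(1 / 2) ^ n \<le> (3 / 4 :: real) ^ n" by (rule power_mono) auto
  have U: "prob (- U i j d) \<le> 2 * (3 / 4) ^ n" for i j d
  proof -
    let ?x = "width * i + 2 * int n + 3" and ?y = "height * (j + d)"
    let ?E = "\<lambda>k. UNIV \<times> {?x + int k} \<times> UNIV"
    have 1: "prob {w. \<not> (\<exists>k<n. column_sum w (?x + int k) ?y \<ge> m)} \<le> (1 - 1 / 2) ^ n"
    proof (rule prob_none)
      show "depends_on (\<lambda>w. column_sum w (?x + int k) ?y \<ge> m) (?E k)" for k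
        unfolding depends_on_def column_sum_def by auto
      show "?E k \<inter> ?E k' = {}" if "k \<noteq> k'" for k k' using that by auto
      show "1 / 2 \<le> prob {w. column_sum w (?x + int k) ?y \<ge> m}" for k unfolding col by (rule m)
    qed (rule geq)
    have 2: "prob {w. \<not> (\<exists>k<n. column_sum w (?x + int k) ?y \<le> m + 1)} \<le> (1 - 1 / 2) ^ n"
    proof (rule prob_none)
      show "depends_on (\<lambda>w. column_sum w (?x + int k) ?y \<le> m + 1) (?E k)" for k
        unfolding depends_on_def column_sum_def by auto
      show "?E k \<inter> ?E k' = {}" if "k \<noteq> k'" for k k' using that by auto
      show "1 / 2 \<le> prob {w. column_sum w (?x + int k) ?y \<le> m + 1}" for k unfolding col by (rule m)
    qed (rule leq)
    let ?A = "{w. \<not> (\<exists>k<n. column_sum w (?x + int k) ?y \<ge> m)}"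
    let ?B = "{w. \<not> (\<exists>k<n. column_sum w (?x + int k) ?y \<le> m + 1)}"
    have mm: "?A \<in> events" "?B \<in> events"
      by (rule events_Collect_not, rule ex_meas, rule geq) (rule events_Collect_not, rule ex_meas, rule leq)
    have "- U i j d = ?A \<union> ?B" unfolding U_def balanced_columns_def by auto
    then have "prob (- U i j d) \<le> prob ?A + prob ?B" using measure_Un_le[OF mm] by simp
    then show ?thesis using 1 2 halves by simp
  qed
  have T: "prob (- T i j) \<le> q / 8" for i j
  proof -
    have "- T i j \<subseteq> (\<Union>e\<in>window i j. {w. \<bar>w e\<bar> > K})" unfolding T_def by (auto simp: not_le)
    then have "prob (- T i j) \<le> prob (\<Union>e\<in>window i j. {w. \<bar>w e\<bar> > K})"
      by (intro finite_measure_mono sets.finite_UN window_finite gt)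
    also have "\<dots> \<le> (\<Sum>e\<in>window i j. prob {w. \<bar>w e\<bar> > K})"
      by (rule finite_measure_subadditive_finite[OF window_finite(1)]) (use gt in auto)
    also have "\<dots> \<le> (\<Sum>e\<in>window i j. q / 8 / real (Suc c))" by (intro sum_mono Kprops)
    also have "\<dots> = real (card (window i j)) * (q / 8 / real (Suc c))" by simp
    also have "\<dots> \<le> real (Suc c) * (q / 8 / real (Suc c))"
    proof (rule mult_right_mono)
      have "card (window i j) \<le> c" using window_finite(2)[of i j] unfolding c_def width_def .
      then show "real (card (window i j)) \<le> real (Suc c)" by simp
    qed (use assms in simp)
    also have "\<dots> = q / 8"
      by (subst times_divide_eq_right, rule nonzero_mult_div_cancel_left) simp
    finally show ?thesis .
  qed
  have bad: "prob {w. \<not> good_cell w i j} \<le> q" for i j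
  proof -
    have cm: "- A \<in> events" if "A \<in> events" for A
      using sets.compl_sets[OF that] by (simp add: Compl_eq_Diff_UNIV)
    have un: "prob (A \<union> B) \<le> a + b" if "A \<in> events" "B \<in> events" "prob A \<le> a" "prob B \<le> b" for A B a b
      using measure_Un_le[OF that(1,2)] that(3,4) by linarith
    let ?p = "(3 / 4 :: real) ^ n"
    have "{w. \<not> good_cell w i j} = - W i j (-1) \<union> (- W i j 0 \<union> (- W i j 1 \<union> (- H1 i j \<union> (- H2 i j \<union> (- U i j (-1) \<union> (- U i j 0 \<union> - T i j))))))"
      unfolding Collect_neg_eq good_eq by auto
    moreover have "prob (- W i j (-1) \<union> (- W i j 0 \<union> (- W i j 1 \<union> (- H1 i j \<union> (- H2 i j \<union> (- U i j (-1) \<union> (- U i j 0 \<union> - T i j)))))))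
        \<le> q / 8 + (q / 8 + (q / 8 + (?p + (?p + (2 * ?p + (2 * ?p + q / 8))))))"
      by (intro un sets.Un cm meas W H1 H2 U T)
    ultimately show ?thesis using n by simp
  qed
  show ?thesis
    using cell_geometry_axioms good_meas bad by blast
qed

end

section \<open>Good blocks percolate\<close>

context cell_geometry
begin

lemma good_cell_depends: "depends_on (\<lambda>w. good_cell w i j) (window i j - gadget_edges)"
  unfolding depends_on_def using good_cell_cong by blast

lemma window_disjoint:
  assumes "z \<noteq> z'" "snd z mod 3 = snd z' mod 3"
  shows "window (fst z) (snd z) \<inter> window (fst z') (snd z') = {}"
proof (rule ccontr)
  assume "\<not> ?thesis"
  then obtain e where "fst z = fst z'" "\<bar>snd (block e) - snd z\<bar> \<le> 1" "\<bar>snd (block e) - snd z'\<bar> \<le> 1"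
    unfolding window_def by auto
  then have "\<bar>snd z - snd z'\<bar> \<le> 2" "snd z \<noteq> snd z'" using assms(1) by (auto simp: prod_eq_iff)
  then show False using assms(2) by presburger
qed

end

context block_geometry
begin

definition block_edges :: "int \<Rightarrow> int \<Rightarrow> (bool \<times> int \<times> int) set" where
  "block_edges I J = {e. fst (block e) div int len = I \<and>
     snd (block e) \<in> {int tall * (J - 1) - 1..int tall * (J + 2) + 1}} - gadget_edges"

lemma good_block_cong_imp:
  assumes good: "good_block w I J" and eq: "\<And>e. e \<in> block_edges I J \<Longrightarrow> w e = w' e"
  shows "good_block w' I J"
proof -
  have cell: "good_cell w' (int len * I + int x) h"
    if "x < len" "h \<in> {int tall * (J - 1)..int tall * (J + 2)}" "good_cell w (int len * I + int x) h" for x h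
  proof -
    have "(int len * I + int x) div int len = I" using that(1) by simp
    then have "window (int len * I + int x) h - gadget_edges \<subseteq> block_edges I J"
      using that(2) unfolding window_def block_edges_def by auto
    then show ?thesis using good_cell_cong[of "int len * I + int x" h w w'] eq that(3) by blast
  qed
  show ?thesis
    unfolding good_block_def
  proof
    fix D :: int assume "D \<in> {-1, 0, 1}"
    then obtain hs :: "int list" where hs: "hs ! 0 = int tall * J" "hs ! len = int tall * (J + D)"
      "\<And>x. x < len \<Longrightarrow> \<bar>hs ! Suc x - hs ! x\<bar> \<le> 1 \<and> hs ! x \<in> {int tall * (J - 1)..int tall * (J + 2)} \<and>
        good_cell w (int len * I + int x) (hs ! x)"
      using good unfolding good_block_def by meson
    then show "\<exists>hs :: int list. hs ! 0 = int tall * J \<and> hs ! len = int tall * (J + D) \<and>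
     (\<forall>x<len. \<bar>hs ! Suc x - hs ! x\<bar> \<le> 1 \<and> hs ! x \<in> {int tall * (J - 1)..int tall * (J + 2)} \<and>
        good_cell w' (int len * I + int x) (hs ! x))"
      using cell by (intro exI[of _ hs]) blast
  qed
qed

lemma good_block_depends: "depends_on (\<lambda>w. good_block w I J) (block_edges I J)"
  unfolding depends_on_def using good_block_cong_imp by metis

lemma block_edges_disjoint:
  assumes "z \<noteq> z'" "snd z mod 4 = snd z' mod 4" and tall: "tall \<ge> 3"
  shows "block_edges (fst z) (snd z) \<inter> block_edges (fst z') (snd z') = {}"
proof (rule ccontr)
  assume "\<not> ?thesis"
  then obtain e where e: "e \<in> block_edges (fst z) (snd z)" "e \<in> block_edges (fst z') (snd z')" by blast
  then have "fst z = fst z'" unfolding block_edges_def by auto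
  then have ne: "snd z \<noteq> snd z'" using assms(1) by (auto simp: prod_eq_iff)
  have far: False if "J' \<ge> J + 4" "e \<in> block_edges I J" "e \<in> block_edges I' J'" for I I' J J'
  proof -
    have "int tall * (J' - 1) - 1 \<le> int tall * (J + 2) + 1"
      using that(2,3) unfolding block_edges_def by auto
    moreover have "int tall * (J + 3) \<le> int tall * (J' - 1)" using that(1) by (intro mult_left_mono) auto
    moreover have "int tall * (J + 3) = int tall * (J + 2) + int tall" by (simp add: algebra_simps)
    ultimately show False using tall by linarith
  qed
  have "snd z' \<ge> snd z + 4 \<or> snd z \<ge> snd z' + 4" using assms(2) ne by presburger
  then show False using far e by blast
qed

text \<open>The base \<open>b D\<close> is one below the level of the block at its left end and one
below the target level at its right end. If the surface over \<open>b D\<close> is as low as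
possible at both ends, it joins the two prescribed cells.\<close>

lemma good_block_surface:
  assumes "2 * tall \<le> len" "tall \<ge> 1"
    and flat: "\<And>D x. D \<in> {-1, 0, 1} \<Longrightarrow> x \<in> {0..int len} \<Longrightarrow>
      \<forall>s\<ge>(if x = 0 \<or> x = int len then 1 else tall). \<not> blocked (\<lambda>z. \<not> good_cell w (fst z) (snd z)) (b D) (int len * I + x, b D (int len * I + x) + int s)"
    and b: "\<And>D x. b D x = int tall * J - 1 + D * min (int tall) (max 0 ((x - int len * I) div 2))"
  shows "good_block w I J"
  unfolding good_block_def
proof
  fix D :: int assume D: "D \<in> {-1, 0, 1}"
  let ?cl = "\<lambda>z. \<not> good_cell w (fst z) (snd z)"
  define \<phi> where "\<phi> x = surface ?cl (b D) (int len * I + int x)" for x :: nat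
  have fin: "finite_height ?cl (b D) (int len * I + int x)" if "x \<le> len" for x
    unfolding finite_height_def using flat[OF D, of "int x"] that by auto
  have gt: "\<phi> x > b D (int len * I + int x)" if "x \<le> len" for x
    unfolding \<phi>_def by (rule surface_props(1)[OF fin[OF that]])
  have le: "\<phi> x \<le> b D (int len * I + int x) + int (if x = 0 \<or> x = len then 1 else tall)" if "x \<le> len" for x
    unfolding \<phi>_def
    by (rule surface_le) (use flat[OF D, of "int x"] that assms(2) in auto)
  have ends: "b D (int len * I + int 0) = int tall * J - 1" "b D (int len * I + int len) = int tall * (J + D) - 1"
  proof -
    have "int tall \<le> int len div 2" using assms(1) by simp
    then show "b D (int len * I + int 0) = int tall * J - 1" "b D (int len * I + int len) = int tall * (J + D) - 1"
      unfolding b by (simp_all add: algebra_simps)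
  qed
  have range: "\<phi> x \<in> {int tall * (J - 1)..int tall * (J + 2)}" if "x < len" for x
  proof -
    define c where "c = min (int tall) (max 0 ((int len * I + int x - int len * I) div 2))"
    have c: "0 \<le> c" "c \<le> int tall" unfolding c_def by auto
    have "b D (int len * I + int x) = int tall * J - 1 + D * c" unfolding b c_def ..
    moreover have "D * c \<le> int tall" "D * c \<ge> - int tall" using D c by auto
    moreover have "int (if x = 0 \<or> x = len then 1 else tall) \<le> int tall" using assms(2) by simp
    ultimately have "\<phi> x \<ge> int tall * J - int tall" "\<phi> x \<le> int tall * J + 2 * int tall"
      using gt[of x] le[of x] that by linarith+
    then show ?thesis by (simp add: algebra_simps)
  qed
  have step: "\<bar>\<phi> (Suc x) - \<phi> x\<bar> \<le> 1" if "x < len" for x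
  proof -
    have "finite_height ?cl (b D) (int len * I + int x + 1)" using fin[of "Suc x"] that by (simp add: algebra_simps)
    then have "\<bar>surface ?cl (b D) (int len * I + int x + 1) - surface ?cl (b D) (int len * I + int x)\<bar> \<le> 1"
      by (intro surface_step fin) (use that in auto)
    then show ?thesis unfolding \<phi>_def by (simp add: algebra_simps)
  qed
  have good: "good_cell w (int len * I + int x) (\<phi> x)" if "x < len" for x
    using surface_open[OF fin[of x]] that unfolding \<phi>_def by simp
  define hs where "hs = map \<phi> [0..<Suc len]"
  have hs: "hs ! x = \<phi> x" if "x \<le> len" for x
    using that unfolding hs_def by (simp del: upt_Suc)
  show "\<exists>hs :: int list. hs ! 0 = int tall * J \<and> hs ! len = int tall * (J + D) \<and>
     (\<forall>x<len. \<bar>hs ! Suc x - hs ! x\<bar> \<le> 1 \<and> hs ! x \<in> {int tall * (J - 1)..int tall * (J + 2)} \<and>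
        good_cell w (int len * I + int x) (hs ! x))"
  proof (intro exI[of _ hs] conjI allI impI)
    show "hs ! 0 = int tall * J" using hs[of 0] gt[of 0] le[of 0] ends(1) by simp
    show "hs ! len = int tall * (J + D)" using hs[of len] gt[of len] le[of len] ends(2) by simp
  qed (use hs step range good in auto)
qed

end

locale block_field = edge_field law + block_geometry n B R C K m len tall
  for law :: "bool \<Rightarrow> real measure" and n B R C K m len tall +
  assumes tall: "tall \<ge> 3"
    and block_closed: "closed_sites field (\<lambda>w z. \<not> good_block w (fst z) (snd z)) (1 / 6)"

text \<open>A ramp that rises by one on every second site is flat enough to be the base of a
surface.\<close>

lemma ramp_slope:
  fixes D :: int
  assumes "D \<in> {-1, 0, 1}"
  shows "2 * \<bar>(c + D * min t (max 0 ((x - o') div 2))) - (c + D * min t (max 0 ((y - o') div 2)))\<bar> \<le> \<bar>x - y\<bar> + 1"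
proof -
  define u v where "u = (x - o') div 2" and "v = (y - o') div 2"
  have uv: "2 * \<bar>u - v\<bar> \<le> \<bar>x - y\<bar> + 1" unfolding u_def v_def by presburger
  have "\<bar>min t (max 0 u) - min t (max 0 v)\<bar> \<le> \<bar>u - v\<bar>" by linarith
  moreover have "\<bar>(c + D * min t (max 0 u)) - (c + D * min t (max 0 v))\<bar> \<le> \<bar>min t (max 0 u) - min t (max 0 v)\<bar>"
    using assms by (auto simp: abs_minus_commute)
  ultimately show ?thesis using uv unfolding u_def v_def by linarith
qed

context edge_field
begin

text \<open>A block is bad only if one of its three surfaces is higher than necessary at an end,
which has probability of order \<open>\<kappa>\<close>, or higher than \<open>tall\<close>
somewhere, which has probability of order \<open>len * \<kappa> ^ tall\<close>. Since
\<open>len\<close> grows only linearly with \<open>tall\<close>, both are small. The outer exponents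
3 and 4 are the numbers of residue classes of cells and blocks.\<close>

lemma block_field_exists:
  "\<exists>n B R C K m len tall. block_field law n B R C K m len tall"
proof -
  define q2 :: real where "q2 = ((1 / 6) ^ 3) ^ 4"
  have q2: "q2 > 0" "q2 \<le> 1" unfolding q2_def by (auto simp: power_le_one)
  \<comment> \<open>Three surfaces with two ends each, at \<open>4 * \<kappa>\<close> per end, use up half of \<open>q2\<close>.\<close>
  define \<kappa> where "\<kappa> = min (1 / 6) (q2 / 48)"
  have \<kappa>: "\<kappa> > 0" "\<kappa> \<le> 1 / 6" "\<kappa> \<le> q2 / 48" unfolding \<kappa>_def using q2 by auto
  have "(\<kappa> ^ 3) ^ 3 > 0" using \<kappa> by simp
  from good_cell_likely[OF this] obtain n B R C K m where geo: "cell_geometry B R C K"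
    and good_meas: "\<And>i j. {w. cell_geometry.good_cell n B R C K m w i j} \<in> events"
    and bad: "\<And>i j. prob {w. \<not> cell_geometry.good_cell n B R C K m w i j} \<le> (\<kappa> ^ 3) ^ 3"
    by blast
  interpret cell_geometry n B R C K m by (rule geo)
  interpret cells: closed_sites field "\<lambda>w z. \<not> good_cell w (fst z) (snd z)" \<kappa>
  proof unfold_locales
    show "{w \<in> space field. \<not> good_cell w (fst z) (snd z)} \<in> events" for z
      using events_Collect_not[OF good_meas] by simp
    show "prob {w \<in> space field. \<forall>z\<in>Z. \<not> good_cell w (fst z) (snd z)} \<le> (\<kappa> ^ 3) ^ card Z"
      if "finite Z" for Z :: "(int \<times> int) set"
    proof -
      have "prob {w. \<forall>z\<in>Z. \<not> good_cell w (fst z) (snd z)} \<le> (\<kappa> ^ 3) ^ card Z"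
      proof (rule prob_all_closed[where r = 3 and E = "\<lambda>z. window (fst z) (snd z) - gadget_edges"])
        show "depends_on (\<lambda>w. \<not> good_cell w (fst z) (snd z)) (window (fst z) (snd z) - gadget_edges)" for z
          by (rule depends_on_not[OF good_cell_depends])
        show "{w. \<not> good_cell w (fst z) (snd z)} \<in> events" for z
          by (rule events_Collect_not[OF good_meas])
        show "(window (fst z) (snd z) - gadget_edges) \<inter> (window (fst z') (snd z') - gadget_edges) = {}"
          if "z \<noteq> z'" "snd z mod int 3 = snd z' mod int 3" for z z'
          using window_disjoint[OF that(1)] that(2) by auto
        show "prob {w. \<not> good_cell w (fst z) (snd z)} \<le> (\<kappa> ^ 3) ^ 3" for z by (rule bad)
      qed (use \<kappa> that in \<open>auto simp: power_le_one\<close>)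
      then show ?thesis by simp
    qed
  qed (use \<kappa> in auto)
  obtain M0 :: nat where M0: "real M0 > \<bar>m\<bar>" using reals_Archimedean2 by blast
  define M where "M = M0 + 2"
  have "(\<lambda>t. real M * (real t * \<kappa> ^ t) + \<kappa> ^ t) \<longlonglongrightarrow> real M * 0 + 0"
    using \<kappa> by (intro tendsto_add tendsto_mult tendsto_const LIMSEQ_realpow_zero powser_times_n_limit_0) auto
  then have "\<forall>\<^sub>F t in sequentially. real M * (real t * \<kappa> ^ t) + \<kappa> ^ t < q2 / 24"
    by (rule order_tendstoD) (use q2 in simp)
  then have "\<forall>\<^sub>F t in sequentially. real M * (real t * \<kappa> ^ t) + \<kappa> ^ t < q2 / 24 \<and> t \<ge> 3"
    using eventually_ge_at_top by (rule eventually_conj)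
  then obtain tall where tall: "real M * (real tall * \<kappa> ^ tall) + \<kappa> ^ tall < q2 / 24" "tall \<ge> 3"
    unfolding eventually_sequentially by blast
  define len where "len = M * tall + 1"
  have len_tall: "2 * tall \<le> len" unfolding len_def M_def by simp
  have len_m: "real len \<ge> \<bar>m\<bar> * real tall + 1"
  proof -
    have "\<bar>m\<bar> * real tall \<le> real M * real tall" using M0 unfolding M_def by (intro mult_right_mono) auto
    then show ?thesis unfolding len_def by simp
  qed
  have len_q: "real len * \<kappa> ^ tall < q2 / 24"
    using tall(1) unfolding len_def by (simp add: algebra_simps)
  interpret block_geometry n B R C K m len tall
    by unfold_locales (rule len_m)
  have block_meas: "{w. good_block w I J} \<in> events" for I J
  proof -
    have "{w \<in> space field. good_block w I J} \<in> events"
      unfolding good_block_def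
      by (intro sets.sets_Collect_finite_All sets.sets_Collect_countable_Ex sets.sets_Collect_conj
          sets.sets_Collect_countable_All sets.sets_Collect_imp sets.sets_Collect_const) (use good_meas in auto)
    then show ?thesis by simp
  qed
  have block_bad: "prob {w. \<not> good_block w I J} \<le> q2" for I J
  proof -
    define b where "b D x = int tall * J - 1 + D * min (int tall) (max 0 ((x - int len * I) div 2))" for D x
    define A where "A D s x = {w \<in> space field. \<exists>s'\<ge>s. blocked (\<lambda>z. \<not> good_cell w (fst z) (snd z)) (b D) (int len * I + x, b D (int len * I + x) + int s')}"
      for D s x
    have A_meas: "A D s x \<in> events" for D s x
      unfolding A_def
      by (intro sets.sets_Collect_countable_Ex sets.sets_Collect_conj sets.sets_Collect_const cells.blocked_meas)
    have A_prob: "prob (A D s x) \<le> 4 * \<kappa> ^ s" if "D \<in> {-1, 0, 1}" "s \<ge> 1" for D s x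
      unfolding A_def
    proof (rule cells.prob_high_blocked[OF _ that(2)])
      show "2 * \<bar>b D x - b D y\<bar> \<le> \<bar>x - y\<bar> + 1" for x y
        unfolding b_def by (rule ramp_slope[OF that(1)])
    qed
    define F where "F D = A D 1 0 \<union> A D 1 (int len) \<union> (\<Union>x\<in>{0..<int len}. A D tall x)" for D
    have F_meas: "F D \<in> events" for D unfolding F_def using A_meas by auto
    have F_prob: "prob (F D) \<le> q2 / 3" if D: "D \<in> {-1, 0, 1}" for D
    proof -
      have U: "(\<Union>x\<in>{0..<int len}. A D tall x) \<in> events" using A_meas by auto
      have "prob (\<Union>x\<in>{0..<int len}. A D tall x) \<le> (\<Sum>x\<in>{0..<int len}. prob (A D tall x))"
        by (rule finite_measure_subadditive_finite) (use A_meas in auto)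
      also have "\<dots> \<le> (\<Sum>x\<in>{0..<int len}. 4 * \<kappa> ^ tall)"
        by (intro sum_mono A_prob D) (use tall in auto)
      also have "\<dots> = 4 * (real len * \<kappa> ^ tall)" by simp
      finally have 1: "prob (\<Union>x\<in>{0..<int len}. A D tall x) \<le> q2 / 6" using len_q by simp
      have "prob (F D) \<le> prob (A D 1 0 \<union> A D 1 (int len)) + prob (\<Union>x\<in>{0..<int len}. A D tall x)"
        unfolding F_def by (rule measure_Un_le[OF sets.Un[OF A_meas A_meas] U])
      moreover have "prob (A D 1 0 \<union> A D 1 (int len)) \<le> prob (A D 1 0) + prob (A D 1 (int len))"
        by (rule measure_Un_le[OF A_meas A_meas])
      moreover have "prob (A D 1 0) \<le> 4 * \<kappa>" "prob (A D 1 (int len)) \<le> 4 * \<kappa>"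
        using A_prob[OF D, of 1] by simp_all
      ultimately show ?thesis using 1 \<kappa>(3) by linarith
    qed
    have "{w. \<not> good_block w I J} \<subseteq> F (-1) \<union> F 0 \<union> F 1"
    proof (rule subsetI, rule ccontr)
      fix w assume w: "w \<in> {w. \<not> good_block w I J}" "w \<notin> F (-1) \<union> F 0 \<union> F 1"
      have "good_block w I J"
      proof (rule good_block_surface[OF len_tall _ _ b_def])
        show "\<forall>s\<ge>(if x = 0 \<or> x = int len then 1 else tall). \<not> blocked (\<lambda>z. \<not> good_cell w (fst z) (snd z)) (b D) (int len * I + x, b D (int len * I + x) + int s)"
          if "D \<in> {-1, 0, 1}" "x \<in> {0..int len}" for D x
        proof -
          have "w \<notin> F D" using that(1) w(2) by auto
          then show ?thesis using that(2) unfolding F_def A_def by auto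
        qed
      qed (use tall in simp)
      then show False using w by simp
    qed
    then have "prob {w. \<not> good_block w I J} \<le> prob (F (-1) \<union> F 0 \<union> F 1)"
      by (intro finite_measure_mono sets.Un F_meas)
    also have "\<dots> \<le> prob (F (-1)) + prob (F 0) + prob (F 1)"
      using measure_Un_le[OF sets.Un[OF F_meas F_meas] F_meas, of "-1" 0 1] measure_Un_le[OF F_meas F_meas, of "-1" 0] by linarith
    also have "\<dots> \<le> q2" using F_prob[of "-1"] F_prob[of 0] F_prob[of 1] by simp
    finally show ?thesis .
  qed
  have "closed_sites field (\<lambda>w z. \<not> good_block w (fst z) (snd z)) (1 / 6)"
  proof unfold_locales
    show "{w \<in> space field. \<not> good_block w (fst z) (snd z)} \<in> events" for z
      using events_Collect_not[OF block_meas] by simp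
    show "prob {w \<in> space field. \<forall>z\<in>Z. \<not> good_block w (fst z) (snd z)} \<le> ((1 / 6) ^ 3) ^ card Z"
      if "finite Z" for Z :: "(int \<times> int) set"
    proof -
      have "prob {w. \<forall>z\<in>Z. \<not> good_block w (fst z) (snd z)} \<le> ((1 / 6) ^ 3) ^ card Z"
      proof (rule prob_all_closed[where r = 4 and E = "\<lambda>z. block_edges (fst z) (snd z)"])
        show "depends_on (\<lambda>w. \<not> good_block w (fst z) (snd z)) (block_edges (fst z) (snd z))" for z
          by (rule depends_on_not[OF good_block_depends])
        show "{w. \<not> good_block w (fst z) (snd z)} \<in> events" for z
          by (rule events_Collect_not[OF block_meas])
        show "block_edges (fst z) (snd z) \<inter> block_edges (fst z') (snd z') = {}"
          if "z \<noteq> z'" "snd z mod int 4 = snd z' mod int 4" for z z'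
          using block_edges_disjoint[OF that(1) _ tall(2)] that(2) by auto
        show "prob {w. \<not> good_block w (fst z) (snd z)} \<le> ((1 / 6) ^ 3) ^ 4" for z
          using block_bad unfolding q2_def .
      qed (use that in \<open>auto simp: power_le_one\<close>)
      then show ?thesis by simp
    qed
  qed auto
  then have "block_field law n B R C K m len tall"
    by (intro block_field.intro block_field_axioms.intro edge_field_axioms block_geometry_axioms tall(2))
  then show ?thesis by blast
qed

end

section \<open>Recurrence of gadgets\<close>

context edge_field
begin

definition mix :: "(bool \<times> int \<times> int) set \<Rightarrow> env \<times> env \<Rightarrow> env" where
  "mix G = (\<lambda>(u, g) e. if e \<in> G then g e else u e)"

lemma mix_measurable [measurable]: "mix G \<in> measurable (field \<Otimes>\<^sub>M field) field"
proof -
  have "mix G \<in> measurable (field \<Otimes>\<^sub>M field) (PiM UNIV (\<lambda>_. borel))"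
  proof (rule measurable_PiM_single')
    fix e
    have "(\<lambda>x. (snd x) e) \<in> borel_measurable (field \<Otimes>\<^sub>M field)"
      by (rule measurable_compose[OF measurable_snd coord_measurable])
    moreover have "(\<lambda>x. (fst x) e) \<in> borel_measurable (field \<Otimes>\<^sub>M field)"
      by (rule measurable_compose[OF measurable_fst coord_measurable])
    ultimately show "(\<lambda>x. mix G x e) \<in> borel_measurable (field \<Otimes>\<^sub>M field)"
      unfolding mix_def by (cases "e \<in> G") (simp_all add: split_beta)
  qed auto
  then show ?thesis using measurable_cong_sets[OF refl sets_field] by blast
qed

lemma emeasure_cylinder:
  assumes "finite J" "\<And>j. j \<in> J \<Longrightarrow> F j \<in> sets borel"
  shows "emeasure field {w. \<forall>j\<in>J. w j \<in> F j} = (\<Prod>j\<in>J. emeasure (law (fst j)) (F j))"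
    and "{w. \<forall>j\<in>J. w j \<in> F j} \<in> events"
proof -
  show "emeasure field {w. \<forall>j\<in>J. w j \<in> F j} = (\<Prod>j\<in>J. emeasure (law (fst j)) (F j))"
    using coord.emeasure_PiM_Collect[of J F] assms by (simp add: field_def[symmetric] law_sets)
  have "{w \<in> space field. w j \<in> F j} \<in> events" if "j \<in> J" for j
    using measurable_sets[OF coord_measurable assms(2)[OF that], of j] by (simp add: vimage_def)
  then have "{w \<in> space field. \<forall>j\<in>J. w j \<in> F j} \<in> events"
    using assms(1) by (intro sets.sets_Collect_finite_All) auto
  then show "{w. \<forall>j\<in>J. w j \<in> F j} \<in> events" by simp
qed

text \<open>Resampling the edges of \<open>G\<close> does not change the law. This separates the
edges that decide about percolation from those of the gadgets.\<close>

lemma distr_mix: "distr (field \<Otimes>\<^sub>M field) field (mix G) = field"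
  unfolding field_def[symmetric]
proof -
  have "distr (field \<Otimes>\<^sub>M field) field (mix G) = PiM UNIV (\<lambda>e. law (fst e))"
  proof (rule coord.PiM_eq)
    fix J :: "(bool \<times> int \<times> int) set" and F
    assume J: "finite J" "\<And>j. j \<in> J \<Longrightarrow> F j \<in> sets (law (fst j))"
    have F: "F j \<in> sets borel" if "j \<in> J" for j using J(2)[OF that] law_sets by blast
    have emb: "prod_emb UNIV (\<lambda>e. law (fst e)) J (\<Pi>\<^sub>E j\<in>J. F j) = {w. \<forall>j\<in>J. w j \<in> F j}"
      unfolding prod_emb_def by (auto simp: space_PiM space_law PiE_iff)
    have "emeasure (distr (field \<Otimes>\<^sub>M field) field (mix G)) {w. \<forall>j\<in>J. w j \<in> F j} =
        emeasure (field \<Otimes>\<^sub>M field) (mix G -` {w. \<forall>j\<in>J. w j \<in> F j} \<inter> space (field \<Otimes>\<^sub>M field))"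
      by (rule emeasure_distr[OF mix_measurable emeasure_cylinder(2)[OF J(1) F]])
    also have "mix G -` {w. \<forall>j\<in>J. w j \<in> F j} \<inter> space (field \<Otimes>\<^sub>M field) =
        {u. \<forall>j\<in>J - G. u j \<in> F j} \<times> {g. \<forall>j\<in>J \<inter> G. g j \<in> F j}"
      unfolding mix_def by (auto simp: space_pair_measure)
    also have "emeasure (field \<Otimes>\<^sub>M field) \<dots> =
        emeasure field {u. \<forall>j\<in>J - G. u j \<in> F j} * emeasure field {g. \<forall>j\<in>J \<inter> G. g j \<in> F j}"
      by (rule emeasure_pair_measure_Times; rule emeasure_cylinder(2)) (use J F in auto)
    also have "\<dots> = (\<Prod>j\<in>J - G. emeasure (law (fst j)) (F j)) * (\<Prod>j\<in>J \<inter> G. emeasure (law (fst j)) (F j))"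
      using J F by (subst (1 2) emeasure_cylinder(1)) auto
    also have "\<dots> = (\<Prod>j\<in>J. emeasure (law (fst j)) (F j))"
      using J(1) by (subst prod.union_disjoint[symmetric]) (auto intro!: prod.cong)
    finally show "emeasure (distr (field \<Otimes>\<^sub>M field) field (mix G)) (prod_emb UNIV (\<lambda>e. law (fst e)) J (\<Pi>\<^sub>E j\<in>J. F j)) =
        (\<Prod>j\<in>J. emeasure (law (fst j)) (F j))" unfolding emb .
  qed (simp add: field_def)
  then show ?thesis unfolding field_def .
qed

lemma AE_mix:
  assumes "{w. Q w} \<in> events" "AE u in field. AE g in field. Q (mix G (u, g))"
  shows "AE w in field. Q w"
proof -
  interpret P: pair_prob_space field field ..
  have meas: "{x \<in> space (field \<Otimes>\<^sub>M field). Q (mix G x)} \<in> sets (field \<Otimes>\<^sub>M field)"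
    using measurable_sets[OF mix_measurable assms(1), of G] by (simp add: vimage_def Collect_conj_eq Int_commute)
  have "AE x in field \<Otimes>\<^sub>M field. Q (mix G x)"
    by (rule P.AE_pair_measure[OF meas]) (use assms(2) in simp)
  then have "AE w in distr (field \<Otimes>\<^sub>M field) field (mix G). Q w"
    using assms(1) by (subst AE_distr_iff) simp_all
  then show ?thesis unfolding distr_mix .
qed

definition near :: "nat \<Rightarrow> real \<Rightarrow> real \<Rightarrow> real set" where
  "near k x \<epsilon> = {y. \<bar>y - x\<bar> < \<epsilon> \<and> \<bar>y\<bar> \<le> real k}"

text \<open>The support of the law restricted to \<open>[-k, k]\<close>. The truncation keeps the
steps in use bounded; horizontal and vertical edges have the same support because their null sets
agree.\<close>

definition support :: "nat \<Rightarrow> real set" where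
  "support k = {x. \<forall>\<epsilon>>0. measure (law False) (near k x \<epsilon>) > 0}"

lemma near_borel [measurable]: "near k x \<epsilon> \<in> sets borel"
  unfolding near_def by measurable

lemma near_law: "measure (law b) (near k x \<epsilon>) > 0 \<longleftrightarrow> measure (law False) (near k x \<epsilon>) > 0"
  using law_null[OF near_borel, of k x \<epsilon>] by (cases b) (auto simp: zero_less_measure_iff)

lemma support_minus: "x \<in> support k \<Longrightarrow> - x \<in> support k"
proof -
  assume x: "x \<in> support k"
  have "measure (law False) (near k (- x) \<epsilon>) > 0" if "\<epsilon> > 0" for \<epsilon>
  proof -
    have "uminus -` near k x \<epsilon> = near k (- x) \<epsilon>" unfolding near_def by (auto simp: abs_minus_commute)
    then show ?thesis
      using x that law_sym[OF near_borel, of False k x \<epsilon>] unfolding support_def by (auto simp: zero_less_measure_iff)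
  qed
  then show ?thesis unfolding support_def by blast
qed

lemma support_bound: "x \<in> support k \<Longrightarrow> \<bar>x\<bar> \<le> real k"
proof (rule ccontr)
  assume x: "x \<in> support k" "\<not> \<bar>x\<bar> \<le> real k"
  have "near k x (\<bar>x\<bar> - real k) = {}" unfolding near_def by auto
  moreover have "measure (law False) (near k x (\<bar>x\<bar> - real k)) > 0" using x unfolding support_def by auto
  ultimately show False by simp
qed

lemma AE_support: "AE w in field. \<forall>e k. \<bar>w e\<bar> \<le> real k \<longrightarrow> w e \<in> support k"
proof -
  have "AE w in field. \<bar>w e\<bar> \<le> real k \<longrightarrow> w e \<in> support k" for e k
  proof -
    let ?I = "{z :: rat \<times> rat. measure (law False) (near k (of_rat (fst z)) (of_rat (snd z))) = 0}"
    have "AE w in field. w e \<notin> near k (of_rat q) (of_rat r)" if "(q, r) \<in> ?I" for q r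
    proof -
      have "measure (law (fst e)) (near k (of_rat q) (of_rat r)) = 0"
        using near_law[of "fst e" k "of_rat q" "of_rat r"] that by (simp add: zero_less_measure_iff)
      then have 0: "prob {w. w e \<in> near k (of_rat q) (of_rat r)} = 0"
        using prob_coord[OF near_borel] by simp
      have ev: "{w. w e \<in> near k (of_rat q) (of_rat r)} \<in> events"
        using measurable_sets[OF coord_measurable near_borel, of e k "of_rat q" "of_rat r"] by (simp add: vimage_def)
      show ?thesis by (rule AE_I[of _ _ "{w. w e \<in> near k (of_rat q) (of_rat r)}"])
        (use 0 ev in \<open>auto simp: emeasure_eq_measure\<close>)
    qed
    then have "AE w in field. \<forall>z\<in>?I. w e \<notin> near k (of_rat (fst z)) (of_rat (snd z))"
      by (subst AE_ball_countable) (auto intro: countable_subset[OF subset_UNIV])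
    then show ?thesis
    proof (eventually_elim)
      fix w assume w0: "\<forall>z\<in>?I. w e \<notin> near k (of_rat (fst z)) (of_rat (snd z))"
      show "\<bar>w e\<bar> \<le> real k \<longrightarrow> w e \<in> support k"
      proof (intro impI, rule ccontr)
      assume w: "\<bar>w e\<bar> \<le> real k" "w e \<notin> support k"
      then obtain \<epsilon> where \<epsilon>: "\<epsilon> > 0" "measure (law False) (near k (w e) \<epsilon>) = 0"
        unfolding support_def by (auto simp: zero_less_measure_iff)
      obtain r :: rat where r: "0 < (of_rat r :: real)" "of_rat r < \<epsilon> / 2"
        using of_rat_dense[of 0 "\<epsilon> / 2"] \<epsilon> by auto
      obtain q :: rat where q: "w e - of_rat r < of_rat q" "of_rat q < w e"
        using of_rat_dense[of "w e - of_rat r" "w e"] r by auto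
      have "near k (of_rat q) (of_rat r) \<subseteq> near k (w e) \<epsilon>"
        using q r unfolding near_def by auto
      then have "measure (law False) (near k (of_rat q) (of_rat r)) \<le> measure (law False) (near k (w e) \<epsilon>)"
        by (intro finite_measure.finite_measure_mono[OF prob_space.finite_measure[OF law_prob]]) (simp_all add: law_sets)
      then have "(q, r) \<in> ?I" using \<epsilon>(2) by (simp add: measure_le_0_iff)
      moreover have "w e \<in> near k (of_rat q) (of_rat r)" using q w(1) unfolding near_def by auto
      ultimately show False using w0 by fastforce
      qed
    qed
  qed
  then show ?thesis by (simp add: AE_all_countable)
qed

end

context block_field
begin

abbreviation bad_block :: "env \<Rightarrow> int \<times> int \<Rightarrow> bool" where
  "bad_block w \<equiv> \<lambda>z. \<not> good_block w (fst z) (snd z)"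

sublocale blocks: closed_sites field bad_block "1 / 6"
  by (rule block_closed)

abbreviation ground :: "int \<Rightarrow> int" where "ground \<equiv> \<lambda>_. 0"

definition level :: "env \<Rightarrow> nat \<Rightarrow> int" where
  "level w i = surface (bad_block w) ground (int i)"

text \<open>Countably many events describe the level, which makes it measurable.\<close>

definition is_level :: "env \<Rightarrow> nat \<Rightarrow> int \<Rightarrow> bool" where
  "is_level w i J \<longleftrightarrow> J > 0 \<and> blocked (bad_block w) ground (int i, J - 1) \<and>
     (\<forall>J'\<ge>J. \<not> blocked (bad_block w) ground (int i, J'))"

definition percolates :: "env \<Rightarrow> bool" where
  "percolates w \<longleftrightarrow> (\<forall>i :: nat. finite_height (bad_block w) ground (int i))"

lemma is_level_iff: "percolates w \<Longrightarrow> is_level w i J \<longleftrightarrow> J = level w i"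
  using surface_eqI[of "bad_block w" ground "int i" J] unfolding percolates_def is_level_def level_def by auto

lemma AE_percolates: "AE w in field. percolates w"
  unfolding percolates_def by (subst AE_all_countable) (auto intro!: blocks.AE_finite_height)

lemma is_level_meas: "{w. is_level w i J} \<in> events"
proof -
  have "{w \<in> space field. is_level w i J} \<in> events"
    unfolding is_level_def
    by (intro sets.sets_Collect_conj sets.sets_Collect_const blocks.blocked_meas
        sets.sets_Collect_countable_All sets.sets_Collect_imp sets.sets_Collect_neg)
  then show ?thesis by simp
qed

lemma bad_block_mix: "bad_block (mix gadget_edges (u, g)) = bad_block u"
proof
  fix z
  have "good_block (mix gadget_edges (u, g)) (fst z) (snd z) = good_block u (fst z) (snd z)"
    by (rule depends_onD[OF good_block_depends]) (auto simp: mix_def block_edges_def)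
  then show "bad_block (mix gadget_edges (u, g)) z = bad_block u z" by simp
qed

text \<open>The gadget at the entrance of a block has its left edge near \<open>x\<close>, its right
edge near \<open>y\<close>, and its top edge near \<open>z\<close>. With \<open>z\<close> the value
of the bottom edge, top and bottom cancel and the gadget changes the sum by about \<open>x -
y\<close>.\<close>

definition gadget_like :: "env \<Rightarrow> nat \<Rightarrow> int \<Rightarrow> nat \<Rightarrow> real \<Rightarrow> real \<Rightarrow> real \<Rightarrow> real \<Rightarrow> bool" where
  "gadget_like w i J k x y z \<epsilon> \<longleftrightarrow> (case port (int i) J of (px, py) \<Rightarrow>
     w (False, px + 1, py) \<in> near k x \<epsilon> \<and> w (False, px + 2, py) \<in> near k y \<epsilon> \<and>
     w (True, px + 1, py + 1) \<in> near k z \<epsilon>)"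

definition bottom :: "env \<Rightarrow> nat \<Rightarrow> int \<Rightarrow> real" where
  "bottom w i J = (case port (int i) J of (px, py) \<Rightarrow> w (True, px + 1, py))"

definition admissible :: "nat \<Rightarrow> rat \<Rightarrow> rat \<Rightarrow> rat \<Rightarrow> bool" where
  "admissible k x y \<epsilon> \<longleftrightarrow> \<epsilon> > 0 \<and> real k \<ge> K \<and> measure (law False) (near k (of_rat x) (of_rat \<epsilon>)) > 0 \<and>
     measure (law False) (near k (of_rat y) (of_rat \<epsilon>)) > 0"

definition rich :: "env \<Rightarrow> bool" where
  "rich w \<longleftrightarrow> (\<forall>k x y \<epsilon>. admissible k x y \<epsilon> \<longrightarrow> (\<forall>N. \<exists>i\<ge>N. \<exists>J. is_level w i J \<and>
     gadget_like w i J k (of_rat x) (of_rat y) (bottom w i J) (of_rat \<epsilon>)))"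

lemma gadget_like_meas: "{w. gadget_like w i J k x y (bottom w i J) \<epsilon>} \<in> events"
proof -
  obtain px py where p: "port (int i) J = (px, py)" by (cases "port (int i) J")
  have "{w \<in> space field. gadget_like w i J k x y (bottom w i J) \<epsilon>} \<in> events"
    unfolding gadget_like_def bottom_def p near_def prod.case mem_Collect_eq by measurable
  then show ?thesis by simp
qed

lemma rich_meas: "{w. rich w} \<in> events"
proof -
  have "{w \<in> space field. rich w} \<in> events"
    unfolding rich_def
    by (intro sets.sets_Collect_conj sets.sets_Collect_const sets.sets_Collect_countable_Ex
        sets.sets_Collect_countable_All sets.sets_Collect_imp)
       (use is_level_meas gadget_like_meas in simp_all)
  then show ?thesis by simp
qed

lemma port_fst_gap: "i < i' \<Longrightarrow> fst (port (int i) J) + 4 \<le> fst (port (int i') J')"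
proof -
  assume "i < i'"
  have w4: "width \<ge> 4" unfolding width_def by simp
  have "width * (int len * int i') - width * (int len * int i) = width * (int len * (int i' - int i))"
    by (simp add: algebra_simps)
  moreover have "int len * (int i' - int i) \<ge> 1 * 1"
    using len_pos \<open>i < i'\<close> by (intro mult_mono) auto
  then have "width * (int len * (int i' - int i)) \<ge> width * 1" using width_pos by (intro mult_left_mono) auto
  then have "width * (int len * (int i' - int i)) \<ge> 4" using w4 by linarith
  ultimately show ?thesis unfolding port_def fst_conv by linarith
qed

lemma gadget_edges_port:
  assumes "port (int i) J = (px, py)"
  shows "(False, px + 1, py) \<in> gadget_edges" "(False, px + 2, py) \<in> gadget_edges"
    "(True, px + 1, py + 1) \<in> gadget_edges" "(True, px + 1, py) \<notin> gadget_edges"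
proof -
  have w4: "width \<ge> 4" unfolding width_def by simp
  have p: "px = width * (int len * int i)" "py = height * (int tall * J)"
    using assms unfolding port_def by auto
  have "(px + 1) mod width = 1" "(px + 2) mod width = 2" using w4 unfolding p by (simp_all add: mod_pos_pos_trivial)
  moreover have "py mod height = 0" "(py + 1) mod height = 1"
    using B unfolding p by (simp_all add: mod_pos_pos_trivial)
  ultimately show "(False, px + 1, py) \<in> gadget_edges" "(False, px + 2, py) \<in> gadget_edges"
    "(True, px + 1, py + 1) \<in> gadget_edges" "(True, px + 1, py) \<notin> gadget_edges"
    unfolding gadget_edges_def by auto
qed

text \<open>The bottom edges are bounded, so infinitely many of them are close to one value
\<open>z\<close>. At these places a top edge near \<open>z\<close> has a fixed positive probability,
and the gadgets of different blocks are independent.\<close>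

lemma gadget_recurs:
  assumes b: "\<And>i. b i \<in> support k" and adm: "admissible k x y \<epsilon>"
  shows "AE g in field. \<exists>i\<ge>N. gadget_like g i (h i) k (of_rat x) (of_rat y) (b i) (of_rat \<epsilon>)"
proof -
  define \<epsilon>' :: real where "\<epsilon>' = of_rat \<epsilon>"
  have \<epsilon>: "\<epsilon>' > 0" using adm unfolding admissible_def \<epsilon>'_def by simp
  have "bounded (range b)" using support_bound[OF b] by (auto simp: bounded_iff)
  then obtain l r where r: "strict_mono r" "(b \<circ> r) \<longlonglongrightarrow> l"
    using bounded_imp_convergent_subsequence by blast
  obtain n0 where n0: "\<And>n. n \<ge> n0 \<Longrightarrow> \<bar>b (r n) - l\<bar> < \<epsilon>' / 4"
    using LIMSEQ_D[OF r(2), of "\<epsilon>' / 4"] \<epsilon> by auto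
  define z where "z = b (r n0)"
  have close: "\<bar>b (r n) - z\<bar> < \<epsilon>' / 2" if "n \<ge> n0" for n
    using n0[OF that] n0[OF order_refl] unfolding z_def by linarith
  have z: "measure (law True) (near k z (\<epsilon>' / 2)) > 0"
    unfolding near_law[of True] using b[of "r n0"] \<epsilon> unfolding z_def support_def by simp
  define i where "i n = r (n + n0 + N)" for n
  have i_ge: "i n \<ge> N" for n using seq_suble[OF r(1), of "n + n0 + N"] unfolding i_def by simp
  have i_inj: "i n = i n' \<longleftrightarrow> n = n'" for n n' unfolding i_def using strict_mono_eq[OF r(1)] by simp
  define px py where "px n = fst (port (int (i n)) (h (i n)))" and "py n = snd (port (int (i n)) (h (i n)))" for n
  define E where "E n = {(False, px n + 1, py n), (False, px n + 2, py n), (True, px n + 1, py n + 1)}" for n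
  define S where "S n e = (if e = (False, px n + 1, py n) then near k (of_rat x) \<epsilon>' else
     if e = (False, px n + 2, py n) then near k (of_rat y) \<epsilon>' else near k z (\<epsilon>' / 2))" for n e
  define p where "p = min (measure (law False) (near k (of_rat x) \<epsilon>'))
     (min (measure (law False) (near k (of_rat y) \<epsilon>')) (measure (law True) (near k z (\<epsilon>' / 2))))"
  have p: "p > 0" "p \<le> 1"
    unfolding p_def using adm z prob_space.prob_le_1[OF law_prob, of True]
    by (auto simp: min_le_iff_disj admissible_def \<epsilon>'_def)
  define Q where "Q n g \<longleftrightarrow> (\<forall>e\<in>E n. g e \<in> S n e)" for n and g :: env
  have Q_meas: "{g. Q n g} \<in> events" for n
    unfolding Q_def by (rule emeasure_cylinder(2)) (auto simp: E_def S_def)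
  have none: "prob {g. \<not> (\<exists>n<M. Q n g)} \<le> (1 - p ^ 3) ^ M" for M
  proof (rule prob_none[OF _ Q_meas])
    show "depends_on (Q n) (E n)" for n unfolding depends_on_def Q_def by auto
    have gap: "px n + 4 \<le> px n' \<or> px n' + 4 \<le> px n" if "n \<noteq> n'" for n n'
    proof -
      have "i n < i n' \<or> i n' < i n" using that i_inj by (meson linorder_neqE_nat)
      then show ?thesis using port_fst_gap unfolding px_def by blast
    qed
    show "E n \<inter> E n' = {}" if "n \<noteq> n'" for n n' using gap[OF that] unfolding E_def by auto
    show "prob {g. Q n g} \<ge> p ^ 3" for n
      unfolding Q_def
    proof (rule prob_pattern)
      show "p \<le> measure (law (fst e)) (S n e)" if "e \<in> E n" for e
        using that unfolding E_def S_def p_def by auto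
      show "card (E n) \<le> 3" unfolding E_def by (simp add: card_insert_if)
    qed (use p in \<open>auto simp: E_def S_def\<close>)
  qed
  let ?A = "{g. \<forall>n. \<not> Q n g}"
  have A_meas: "?A \<in> events"
  proof -
    have "{g \<in> space field. \<forall>n. \<not> Q n g} \<in> events"
      by (intro sets.sets_Collect_countable_All) (use events_Collect_not[OF Q_meas] in simp)
    then show ?thesis by simp
  qed
  have none_meas: "{g. \<not> (\<exists>n<M. Q n g)} \<in> events" for M
  proof (rule events_Collect_not)
    have "{g \<in> space field. \<exists>n<M. Q n g} \<in> events"
      by (intro sets.sets_Collect_countable_Ex sets.sets_Collect_conj sets.sets_Collect_const) (use Q_meas in simp)
    then show "{g. \<exists>n<M. Q n g} \<in> events" by simp
  qed
  have "prob ?A \<le> (1 - p ^ 3) ^ M" for M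
    by (rule order_trans[OF finite_measure_mono[OF _ none_meas] none]) auto
  moreover have "(\<lambda>M. (1 - p ^ 3) ^ M) \<longlonglongrightarrow> 0"
  proof (rule LIMSEQ_realpow_zero)
    show "0 \<le> 1 - p ^ 3" using p by (simp add: power_le_one)
    show "1 - p ^ 3 < 1" using p by simp
  qed
  ultimately have "prob ?A \<le> 0" by (intro LIMSEQ_le_const[of "\<lambda>M. (1 - p ^ 3) ^ M"]) auto
  then have "?A \<in> null_sets field"
    using A_meas by (intro null_setsI) (auto simp: emeasure_eq_measure measure_le_0_iff)
  then have "AE g in field. g \<notin> ?A" by (rule AE_not_in)
  then show ?thesis
  proof eventually_elim
    fix g assume "g \<notin> ?A"
    then obtain n where n: "Q n g" by blast
    have "gadget_like g (i n) (h (i n)) k (of_rat x) (of_rat y) (b (i n)) \<epsilon>'"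
    proof -
      have q: "g (False, px n + 1, py n) \<in> near k (of_rat x) \<epsilon>'"
        "g (False, px n + 2, py n) \<in> near k (of_rat y) \<epsilon>'"
        "g (True, px n + 1, py n + 1) \<in> near k z (\<epsilon>' / 2)"
        using n unfolding Q_def E_def S_def by auto
      have "\<bar>b (i n) - z\<bar> < \<epsilon>' / 2" unfolding i_def by (rule close) simp
      then have "g (True, px n + 1, py n + 1) \<in> near k (b (i n)) \<epsilon>'"
        using q(3) unfolding near_def mem_Collect_eq by linarith
      then show ?thesis using q(1,2) unfolding gadget_like_def px_def py_def by (simp add: split_beta)
    qed
    then show "\<exists>i\<ge>N. gadget_like g i (h i) k (of_rat x) (of_rat y) (b i) (of_rat \<epsilon>)"
      using i_ge[of n] unfolding \<epsilon>'_def by blast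
  qed
qed

lemma level_good: "percolates w \<Longrightarrow> good_block w (int i) (level w i)"
  using surface_open[of "bad_block w" ground "int i"] unfolding percolates_def level_def by simp

lemma level_step: "percolates w \<Longrightarrow> level w (Suc i) - level w i \<in> {-1, 0, 1}"
proof -
  assume p: "percolates w"
  have "finite_height (bad_block w) ground (int (Suc i))" using p unfolding percolates_def by blast
  then have "\<bar>surface (bad_block w) ground (int i + 1) - surface (bad_block w) ground (int i)\<bar> \<le> 1"
    using p unfolding percolates_def by (intro surface_step) (auto simp: add.commute)
  then show ?thesis unfolding level_def by (simp add: add.commute; presburger)
qed

lemma bottom_bound: "good_block w (int i) J \<Longrightarrow> \<bar>bottom w i J\<bar> \<le> K"
proof -
  assume "good_block w (int i) J"
  then obtain hs :: "int list" where "hs ! 0 = int tall * J"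
      "\<forall>x<len. good_cell w (int len * int i + int x) (hs ! x)"
    unfolding good_block_def by (meson insertI1)
  then have "good_cell w (int len * int i) (int tall * J)" using len_pos by fastforce
  from entrance_bound(2)[OF this] show ?thesis unfolding bottom_def port_def by simp
qed

text \<open>Given all other edges, the surface of good blocks and its bottom edges are fixed, while
the gadget edges are still independent with their original laws.\<close>

lemma AE_rich: "AE w in field. rich w"
proof (rule AE_mix[OF rich_meas, of gadget_edges])
  show "AE u in field. AE g in field. rich (mix gadget_edges (u, g))"
    using AE_percolates AE_support
  proof eventually_elim
    fix u assume u: "percolates u" "\<forall>e k. \<bar>u e\<bar> \<le> real k \<longrightarrow> u e \<in> support k"
    have lev: "is_level (mix gadget_edges (u, g)) i J \<longleftrightarrow> J = level u i" for g i J
      using is_level_iff[OF u(1), of i J] unfolding is_level_def bad_block_mix .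
    define b where "b i = bottom u i (level u i)" for i
    have bot: "bottom (mix gadget_edges (u, g)) i J = bottom u i J" for g i J
      using gadget_edges_port(4)[of i J] unfolding bottom_def mix_def by (auto split: prod.split)
    have gad: "gadget_like (mix gadget_edges (u, g)) i J k x y z \<epsilon> = gadget_like g i J k x y z \<epsilon>" for g i J k x y z \<epsilon>
      using gadget_edges_port(1-3)[of i J] unfolding gadget_like_def mix_def by (auto split: prod.split)
    have "AE g in field. admissible k x y \<epsilon> \<longrightarrow> (\<exists>i\<ge>N. gadget_like g i (level u i) k (of_rat x) (of_rat y) (b i) (of_rat \<epsilon>))"
      for k x y \<epsilon> N
    proof (cases "admissible k x y \<epsilon>")
      case True
      have "b i \<in> support k" for i
      proof -
        have "\<bar>b i\<bar> \<le> real k"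
          using bottom_bound[OF level_good[OF u(1)], of i] True unfolding b_def admissible_def by linarith
        then show ?thesis using u(2) unfolding b_def bottom_def by (auto split: prod.splits)
      qed
      from gadget_recurs[OF this True] show ?thesis using True by simp
    qed simp
    then have "AE g in field. \<forall>k x y \<epsilon> N. admissible k x y \<epsilon> \<longrightarrow>
        (\<exists>i\<ge>N. gadget_like g i (level u i) k (of_rat x) (of_rat y) (b i) (of_rat \<epsilon>))"
      by (simp only: AE_all_countable) blast
    then show "AE g in field. rich (mix gadget_edges (u, g))"
    proof eventually_elim
      fix g assume "\<forall>k x y \<epsilon> N. admissible k x y \<epsilon> \<longrightarrow>
        (\<exists>i\<ge>N. gadget_like g i (level u i) k (of_rat x) (of_rat y) (b i) (of_rat \<epsilon>))"
      then show "rich (mix gadget_edges (u, g))"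
        unfolding rich_def lev gad bot b_def by blast
    qed
  qed
qed

lemma rich_types:
  assumes "percolates w" "rich w" "real k \<ge> K" "x \<in> support k" "y \<in> support k" "\<epsilon> > 0"
  shows "\<exists>i\<ge>N. gadget_like w i (level w i) k x y (bottom w i (level w i)) \<epsilon>"
proof -
  obtain \<delta> :: rat where \<delta>: "0 < (of_rat \<delta> :: real)" "of_rat \<delta> < \<epsilon> / 3"
    using of_rat_dense[of 0 "\<epsilon> / 3"] assms by auto
  obtain x' y' :: rat where x': "x - of_rat \<delta> < of_rat x'" "of_rat x' < x"
    and y': "y - of_rat \<delta> < of_rat y'" "of_rat y' < y"
    using of_rat_dense[of "x - of_rat \<delta>" x] of_rat_dense[of "y - of_rat \<delta>" y] \<delta> by auto
  have pos: "measure (law False) (near k (of_rat c') (of_rat (2 * \<delta>))) > 0"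
    if "c \<in> support k" "c - of_rat \<delta> < of_rat c'" "of_rat c' < c" for c and c' :: rat
  proof -
    have "near k c (of_rat \<delta>) \<subseteq> near k (of_rat c') (of_rat (2 * \<delta>))"
      using that(2,3) \<delta> unfolding near_def by (auto simp: of_rat_mult)
    then have "measure (law False) (near k c (of_rat \<delta>)) \<le> measure (law False) (near k (of_rat c') (of_rat (2 * \<delta>)))"
      by (intro finite_measure.finite_measure_mono[OF prob_space.finite_measure[OF law_prob]]) (simp_all add: law_sets)
    moreover have "measure (law False) (near k c (of_rat \<delta>)) > 0" using that(1) \<delta> unfolding support_def by blast
    ultimately show ?thesis by linarith
  qed
  have "admissible k x' y' (2 * \<delta>)"
    unfolding admissible_def using pos[OF assms(4) x'] pos[OF assms(5) y'] \<delta> assms(3) by simp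
  then obtain i J where iJ: "i \<ge> N" "is_level w i J"
    "gadget_like w i J k (of_rat x') (of_rat y') (bottom w i J) (of_rat (2 * \<delta>))"
    using assms(2) unfolding rich_def by blast
  have wid: "near k (of_rat c') (of_rat (2 * \<delta>)) \<subseteq> near k c \<epsilon>"
    if "c - of_rat \<delta> < of_rat c'" "of_rat c' < c" for c and c' :: rat
    using that \<delta> unfolding near_def by (auto simp: of_rat_mult)
  have wid0: "near k c (of_rat (2 * \<delta>)) \<subseteq> near k c \<epsilon>" for c
    using \<delta> unfolding near_def by (auto simp: of_rat_mult)
  have "gadget_like w i J k x y (bottom w i J) \<epsilon>"
    using iJ(3) wid[OF x'] wid[OF y'] wid0 unfolding gadget_like_def by (auto split: prod.splits)
  moreover have "J = level w i" using iJ(2) is_level_iff[OF assms(1)] by blast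
  ultimately show ?thesis using iJ(1) by blast
qed

text \<open>The walk goes straight up from the origin to the first block of the surface; this
segment lies on the line \<open>x = 0\<close>, to the left of all later vertices.\<close>

lemma balanced_path_exists:
  assumes perc: "percolates w" and sup: "\<forall>e k. \<bar>w e\<bar> \<le> real k \<longrightarrow> w e \<in> support k" and rich: "rich w"
  shows "balanced_path w"
proof -
  define P where "P i = port (int i) (level w i)" for i
  have P0: "P 0 = (0, int (nat (height * (int tall * level w 0))))"
  proof -
    have "level w 0 > 0"
      using surface_props(1)[of "bad_block w" ground 0] perc unfolding level_def percolates_def
      by (metis of_nat_0)
    then show ?thesis unfolding P_def port_def by simp
  qed
  define T where "T = nat (height * (int tall * level w 0))"
  obtain k :: nat where k: "real k > max K (\<Sum>t<T. \<bar>w (False, 0, 0 + int t)\<bar>)" using reals_Archimedean2 by blast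
  have seg: "\<bar>w (False, 0, 0 + int t)\<bar> \<le> real k" if "t < T" for t
    using member_le_sum[of t "{..<T}" "\<lambda>t. \<bar>w (False, 0, 0 + int t)\<bar>"] that k by auto
  have "conn w (real k) T ({0} \<times> {0<..0 + int T}) (0, 0) (0, 0 + int T) (\<Sum>t<T. w (False, 0, 0 + int t))"
    by (rule conn_up) (rule seg)
  then obtain p0 where p0: "walk w (real k) (0, 0) p0" "last ((0, 0) # p0) = (0, int T)" "distinct p0"
      "set p0 \<subseteq> {0} \<times> {0<..int T}" unfolding conn_def by auto
  have good: "good_block w (int i) (level w i)" for i by (rule level_good[OF perc])
  have next_port: "port (int i + 1) (level w i + (level w (Suc i) - level w i)) = P (Suc i)" for i
    unfolding P_def by (simp add: add.commute)
  define offered where "offered i r \<longleftrightarrow> \<bar>r\<bar> \<le> block_bound \<and>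
      conn w K block_length (span (int i)) (P i) (P (Suc i)) r \<and>
      (\<forall>k\<ge>K. \<bar>w (False, fst (P i) + 1, snd (P i))\<bar> \<le> k \<longrightarrow> \<bar>w (False, fst (P i) + 2, snd (P i))\<bar> \<le> k \<longrightarrow>
          \<bar>w (True, fst (P i) + 1, snd (P i) + 1)\<bar> \<le> k \<longrightarrow>
        conn w k block_length (span (int i)) (P i) (P (Suc i)) (r + gadget_effect w (fst (P i)) (snd (P i))))" for i r
  have crossing: "\<exists>r. \<sigma> * r \<ge> 1 \<and> offered i r" if "\<sigma> \<in> {-1, 1}" for \<sigma> i
    using block_crossing[OF good level_step[OF perc] that, of i i]
    unfolding next_port offered_def unfolding P_def .
  obtain rp where rp: "\<And>i. 1 * rp i \<ge> 1 \<and> offered i (rp i)" using crossing[of 1] by (metis insertI1 insertI2)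
  obtain rn where rn: "\<And>i. (-1) * rn i \<ge> 1 \<and> offered i (rn i)" using crossing[of "-1"] by (metis insertI1)
  define usable where "usable i \<longleftrightarrow> \<bar>w (False, fst (P i) + 1, snd (P i))\<bar> \<le> real k \<and>
     \<bar>w (False, fst (P i) + 2, snd (P i))\<bar> \<le> real k \<and> \<bar>w (True, fst (P i) + 1, snd (P i) + 1)\<bar> \<le> real k" for i
  have kK: "K \<le> real k" using k by simp
  have fstP: "fst (P i) = width * (int len * int i)" for i unfolding P_def port_def by simp
  have "steered_walk w (real k) block_length block_bound (\<lambda>i. span (int i)) P
    (\<lambda>i. gadget_effect w (fst (P i)) (snd (P i))) rp rn usable (support k) p0"
  proof
    show "0 \<le> rp i \<and> rp i \<le> block_bound \<and> conn w (real k) block_length (span (int i)) (P i) (P (Suc i)) (rp i)" for i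
      using rp[of i] conn_mono[OF _ kK order_refl order_refl] unfolding offered_def by auto
    show "- block_bound \<le> rn i \<and> rn i \<le> 0 \<and> conn w (real k) block_length (span (int i)) (P i) (P (Suc i)) (rn i)" for i
      using rn[of i] conn_mono[OF _ kK order_refl order_refl] unfolding offered_def by auto
    show "conn w (real k) block_length (span (int i)) (P i) (P (Suc i)) (rp i + gadget_effect w (fst (P i)) (snd (P i))) \<and>
      conn w (real k) block_length (span (int i)) (P i) (P (Suc i)) (rn i + gadget_effect w (fst (P i)) (snd (P i)))"
      if "usable i" for i
      using rp[of i] rn[of i] kK that unfolding usable_def offered_def by blast
    show "span (int i) \<inter> span (int j) = {}" if "i \<noteq> j" for i j
    proof -
      have le: "width * (int len * (int a + 1)) \<le> width * (int len * int b)" if "a < b" for a b :: nat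
        using that width_pos by (intro mult_left_mono) auto
      show ?thesis
        using le[of i j] le[of j i] that unfolding span_def by (cases "i < j") auto
    qed
    show "P i \<noteq> P (Suc i)" for i
      using port_fst_gap[of i "Suc i" "level w i" "level w (Suc i)"] unfolding P_def by auto
    show "even (fst (P i) + snd (P i))" for i
      unfolding P_def port_def width_def using B(1) by simp
    show "crossing w u v \<in> support k" if "adjacent u v" "\<bar>crossing w u v\<bar> \<le> real k" for u v
    proof -
      have "\<exists>e. crossing w u v = w e \<or> crossing w u v = - w e" unfolding crossing_def by metis
      then obtain e where e: "crossing w u v = w e \<or> crossing w u v = - w e" by blast
      then have "\<bar>w e\<bar> \<le> real k" using that(2) by (metis abs_minus_cancel)
      then have "w e \<in> support k" using sup by blast
      then show ?thesis using e support_minus by metis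
    qed
    show "- x \<in> support k" if "x \<in> support k" for x using that by (rule support_minus)
    show "\<bar>x\<bar> \<le> real k" if "x \<in> support k" for x using that by (rule support_bound)
    show "\<exists>i\<ge>N. usable i \<and> \<bar>gadget_effect w (fst (P i)) (snd (P i)) - (x - y)\<bar> < \<epsilon>"
      if "x \<in> support k" "y \<in> support k" "\<epsilon> > 0" for x y \<epsilon> N
    proof -
      obtain i where i: "i \<ge> N" "gadget_like w i (level w i) k x y (bottom w i (level w i)) (\<epsilon> / 3)"
        using rich_types[OF perc rich kK, of x y "\<epsilon> / 3"] \<open>x \<in> support k\<close> \<open>y \<in> support k\<close> \<open>\<epsilon> > 0\<close> by auto
      have "w (False, fst (P i) + 1, snd (P i)) \<in> near k x (\<epsilon> / 3)"
        "w (False, fst (P i) + 2, snd (P i)) \<in> near k y (\<epsilon> / 3)"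
        "w (True, fst (P i) + 1, snd (P i) + 1) \<in> near k (w (True, fst (P i) + 1, snd (P i))) (\<epsilon> / 3)"
        using i(2) unfolding gadget_like_def bottom_def P_def by (simp_all add: split_beta)
      note edges = this[unfolded near_def mem_Collect_eq]
      have "usable i" unfolding usable_def using edges by blast
      moreover have "\<bar>gadget_effect w (fst (P i)) (snd (P i)) - (x - y)\<bar> < \<epsilon>"
        unfolding gadget_effect_def using edges by linarith
      ultimately show ?thesis using i(1) by blast
    qed
    show "walk w (real k) (0, 0) p0" by (rule p0(1))
    show "last ((0, 0) # p0) = P 0" unfolding p0(2) P0 T_def ..
    show "distinct ((0, 0) # p0)" using p0(3,4) by auto
    show "set ((0, 0) # p0) \<inter> span (int i) = {}" for i
    proof -
      have "width * (int len * int i) \<ge> 0" using width_pos by simp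
      then show ?thesis using p0(4) unfolding span_def by auto
    qed
  qed simp
  then show ?thesis by (rule steered_walk.balanced_path)
qed

lemma AE_balanced_path_block: "AE w in field. balanced_path w"
  using AE_percolates AE_support AE_rich
  by eventually_elim (rule balanced_path_exists)

end

theorem (in edge_field) AE_balanced_path: "AE w in field. balanced_path w"
proof -
  obtain n B R C K m len tall where "block_field law n B R C K m len tall"
    using block_field_exists by blast
  then show ?thesis by (rule block_field.AE_balanced_path_block)
qed

section \<open>The random environment\<close>

definition edge :: "bool \<times> int \<times> int \<Rightarrow> edge" where
  "edge i = (case i of (b, x, y) \<Rightarrow> {(x, y), if b then (x + 1, y) else (x, y + 1)})"

lemma edge_lattice: "edge i \<in> lattice_edges"
proof -
  obtain b x y where i: "i = (b, x, y)" by (cases i)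
  show ?thesis
    unfolding lattice_edges_def edge_def i
    by (cases b) (simp_all, (rule exI[of _ x], rule exI[of _ y], rule exI[of _ "x + 1"], rule exI[of _ y], simp)?,
        (rule exI[of _ x], rule exI[of _ y], rule exI[of _ x], rule exI[of _ "y + 1"], simp)?)
qed

lemma edge_horizontal: "edge (True, x, y) \<in> horizontal_edges"
  unfolding horizontal_edges_def edge_def
  by simp (rule exI[of _ x], rule exI[of _ y], rule exI[of _ "x + 1"], rule exI[of _ y], simp)

lemma edge_vertical: "edge (False, x, y) \<in> vertical_edges"
  unfolding vertical_edges_def edge_def
  by simp (rule exI[of _ x], rule exI[of _ y], rule exI[of _ x], rule exI[of _ "y + 1"], simp)

lemma inj_edge: "inj edge"
  by (rule injI) (auto simp: edge_def doubleton_eq_iff split: prod.splits if_splits)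

lemma edge_adjacent:
  assumes "adjacent u v"
  shows "of_int (step_sign u v) * Yw {u, v} * Xw {u, v} = crossing (\<lambda>i. Yw (edge i) * Xw (edge i)) u v"
proof -
  obtain a b c d where uv: "u = (a, b)" "v = (c, d)" by (cases u, cases v)
  have "\<bar>a - c\<bar> + \<bar>b - d\<bar> = 1" using assms unfolding adjacent_def uv by simp
  then consider "c = a + 1" "d = b" | "c = a - 1" "d = b" | "c = a" "d = b + 1" | "c = a" "d = b - 1" by linarith
  then show ?thesis
    by cases (simp_all add: uv step_sign_def crossing_def edge_def insert_commute)
qed

lemma balanced_path_partial_sums:
  fixes Xw Yw :: "edge \<Rightarrow> real"
  assumes "balanced_path (\<lambda>i. Yw (edge i) * Xw (edge i))"
  shows "\<exists>\<eta>\<in>self_avoiding_paths. bounded (range (partial_sum Xw Yw \<eta>)) \<and>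
    accumulation_point (partial_sum Xw Yw \<eta>) 0"
proof -
  let ?w = "\<lambda>i. Yw (edge i) * Xw (edge i)"
  obtain \<eta> b where \<eta>: "\<eta> 0 = (0, 0)" "\<And>i. adjacent (\<eta> i) (\<eta> (Suc i))" "inj \<eta>"
    and b: "\<And>N. \<bar>\<Sum>i<N. crossing ?w (\<eta> i) (\<eta> (Suc i))\<bar> \<le> b"
    and small: "\<And>\<epsilon> n. \<epsilon> > 0 \<Longrightarrow> \<exists>N\<ge>n. \<bar>\<Sum>i<N. crossing ?w (\<eta> i) (\<eta> (Suc i))\<bar> < \<epsilon>"
    using assms unfolding balanced_path_def by blast
  have S: "partial_sum Xw Yw \<eta> N = (\<Sum>i<N. crossing ?w (\<eta> i) (\<eta> (Suc i)))" for N
  proof -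
    have "partial_sum Xw Yw \<eta> N = (\<Sum>k = Suc 0..N. crossing ?w (\<eta> (k - 1)) (\<eta> k))"
      unfolding partial_sum_def path_edge_def
    proof (rule sum.cong)
      fix k assume "k \<in> {Suc 0..N}"
      then have "adjacent (\<eta> (k - 1)) (\<eta> k)" using \<eta>(2)[of "k - 1"] by simp
      then show "of_int (step_sign (\<eta> (k - 1)) (\<eta> k)) * Yw {\<eta> (k - 1), \<eta> k} * Xw {\<eta> (k - 1), \<eta> k} =
          crossing ?w (\<eta> (k - 1)) (\<eta> k)" by (rule edge_adjacent)
    qed simp
    also have "\<dots> = (\<Sum>i<N. crossing ?w (\<eta> i) (\<eta> (Suc i)))"
      by (simp add: sum.atLeast1_atMost_eq)
    finally show ?thesis .
  qed
  have "path_edge \<eta> k \<in> lattice_edges" if "k \<ge> 1" for k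
  proof -
    have "adjacent (\<eta> (k - 1)) (\<eta> k)" using \<eta>(2)[of "k - 1"] that by simp
    then show ?thesis
      unfolding path_edge_def lattice_edges_def adjacent_def
      by (intro CollectI exI[of _ "fst (\<eta> (k - 1))"] exI[of _ "snd (\<eta> (k - 1))"]
          exI[of _ "fst (\<eta> k)"] exI[of _ "snd (\<eta> k)"]) simp
  qed
  then have "\<eta> \<in> self_avoiding_paths"
    unfolding self_avoiding_paths_def infinite_path_from_def using \<eta>(1,3) by simp
  moreover have "bounded (range (partial_sum Xw Yw \<eta>))"
    using b unfolding bounded_iff S[symmetric] by auto
  moreover have "accumulation_point (partial_sum Xw Yw \<eta>) 0"
    unfolding accumulation_point_def
  proof (intro allI impI)
    fix U :: "real set" assume "open U \<and> 0 \<in> U"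
    then obtain \<epsilon> where \<epsilon>: "\<epsilon> > 0" "\<And>x. dist x 0 < \<epsilon> \<Longrightarrow> x \<in> U" unfolding open_dist by blast
    show "infinite {n. partial_sum Xw Yw \<eta> n \<in> U}"
      unfolding infinite_nat_iff_unbounded_le
    proof
      fix n
      obtain N where "N \<ge> n" "\<bar>partial_sum Xw Yw \<eta> N\<bar> < \<epsilon>" using small[OF \<epsilon>(1), of n] unfolding S by blast
      then show "\<exists>N\<ge>n. N \<in> {n. partial_sum Xw Yw \<eta> n \<in> U}" using \<epsilon>(2) by auto
    qed
  qed
  ultimately show ?thesis by blast
qed

locale environment = prob_space M
  for M :: "'a measure" +
  fixes X Y :: "edge \<Rightarrow> 'a \<Rightarrow> real" and L :: "real measure" and p_o p_v :: real
  assumes indep_X: "indep_vars (\<lambda>_. borel) X lattice_edges"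
    and indep_Y: "indep_vars (\<lambda>_. borel) Y lattice_edges"
    and indep_XY: "indep_var
          (PiM lattice_edges (\<lambda>_. borel)) (\<lambda>\<omega>. \<lambda>e\<in>lattice_edges. X e \<omega>)
          (PiM lattice_edges (\<lambda>_. borel)) (\<lambda>\<omega>. \<lambda>e\<in>lattice_edges. Y e \<omega>)"
    and law_X: "\<And>e. e \<in> lattice_edges \<Longrightarrow> distr M borel (X e) = L"
    and L_nontrivial: "L \<noteq> return borel 0"
    and values_Y: "\<And>e \<omega>. e \<in> lattice_edges \<Longrightarrow> \<omega> \<in> space M \<Longrightarrow> Y e \<omega> \<in> {-1, 1}"
    and Y_horizontal: "\<And>e. e \<in> horizontal_edges \<Longrightarrow> measure M {\<omega> \<in> space M. Y e \<omega> = 1} = p_o"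
    and Y_vertical: "\<And>e. e \<in> vertical_edges \<Longrightarrow> measure M {\<omega> \<in> space M. Y e \<omega> = 1} = p_v"
    and p: "0 < p_o" "p_o < 1" "0 < p_v" "p_v < 1"
begin

lemma X_meas: "e \<in> lattice_edges \<Longrightarrow> X e \<in> borel_measurable M"
  using indep_X unfolding indep_vars_def by blast

lemma Y_meas: "e \<in> lattice_edges \<Longrightarrow> Y e \<in> borel_measurable M"
  using indep_Y unfolding indep_vars_def by blast

lemma cylinder_sets:
  assumes "finite J" "J \<subseteq> lattice_edges" "\<And>e. e \<in> J \<Longrightarrow> A e \<in> sets borel"
  shows "{f \<in> space (PiM lattice_edges (\<lambda>_. borel)). \<forall>e\<in>J. f e \<in> A e} \<in> sets (PiM lattice_edges (\<lambda>_. borel :: real measure))"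
proof (rule sets.sets_Collect_finite_All[OF _ assms(1)])
  fix e assume e: "e \<in> J"
  have "(\<lambda>f. f e) \<in> measurable (PiM lattice_edges (\<lambda>_. borel :: real measure)) borel"
    by (rule measurable_component_singleton) (use e assms(2) in auto)
  from measurable_sets[OF this assms(3)[OF e]]
  show "{f \<in> space (PiM lattice_edges (\<lambda>_. borel)). f e \<in> A e} \<in> sets (PiM lattice_edges (\<lambda>_. borel :: real measure))"
    by (simp add: vimage_def Collect_conj_eq Int_commute)
qed

lemma prob_joint:
  assumes "finite J" "J \<subseteq> lattice_edges" "\<And>e. e \<in> J \<Longrightarrow> A e \<in> sets borel"
    and "finite J'" "J' \<subseteq> lattice_edges" "\<And>e. e \<in> J' \<Longrightarrow> A' e \<in> sets borel"
  shows "prob {\<omega> \<in> space M. (\<forall>e\<in>J. X e \<omega> \<in> A e) \<and> (\<forall>e\<in>J'. Y e \<omega> \<in> A' e)} =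
    (\<Prod>e\<in>J. prob {\<omega> \<in> space M. X e \<omega> \<in> A e}) * (\<Prod>e\<in>J'. prob {\<omega> \<in> space M. Y e \<omega> \<in> A' e})"
proof -
  let ?P = "PiM lattice_edges (\<lambda>_. borel :: real measure)"
  let ?XX = "\<lambda>\<omega>. \<lambda>e\<in>lattice_edges. X e \<omega>" and ?YY = "\<lambda>\<omega>. \<lambda>e\<in>lattice_edges. Y e \<omega>"
  let ?C = "{f \<in> space ?P. \<forall>e\<in>J. f e \<in> A e}" and ?C' = "{f \<in> space ?P. \<forall>e\<in>J'. f e \<in> A' e}"
  have C: "?XX -` ?C \<inter> space M = {\<omega> \<in> space M. \<forall>e\<in>J. X e \<omega> \<in> A e}"
    using assms(2) by (auto simp: space_PiM)
  have C': "?YY -` ?C' \<inter> space M = {\<omega> \<in> space M. \<forall>e\<in>J'. Y e \<omega> \<in> A' e}"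
    using assms(5) by (auto simp: space_PiM)
  have pair: "(\<lambda>\<omega>. (?XX \<omega>, ?YY \<omega>)) -` (?C \<times> ?C') \<inter> space M =
      (?XX -` ?C \<inter> space M) \<inter> (?YY -` ?C' \<inter> space M)" by auto
  have C_sets: "?C \<in> sets ?P" by (rule cylinder_sets) (use assms in auto)
  have C'_sets: "?C' \<in> sets ?P" by (rule cylinder_sets) (use assms in auto)
  have "prob ((?XX -` ?C \<inter> space M) \<inter> (?YY -` ?C' \<inter> space M)) =
      prob (?XX -` ?C \<inter> space M) * prob (?YY -` ?C' \<inter> space M)"
    using indep_varD[OF indep_XY C_sets C'_sets] unfolding pair .
  moreover have "(?XX -` ?C \<inter> space M) \<inter> (?YY -` ?C' \<inter> space M) =
      {\<omega> \<in> space M. (\<forall>e\<in>J. X e \<omega> \<in> A e) \<and> (\<forall>e\<in>J'. Y e \<omega> \<in> A' e)}" unfolding C C' by (rule set_eqI) (simp, blast)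
  moreover have prod: "prob {\<omega> \<in> space M. \<forall>e\<in>J. Z e \<omega> \<in> A e} = (\<Prod>e\<in>J. prob {\<omega> \<in> space M. Z e \<omega> \<in> A e})"
    if "indep_vars (\<lambda>_. borel) Z lattice_edges" "finite J" "J \<subseteq> lattice_edges" "\<And>e. e \<in> J \<Longrightarrow> A e \<in> sets borel"
    for Z :: "edge \<Rightarrow> 'a \<Rightarrow> real" and J A
  proof (cases "J = {}")
    case True
    then show ?thesis by (simp add: prob_space)
  next
    case False
    have single: "Z e -` A e \<inter> space M = {\<omega> \<in> space M. Z e \<omega> \<in> A e}" for e by auto
    have "prob (\<Inter>e\<in>J. Z e -` A e \<inter> space M) = (\<Prod>e\<in>J. prob (Z e -` A e \<inter> space M))"
      by (rule indep_varsD[OF that(1) False]) (use that in auto)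
    moreover have "(\<Inter>e\<in>J. {\<omega> \<in> space M. Z e \<omega> \<in> A e}) = {\<omega> \<in> space M. \<forall>e\<in>J. Z e \<omega> \<in> A e}" using False by auto
    ultimately show ?thesis unfolding single by simp
  qed
  ultimately show ?thesis
    using prod[OF indep_X assms(1-3)] prod[OF indep_Y assms(4-6)] unfolding C C' by simp
qed

text \<open>The two families combined into one, so that the independence of products follows by
grouping.\<close>

definition both :: "bool \<times> edge \<Rightarrow> 'a \<Rightarrow> real" where
  "both z = (if fst z then X (snd z) else Y (snd z))"

lemma indep_both: "indep_vars (\<lambda>_. borel) both (UNIV \<times> lattice_edges)"
  unfolding indep_vars_def2
proof (intro conjI ballI)
  show "both z \<in> borel_measurable M" if "z \<in> UNIV \<times> lattice_edges" for z
    using that X_meas Y_meas unfolding both_def by auto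
  show "indep_sets (\<lambda>z. {both z -` A \<inter> space M |A. A \<in> sets borel}) (UNIV \<times> lattice_edges)"
  proof (rule indep_setsI)
    show "{both z -` A \<inter> space M |A. A \<in> sets borel} \<subseteq> events" if "z \<in> UNIV \<times> lattice_edges" for z
      using that X_meas Y_meas unfolding both_def by (auto intro: measurable_sets)
    fix A J assume J: "J \<noteq> {}" "J \<subseteq> UNIV \<times> lattice_edges" "finite J"
      and A: "\<forall>j\<in>J. A j \<in> {both j -` A \<inter> space M |A. A \<in> sets borel}"
    then have "\<forall>j\<in>J. \<exists>S. S \<in> sets borel \<and> A j = both j -` S \<inter> space M" by auto
    then obtain S where S: "\<And>j. j \<in> J \<Longrightarrow> S j \<in> sets borel" "\<And>j. j \<in> J \<Longrightarrow> A j = both j -` S j \<inter> space M" by metis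
    define JX JY where "JX = {e. (True, e) \<in> J}" and "JY = {e. (False, e) \<in> J}"
    have JJ: "J = Pair True ` JX \<union> Pair False ` JY"
    proof (rule set_eqI)
      fix z :: "bool \<times> edge"
      show "z \<in> J \<longleftrightarrow> z \<in> Pair True ` JX \<union> Pair False ` JY"
        unfolding JX_def JY_def by (cases z; cases "fst z") auto
    qed
    have fin: "finite JX" "finite JY"
      using J(3) unfolding JJ by (auto dest: finite_imageD simp: inj_on_def)
    have sub: "JX \<subseteq> lattice_edges" "JY \<subseteq> lattice_edges" using J(2) unfolding JX_def JY_def by auto
    have "(\<Inter>j\<in>J. A j) = {\<omega> \<in> space M. (\<forall>e\<in>JX. X e \<omega> \<in> S (True, e)) \<and> (\<forall>e\<in>JY. Y e \<omega> \<in> S (False, e))}"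
    proof -
      have "(\<Inter>j\<in>J. A j) = {\<omega> \<in> space M. \<forall>j\<in>J. both j \<omega> \<in> S j}" using S(2) J(1) by auto
      also have "\<dots> = {\<omega> \<in> space M. (\<forall>e\<in>JX. X e \<omega> \<in> S (True, e)) \<and> (\<forall>e\<in>JY. Y e \<omega> \<in> S (False, e))}"
        unfolding JJ ball_Un both_def by (simp add: ball_simps)
      finally show ?thesis .
    qed
    then have "prob (\<Inter>j\<in>J. A j) = (\<Prod>e\<in>JX. prob {\<omega> \<in> space M. X e \<omega> \<in> S (True, e)}) *
        (\<Prod>e\<in>JY. prob {\<omega> \<in> space M. Y e \<omega> \<in> S (False, e)})"
      using prob_joint[OF fin(1) sub(1) _ fin(2) sub(2), of "\<lambda>e. S (True, e)" "\<lambda>e. S (False, e)"] S(1)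
      unfolding JX_def JY_def by simp
    also have "(\<Prod>e\<in>JX. prob {\<omega> \<in> space M. X e \<omega> \<in> S (True, e)}) = (\<Prod>e\<in>JX. prob (A (True, e)))"
      by (rule prod.cong) (auto simp: JX_def S(2) both_def intro!: arg_cong[where f = prob])
    also have "(\<Prod>e\<in>JY. prob {\<omega> \<in> space M. Y e \<omega> \<in> S (False, e)}) = (\<Prod>e\<in>JY. prob (A (False, e)))"
      by (rule prod.cong) (auto simp: JY_def S(2) both_def intro!: arg_cong[where f = prob])
    also have "(\<Prod>e\<in>JX. prob (A (True, e))) * (\<Prod>e\<in>JY. prob (A (False, e))) = (\<Prod>j\<in>J. prob (A j))"
      unfolding JJ using fin
      by (subst prod.union_disjoint) (auto simp: prod.reindex inj_on_def)
    finally show "prob (\<Inter>j\<in>J. A j) = (\<Prod>j\<in>J. prob (A j))" .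
  qed
qed

definition W :: "bool \<times> int \<times> int \<Rightarrow> 'a \<Rightarrow> real" where
  "W i \<omega> = Y (edge i) \<omega> * X (edge i) \<omega>"

lemma W_meas: "W i \<in> borel_measurable M"
  unfolding W_def using X_meas[OF edge_lattice] Y_meas[OF edge_lattice] by (intro borel_measurable_times)

lemma indep_W: "indep_vars (\<lambda>_. borel) W UNIV"
proof -
  define Z where "Z i = {(True, edge i), (False, edge i)}" for i
  have 1: "indep_vars (\<lambda>i. PiM (Z i) (\<lambda>_. borel)) (\<lambda>i \<omega>. restrict (\<lambda>z. both z \<omega>) (Z i)) UNIV"
  proof (rule indep_vars_restrict[OF indep_both])
    show "Z i \<subseteq> UNIV \<times> lattice_edges" for i unfolding Z_def using edge_lattice by simp
    show "disjoint_family_on Z UNIV"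
      unfolding disjoint_family_on_def Z_def using inj_eq[OF inj_edge] by simp
  qed
  have "indep_vars (\<lambda>_. borel) (\<lambda>i \<omega>. (\<lambda>f. f (False, edge i) * f (True, edge i)) (restrict (\<lambda>z. both z \<omega>) (Z i))) UNIV"
  proof (rule indep_vars_compose2[OF 1])
    fix i
    show "(\<lambda>f. f (False, edge i) * f (True, edge i)) \<in> borel_measurable (PiM (Z i) (\<lambda>_. borel :: real measure))"
      by (intro borel_measurable_times measurable_component_singleton) (auto simp: Z_def)
  qed
  then show ?thesis unfolding W_def both_def Z_def by simp
qed

definition sign_prob :: "bool \<Rightarrow> real" where "sign_prob b = (if b then p_o else p_v)"

lemma sign_prob: "0 < sign_prob b" "sign_prob b < 1"
  unfolding sign_prob_def using p by auto

lemma prob_Y: "prob {\<omega> \<in> space M. Y (edge i) \<omega> = 1} = sign_prob (fst i)"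
  using Y_horizontal[OF edge_horizontal] Y_vertical[OF edge_vertical]
  unfolding sign_prob_def by (cases i) (auto; metis)

text \<open>Conditioning on the sign shows that the law depends only on the orientation, and that a
set is null if and only if \<open>L\<close> vanishes on it and on its reflection.\<close>

lemma prob_W:
  assumes S: "S \<in> sets borel"
  shows "prob {\<omega> \<in> space M. W i \<omega> \<in> S} = sign_prob (fst i) * measure L S + (1 - sign_prob (fst i)) * measure L (uminus -` S)"
proof -
  let ?e = "edge i"
  have e: "?e \<in> lattice_edges" by (rule edge_lattice)
  note [measurable] = X_meas[OF e] Y_meas[OF e]
  have S': "uminus -` S \<in> sets borel" using measurable_sets[of uminus borel borel S] S by simp
  have LX: "prob {\<omega> \<in> space M. X ?e \<omega> \<in> T} = measure L T" if "T \<in> sets borel" for T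
    using measure_distr[OF X_meas[OF e] that] law_X[OF e] by (simp add: vimage_def Collect_conj_eq Int_commute)
  have joint: "prob {\<omega> \<in> space M. X ?e \<omega> \<in> T \<and> Y ?e \<omega> = c} = measure L T * prob {\<omega> \<in> space M. Y ?e \<omega> = c}"
    if "T \<in> sets borel" for T c
    using prob_joint[of "{?e}" "\<lambda>_. T" "{?e}" "\<lambda>_. {c}"] e that LX[OF that] by simp
  have Ym: "prob {\<omega> \<in> space M. Y ?e \<omega> = -1} = 1 - sign_prob (fst i)"
  proof -
    have ev: "{\<omega> \<in> space M. Y ?e \<omega> = 1} \<in> events" by measurable
    have "{\<omega> \<in> space M. Y ?e \<omega> = -1} = space M - {\<omega> \<in> space M. Y ?e \<omega> = 1}"
      using values_Y[OF e] by auto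
    then show ?thesis using prob_compl[OF ev] prob_Y by simp
  qed
  have split: "{\<omega> \<in> space M. W i \<omega> \<in> S} =
      {\<omega> \<in> space M. X ?e \<omega> \<in> S \<and> Y ?e \<omega> = 1} \<union> {\<omega> \<in> space M. X ?e \<omega> \<in> uminus -` S \<and> Y ?e \<omega> = -1}"
    using values_Y[OF e] unfolding W_def by force
  have ev: "{\<omega> \<in> space M. X ?e \<omega> \<in> T \<and> Y ?e \<omega> = c} \<in> events" if "T \<in> sets borel" for T c
  proof -
    note [measurable] = that
    show ?thesis by measurable
  qed
  have "prob {\<omega> \<in> space M. W i \<omega> \<in> S} =
      prob {\<omega> \<in> space M. X ?e \<omega> \<in> S \<and> Y ?e \<omega> = 1} + prob {\<omega> \<in> space M. X ?e \<omega> \<in> uminus -` S \<and> Y ?e \<omega> = -1}"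
    unfolding split by (rule finite_measure_Union[OF ev[OF S] ev[OF S']]) auto
  then show ?thesis unfolding joint[OF S] joint[OF S'] Ym prob_Y by (simp add: mult.commute)
qed

definition edge_law :: "bool \<Rightarrow> real measure" where "edge_law b = distr M borel (W (b, 0, 0))"

lemma measure_edge_law:
  assumes "S \<in> sets borel"
  shows "measure (edge_law b) S = sign_prob b * measure L S + (1 - sign_prob b) * measure L (uminus -` S)"
  unfolding edge_law_def using measure_distr[OF W_meas assms] prob_W[OF assms, of "(b, 0, 0)"]
  by (simp add: vimage_def Collect_conj_eq Int_commute)

lemma measure_edge_law_eq_0:
  assumes "S \<in> sets borel"
  shows "measure (edge_law b) S = 0 \<longleftrightarrow> measure L S = 0 \<and> measure L (uminus -` S) = 0"
  unfolding measure_edge_law[OF assms]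
  using sign_prob[of b] measure_nonneg[of L S] measure_nonneg[of L "uminus -` S"]
  by (subst add_nonneg_eq_0_iff) auto

lemma distr_W: "distr M borel (W i) = edge_law (fst i)"
proof (rule measure_eqI)
  fix S assume "S \<in> sets (distr M borel (W i))"
  then have S: "S \<in> sets borel" by simp
  have "prob (W i -` S \<inter> space M) = prob (W (fst i, 0, 0) -` S \<inter> space M)"
    using prob_W[OF S, of i] prob_W[OF S, of "(fst i, 0, 0)"]
    by (simp add: vimage_def Collect_conj_eq Int_commute)
  then show "emeasure (distr M borel (W i)) S = emeasure (edge_law (fst i)) S"
    unfolding edge_law_def emeasure_distr[OF W_meas S] by (simp add: emeasure_eq_measure)
qed (simp add: edge_law_def)

lemma L_punctured: "measure L (- {0}) \<noteq> 0"
proof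
  assume 0: "measure L (- {0}) = 0"
  have L: "L = distr M borel (X (edge (True, 0, 0)))" using law_X[OF edge_lattice] by simp
  have sets: "sets L = sets borel" unfolding L by simp
  interpret L: prob_space L unfolding L by (rule prob_space_distr) (rule X_meas[OF edge_lattice])
  have "L = return borel 0"
  proof (rule measure_eqI)
    fix A assume "A \<in> sets L"
    then have A: "A \<in> sets borel" unfolding sets .
    have null: "measure L T = 0" if "T \<subseteq> - {0}" for T
      using L.finite_measure_mono[OF that] 0 by (simp add: sets measure_le_0_iff)
    show "emeasure L A = emeasure (return borel 0) A"
    proof (cases "0 \<in> A")
      case True
      have "measure L (space L - A) = 1 - measure L A" by (rule L.prob_compl) (simp add: sets A)
      moreover have "measure L (space L - A) = 0" by (rule null) (use True in auto)
      ultimately show ?thesis using True A by (simp add: L.emeasure_eq_measure)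
    next
      case False
      then have "measure L A = 0" by (intro null) auto
      then show ?thesis using False A by (simp add: L.emeasure_eq_measure)
    qed
  qed (simp add: sets)
  then show False using L_nontrivial by simp
qed

sublocale edges: edge_field edge_law
proof (rule edge_field.intro)
  show "prob_space (edge_law b)" for b unfolding edge_law_def by (rule prob_space_distr) (rule W_meas)
  show "sets (edge_law b) = sets borel" for b unfolding edge_law_def by simp
  show "measure (edge_law True) S = 0 \<longleftrightarrow> measure (edge_law False) S = 0" if "S \<in> sets borel" for S
    unfolding measure_edge_law_eq_0[OF that] ..
  show "measure (edge_law b) (uminus -` S) = 0 \<longleftrightarrow> measure (edge_law b) S = 0" if "S \<in> sets borel" for S b
  proof -
    have S': "uminus -` S \<in> sets borel" using measurable_sets[of uminus borel borel S] that by simp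
    have "uminus -` uminus -` S = S" by auto
    then show ?thesis unfolding measure_edge_law_eq_0[OF that] measure_edge_law_eq_0[OF S'] by auto
  qed
  have "- {0 :: real} \<in> sets borel" by simp
  from measure_edge_law_eq_0[OF this] show "measure (edge_law False) (- {0}) \<noteq> 0"
    using L_punctured by simp
qed

theorem AE_path: "AE \<omega> in M. balanced_path (\<lambda>i. Y (edge i) \<omega> * X (edge i) \<omega>)"
proof -
  have "distr M (PiM UNIV (\<lambda>_. borel)) (\<lambda>\<omega>. \<lambda>i\<in>UNIV. W i \<omega>) = PiM UNIV (\<lambda>i. distr M borel (W i))"
    using indep_W by (subst (asm) indep_vars_iff_distr_eq_PiM) (auto simp: W_meas)
  then have d: "distr M (PiM UNIV (\<lambda>_. borel)) (\<lambda>\<omega> i. W i \<omega>) = edges.field"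
    unfolding distr_W edges.field_def by (simp add: restrict_def)
  have m: "(\<lambda>\<omega> i. W i \<omega>) \<in> measurable M (PiM UNIV (\<lambda>_. borel))"
    by (rule measurable_PiM_single') (auto intro: W_meas)
  have "AE w in distr M (PiM UNIV (\<lambda>_. borel)) (\<lambda>\<omega> i. W i \<omega>). balanced_path w"
    unfolding d by (rule edges.AE_balanced_path)
  from AE_distrD[OF m this] show ?thesis unfolding W_def .
qed

end

theorem theorem2:
  fixes M :: "'a measure"
    and X Y :: "edge \<Rightarrow> 'a \<Rightarrow> real"
    and L :: "real measure"
    and p_o p_v :: real
  assumes "prob_space M"
    and indep_X: "prob_space.indep_vars M (\<lambda>_. borel) X lattice_edges"
    and indep_Y: "prob_space.indep_vars M (\<lambda>_. borel) Y lattice_edges"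
    and indep_XY: "prob_space.indep_var M
          (PiM lattice_edges (\<lambda>_. borel)) (\<lambda>\<omega>. \<lambda>e\<in>lattice_edges. X e \<omega>)
          (PiM lattice_edges (\<lambda>_. borel)) (\<lambda>\<omega>. \<lambda>e\<in>lattice_edges. Y e \<omega>)"
    and law_X: "\<And>e. e \<in> lattice_edges \<Longrightarrow> distr M borel (X e) = L"
    and L_nontrivial: "L \<noteq> return borel 0"
    and values_Y: "\<And>e \<omega>. e \<in> lattice_edges \<Longrightarrow> \<omega> \<in> space M \<Longrightarrow> Y e \<omega> \<in> {-1, 1}"
    and Y_horizontal: "\<And>e. e \<in> horizontal_edges \<Longrightarrow>
          measure M {\<omega> \<in> space M. Y e \<omega> = 1} = p_o"
    and Y_vertical: "\<And>e. e \<in> vertical_edges \<Longrightarrow>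
          measure M {\<omega> \<in> space M. Y e \<omega> = 1} = p_v"
    and p_o: "0 < p_o" "p_o < 1"
    and p_v: "0 < p_v" "p_v < 1"
  shows "AE \<omega> in M. \<exists>\<eta>\<in>self_avoiding_paths.
           bounded (range (partial_sum (\<lambda>e. X e \<omega>) (\<lambda>e. Y e \<omega>) \<eta>)) \<and>
           accumulation_point (partial_sum (\<lambda>e. X e \<omega>) (\<lambda>e. Y e \<omega>) \<eta>) 0"
proof -
  interpret environment M X Y L p_o p_v
    using assms by (intro environment.intro environment_axioms.intro)
  show ?thesis
    using AE_path by eventually_elim (rule balanced_path_partial_sums)
qed

end
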